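(* Let $F$ be a finitely generated free group. Given two lists of words in $F$, $u_{i,j}$ and $v_{i,j}$, for $i=1,\ldots,n$ and $j=1,\ldots,m_i$, it is algorithmically decidable whether there exist $\varphi\in\mathrm{Aut}(F)$ and elements $z_1,\ldots,z_n\in F$ such that $\varphi(u_{i,j})=z_i^{-1}v_{i,j}z_i$ for every $i=1,\ldots,n$ and $j=1,\ldots,m_i$.
   Context: Elements of $F$ are given as words over a fixed finite basis of $F$ and its inverses. The conjugator $z_i$ is required to be uniform within the $i$-th block (independent of $j$), but may differ from block to block. *)

theory Defs
  imports "HOL-Algebra.Bij" "HOL-Library.Nat_Bijection"
begin

text \<open>
  Decidability is decidability by total recursive functions. \<open>recursive k f\<close> says that the
  restriction of \<open>f\<close> to argument lists of length \<open>k\<close> is a total recursive function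
  \<open>\<nat>\<^sup>k \<Rightarrow> \<nat>\<close>: these form the least class that contains the initial functions and is closed under
  composition, primitive recursion and minimisation of regular functions. The last rule records
  that values at argument lists of any other length are irrelevant.
\<close>

inductive recursive :: "nat \<Rightarrow> (nat list \<Rightarrow> nat) \<Rightarrow> bool" where
  zero: "recursive k (\<lambda>xs. 0)"
| suc: "recursive 1 (\<lambda>xs. Suc (xs ! 0))"
| proj: "i < k \<Longrightarrow> recursive k (\<lambda>xs. xs ! i)"
| comp: "recursive (length gs) f \<Longrightarrow> (\<forall>g\<in>set gs. recursive k g) \<Longrightarrow>
    recursive k (\<lambda>xs. f (map (\<lambda>g. g xs) gs))"
| prim_rec: "recursive k f \<Longrightarrow> recursive (Suc (Suc k)) g \<Longrightarrow>
    recursive (Suc k) (\<lambda>xs. rec_nat (f (tl xs)) (\<lambda>y r. g (y # r # tl xs)) (hd xs))"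
| minimise: "recursive (Suc k) f \<Longrightarrow> (\<forall>xs. length xs = k \<longrightarrow> (\<exists>y. f (y # xs) = 0)) \<Longrightarrow>
    recursive k (\<lambda>xs. LEAST y. f (y # xs) = 0)"
| cong: "recursive k f \<Longrightarrow> (\<forall>xs. length xs = k \<longrightarrow> g xs = f xs) \<Longrightarrow> recursive k g"

text \<open>\<open>code\<close> is meant to be an effective injective coding of the inputs by natural numbers.\<close>

definition decidable :: "('i \<Rightarrow> nat) \<Rightarrow> 'i set \<Rightarrow> bool" where
  "decidable code A \<longleftrightarrow> recursive 1 (\<lambda>xs. of_bool (xs ! 0 \<in> code ` A))"

text \<open>
  The letter \<open>(i, False)\<close> stands for the \<open>i\<close>-th basis element (counted from 0) and \<open>(i, True)\<close>
  for its inverse. Words need not be reduced.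
\<close>

type_synonym letter = "nat \<times> bool"
type_synonym word = "letter list"

definition words :: "nat \<Rightarrow> word set" where
  "words r = lists ({..<r} \<times> UNIV)"

definition reduced :: "word \<Rightarrow> bool" where
  "reduced = successively (\<lambda>(i, b) (j, c). \<not> (i = j \<and> b \<noteq> c))"

definition letter_val :: "('a, 'b) monoid_scheme \<Rightarrow> 'a list \<Rightarrow> letter \<Rightarrow> 'a" where
  "letter_val F X = (\<lambda>(i, b). if b then inv\<^bsub>F\<^esub> (X ! i) else X ! i)"

definition word_val :: "('a, 'b) monoid_scheme \<Rightarrow> 'a list \<Rightarrow> word \<Rightarrow> 'a" where
  "word_val F X w = foldr (\<lambda>l g. letter_val F X l \<otimes>\<^bsub>F\<^esub> g) w \<one>\<^bsub>F\<^esub>"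

text \<open>
  \<open>F\<close> is a free group with finite basis \<open>X\<close>: every element is the value of exactly one reduced
  word. In particular the entries of \<open>X\<close> are distinct, and the rank is \<open>length X\<close>.
\<close>

definition free_group_basis :: "('a, 'b) monoid_scheme \<Rightarrow> 'a list \<Rightarrow> bool" where
  "free_group_basis F X \<longleftrightarrow> group F \<and> set X \<subseteq> carrier F \<and>
     bij_betw (word_val F X) {w \<in> words (length X). reduced w} (carrier F)"

definition word_code :: "word \<Rightarrow> nat" where
  "word_code w = list_encode (map (\<lambda>(i, b). 2 * i + of_bool b) w)"

definition blocks_code :: "word list list \<Rightarrow> nat" where
  "blocks_code us = list_encode (map (\<lambda>ws. list_encode (map word_code ws)) us)"

definition instance_code :: "word list list \<times> word list list \<Rightarrow> nat" where
  "instance_code = (\<lambda>(us, vs). prod_encode (blocks_code us, blocks_code vs))"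

text \<open>
  A pair of families \<open>u\<^sub>i\<^sub>j\<close>, \<open>v\<^sub>i\<^sub>j\<close> of words is a pair of lists of blocks of the same shape. The
  number of blocks and their sizes are part of the input.
\<close>

definition instances :: "nat \<Rightarrow> (word list list \<times> word list list) set" where
  "instances r = {(us, vs). us \<in> lists (lists (words r)) \<and> vs \<in> lists (lists (words r)) \<and>
     map length us = map length vs}"

end

theory Submission
  imports Defs "HOL-Combinatorics.Permutations"
begin

text \<open>
  The semidirect product of \<open>Aut(F)\<close> and \<open>F\<^sup>n\<close> acts on the families \<open>u\<^sub>i\<^sub>j\<close>; the height of a family
  is the sum of the lengths of its reduced words. A word of the \<open>i\<close>-th block is seen as a loop in
  the rose, based at the \<open>i\<close>-th marked point. A Whitehead move blows up the vertex of the rose into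
  an edge, which separates the ends of the petals and the marked points into two sets, and then
  collapses a petal. It changes the height by the number of turns that are cut minus the number of
  passages through the petal.

  Peak reduction: since the number of cut turns is submodular, the two moves at a peak can be
  compared through a third one that is compatible with both, and for compatible moves the peak is
  avoided by exchanging edges of spanning trees in a graph with three vertices. Since Whitehead
  moves generate the group, by Nielsen reduction of the images of a basis, two families in one
  orbit are joined by moves whose heights never exceed those of the end points. Splitting a
  move into an automorphism from a finite table and conjugations of single blocks by letters
  raises the height in a controlled way only. So the orbit can be searched within the finite set of
  families of bounded height, until no new family appears.
\<close>

section \<open>The free group on countably many generators\<close>

text \<open>Neither the automorphism nor the conjugators are bounded in advance, so everything rests
  on bounding the families met on the way. Words are based loops, not cyclic words: all words of a
  block share one base point, and dragging it across an edge conjugates the whole block by one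
  letter and leaves the other blocks alone, which is the uniformity demanded of \<open>z_i\<close>.
  A move is given symmetrically, by two roses got from one graph by collapsing different edges; so
  moves are reversible, and the exchange argument only compares contractions. The new edge brings in
  a new name, hence alphabets vary and moves are taken up to a permutation of names. In one move a
  letter is multiplied by at most one letter on each side, so its image has length at most 3, and
  each conjugator is at most a letter. Thus finitely many automorphisms suffice, and for
  \<open>N\<close> words of total length at most \<open>h\<close> the splitting of a move stays
  within \<open>3 * h + 2 * N\<close>. The table of these automorphisms depends only on the rank,
  which is fixed, so it is built into the algorithm without being computed.\<close>

definition linv :: "letter \<Rightarrow> letter" where
  "linv l = (fst l, \<not> snd l)"

lemma linv_linv [simp]: "linv (linv l) = l"
  and linv_neq [simp]: "linv l \<noteq> l" "l \<noteq> linv l"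
  and fst_linv [simp]: "fst (linv l) = fst l"
  and linv_Pair [simp]: "linv (i, b) = (i, \<not> b)"
  and linv_inject [simp]: "linv l = linv m \<longleftrightarrow> l = m"
  by (auto simp: linv_def prod_eq_iff)

lemma same_index: "fst x = fst y \<Longrightarrow> x = y \<or> x = linv y"
  by (cases x; cases y) (auto simp: linv_def)

lemma linv_swap: "x = linv y \<longleftrightarrow> linv x = y"
  by auto

lemma reduced_simps [simp]:
  "reduced []" "reduced [x]"
  "reduced (x # y # w) \<longleftrightarrow> y \<noteq> linv x \<and> reduced (y # w)"
  by (auto simp: reduced_def linv_def split: prod.splits)

lemma reduced_ConsD: "reduced (x # w) \<Longrightarrow> reduced w"
  by (cases w) auto

lemma reduced_append:
  "reduced (u @ v) \<longleftrightarrow> reduced u \<and> reduced v \<and> (u \<noteq> [] \<longrightarrow> v \<noteq> [] \<longrightarrow> hd v \<noteq> linv (last u))"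
  by (auto simp: reduced_def successively_append_iff linv_def split: prod.splits)

section \<open>Free reduction by pushing letters\<close>

fun push :: "letter \<Rightarrow> word \<Rightarrow> word" where
  "push l [] = [l]"
| "push l (m # w) = (if m = linv l then w else l # m # w)"

lemma reduced_push: "reduced w \<Longrightarrow> reduced (push l w)"
  by (cases w) (auto dest: reduced_ConsD)

text \<open>Every letter acts on the set of reduced words as a permutation (van der Waerden's
  trick). Associativity of the product then comes from the composition of these permutations instead
  of a comparison of cancellations.\<close>

lemma push_linv: "reduced w \<Longrightarrow> push l (push (linv l) w) = w"
  by (cases w rule: remdups_adj.cases) auto

lemma push_reduced: "reduced (l # w) \<Longrightarrow> push l w = l # w"
  by (cases w) auto

lemma reduced_foldr_push: "reduced v \<Longrightarrow> reduced (foldr push u v)"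
  by (induction u) (auto intro: reduced_push)

lemma foldr_push_push: "reduced v \<Longrightarrow> foldr push (push l u) v = push l (foldr push u v)"
  by (cases u) (auto simp: push_linv[OF reduced_foldr_push])

lemma foldr_push_assoc:
  "reduced x \<Longrightarrow> foldr push (foldr push u v) x = foldr push u (foldr push v x)"
  by (induction u) (auto simp: foldr_push_push)

lemma foldr_push_reduced: "reduced (u @ v) \<Longrightarrow> foldr push u v = u @ v"
proof (induction u)
  case (Cons l u)
  then show ?case using reduced_ConsD[of l "u @ v"] by (auto simp: push_reduced)
qed auto

definition winv :: "word \<Rightarrow> word" where
  "winv w = rev (map linv w)"

lemma foldr_push_winv: "foldr push (winv w) w = []"
  by (induction w) (auto simp: winv_def)

lemma winv_simps [simp]: "winv [] = []" "winv (l # w) = winv w @ [linv l]" "winv (u @ v) = winv v @ winv u"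
  "winv (winv w) = w" "length (winv w) = length w"
  by (auto simp: winv_def rev_map o_def)

lemma reduced_winv: "reduced w \<Longrightarrow> reduced (winv w)"
proof (induction w)
  case (Cons x w)
  then show ?case
    by (cases w) (auto simp: reduced_append)
qed auto

text \<open>The group is written additively although it is not commutative: \<open>group_add\<close>
  assumes no commutativity, and \<open>sum_list\<close> then serves as the ordered product. The
  alphabet is infinite so that fresh letters for blown-up edges are always available.\<close>

typedef fg = "{w. reduced w}" morphisms rep_fg abs_fg
  by (rule exI[of _ "[]"]) simp

lemma reduced_rep [simp]: "reduced (rep_fg g)"
  using rep_fg by auto

lemma rep_abs [simp]: "reduced w \<Longrightarrow> rep_fg (abs_fg w) = w"
  by (simp add: abs_fg_inverse)

instantiation fg :: group_add
begin
definition "0 = abs_fg []"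
definition "g + h = abs_fg (foldr push (rep_fg g) (rep_fg h))"
definition "- g = abs_fg (winv (rep_fg g))"
definition "g - h = g + - (h :: fg)"
instance
proof
  fix a b c :: fg
  show "a + b + c = a + (b + c)"
    by (simp add: plus_fg_def reduced_foldr_push foldr_push_assoc)
  show "0 + a = a" by (simp add: plus_fg_def zero_fg_def rep_fg_inverse)
  show "a + 0 = a" using foldr_push_reduced[of "rep_fg a" "[]"]
    by (simp add: plus_fg_def zero_fg_def rep_fg_inverse)
  show "- a + a = 0"
    by (simp add: plus_fg_def zero_fg_def uminus_fg_def reduced_winv foldr_push_winv)
  show "a + - b = a - b" by (simp add: minus_fg_def)
qed
end

lemma rep_zero [simp]: "rep_fg 0 = []"
  by (simp add: zero_fg_def)

lemma rep_plus: "rep_fg (g + h) = foldr push (rep_fg g) (rep_fg h)"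
  by (simp add: plus_fg_def reduced_foldr_push)

lemma rep_uminus: "rep_fg (- g) = winv (rep_fg g)"
  by (simp add: uminus_fg_def reduced_winv)

definition gl :: "letter \<Rightarrow> fg" where
  "gl l = abs_fg [l]"

definition gw :: "word \<Rightarrow> fg" where
  "gw w = sum_list (map gl w)"

lemma rep_gl [simp]: "rep_fg (gl l) = [l]"
  by (simp add: gl_def)

lemma gw_simps [simp]: "gw [] = 0" "gw (l # w) = gl l + gw w" "gw (u @ v) = gw u + gw v"
  by (auto simp: gw_def)

lemma gl_linv [simp]: "gl (linv l) = - gl l"
  by (simp add: gl_def uminus_fg_def)

lemma rep_gw: "rep_fg (gw w) = foldr push w []"
  by (induction w) (auto simp: rep_plus)

lemma rep_gw_reduced [simp]: "reduced w \<Longrightarrow> rep_fg (gw w) = w"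
  using foldr_push_reduced[of w "[]"] by (simp add: rep_gw)

lemma gw_rep [simp]: "gw (rep_fg g) = g"
  by (metis rep_fg_inject rep_gw_reduced reduced_rep)

lemma gl_inject [simp]: "gl l = gl m \<longleftrightarrow> l = m"
  by (metis list.inject rep_gl)

lemma gw_inject: "reduced u \<Longrightarrow> reduced v \<Longrightarrow> gw u = gw v \<longleftrightarrow> u = v"
  by (metis rep_gw_reduced)

definition red :: "word \<Rightarrow> word" where
  "red w = foldr push w []"

lemma rep_gw_red: "rep_fg (gw w) = red w"
  by (simp add: red_def rep_gw)

lemma gw_red [simp]: "gw (red w) = gw w"
  by (metis gw_rep rep_gw_red)

text \<open>The subgroup generated by the letters with index in \<open>I\<close>, read off from the
  reduced word.\<close>

definition gset :: "nat set \<Rightarrow> fg set" where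
  "gset I = {g. fst ` set (rep_fg g) \<subseteq> I}"

lemma set_push: "set (push l w) \<subseteq> insert l (set w)"
  by (cases w) auto

lemma set_foldr_push: "set (foldr push u v) \<subseteq> set u \<union> set v"
proof (induction u)
  case (Cons l u)
  then show ?case using set_push[of l "foldr push u v"] by fastforce
qed simp

lemma gset_simps [simp]: "0 \<in> gset I" "gl l \<in> gset I \<longleftrightarrow> fst l \<in> I"
  "- g \<in> gset I \<longleftrightarrow> g \<in> gset I"
  by (auto simp: gset_def rep_uminus winv_def image_image)

lemma gset_add [intro]: "g \<in> gset I \<Longrightarrow> h \<in> gset I \<Longrightarrow> g + h \<in> gset I"
proof -
  assume "g \<in> gset I" "h \<in> gset I"
  then have "fst ` (set (rep_fg g) \<union> set (rep_fg h)) \<subseteq> I"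
    by (simp add: gset_def image_Un)
  moreover have "set (rep_fg (g + h)) \<subseteq> set (rep_fg g) \<union> set (rep_fg h)"
    by (simp add: rep_plus set_foldr_push)
  ultimately show ?thesis
    unfolding gset_def mem_Collect_eq by (meson image_mono order_trans)
qed

lemma gset_diff [intro]: "g \<in> gset I \<Longrightarrow> h \<in> gset I \<Longrightarrow> g - h \<in> gset I"
  using gset_add[of g I "- h"] by simp

lemma gset_gw: "fst ` set w \<subseteq> I \<Longrightarrow> gw w \<in> gset I"
  by (induction w) (auto simp del: gset_def)

section \<open>Homomorphisms given by the images of letters\<close>

definition symf :: "(letter \<Rightarrow> 'a::group_add) \<Rightarrow> bool" where
  "symf f \<longleftrightarrow> (\<forall>l. f (linv l) = - f l)"

definition ext :: "(letter \<Rightarrow> 'a::group_add) \<Rightarrow> fg \<Rightarrow> 'a" where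
  "ext f g = sum_list (map f (rep_fg g))"

lemma symfD: "symf f \<Longrightarrow> f (linv l) = - f l"
  unfolding symf_def by (erule spec)

lemma symfI: "(\<And>l. f (linv l) = - f l) \<Longrightarrow> symf f"
  unfolding symf_def by (rule allI)

text \<open>Here compatibility of \<open>f\<close> with inversion enters: the sum of the images does
  not notice a cancellation in \<open>push\<close>. This makes \<open>ext f\<close> a homomorphism,
  the universal property of the free group.\<close>

lemma sum_list_push:
  "symf f \<Longrightarrow> sum_list (map f (push l w)) = f l + sum_list (map f w)"
proof (cases w)
  case (Cons m v)
  assume "symf f"
  then have "f l + f (linv l) = 0" by (simp add: symfD)
  then have "f l + (f (linv l) + x) = x" for x
    by (metis add.assoc add_0)
  then show ?thesis using Cons by simp
qed simp

lemma sum_list_foldr_push: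
  "symf f \<Longrightarrow> sum_list (map f (foldr push u v)) = sum_list (map f u) + sum_list (map f v)"
  by (induction u) (auto simp: sum_list_push add.assoc)

lemma ext_add: "symf f \<Longrightarrow> ext f (g + h) = ext f g + ext f h"
  by (simp add: ext_def rep_plus sum_list_foldr_push)

lemma ext_zero [simp]: "ext f 0 = 0"
  by (simp add: ext_def)

lemma ext_uminus: "symf f \<Longrightarrow> ext f (- g) = - ext f g"
  by (metis ext_add ext_zero add.right_inverse neg_eq_iff_add_eq_0 minus_unique)

lemma ext_diff: "symf f \<Longrightarrow> ext f (g - h) = ext f g - ext f h"
  by (metis ext_add ext_uminus diff_conv_add_uminus)

lemma ext_gl [simp]: "ext f (gl l) = f l"
  by (simp add: ext_def)

lemma ext_gw: "symf f \<Longrightarrow> ext f (gw w) = sum_list (map f w)"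
  by (induction w) (auto simp: ext_add)

lemma symf_comp: "symf f \<Longrightarrow> symf g \<Longrightarrow> symf (\<lambda>l. ext f (g l))"
  by (simp add: symf_def ext_uminus[unfolded symf_def])

lemma ext_comp: assumes "symf f" "symf g" shows "ext (\<lambda>l. ext f (g l)) x = ext f (ext g x)"
proof -
  have "ext (\<lambda>l. ext f (g l)) (gw w) = ext f (ext g (gw w))" for w
    by (induction w) (simp_all add: ext_add assms symf_comp)
  then show ?thesis by (metis gw_rep)
qed

lemma ext_cong: "x \<in> gset I \<Longrightarrow> (\<And>l. fst l \<in> I \<Longrightarrow> f l = g l) \<Longrightarrow> ext f x = ext g x"
  unfolding ext_def gset_def by (rule arg_cong[where f=sum_list]) auto

lemma symf_gl [simp]: "symf gl"
  by (simp add: symf_def)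

lemma ext_gl_id [simp]: "ext gl x = x"
  by (metis gw_def gw_rep ext_def)

lemma ext_gset: "x \<in> gset I \<Longrightarrow> (\<And>l. fst l \<in> I \<Longrightarrow> f l \<in> gset J) \<Longrightarrow> ext f x \<in> gset J"
proof -
  assume x: "x \<in> gset I" and f: "\<And>l. fst l \<in> I \<Longrightarrow> f l \<in> gset J"
  have "fst ` set w \<subseteq> I \<Longrightarrow> sum_list (map f w) \<in> gset J" for w
    by (induction w) (auto intro!: gset_add f)
  then show ?thesis using x by (auto simp: ext_def gset_def)
qed

section \<open>Reduced paths in labelled graphs\<close>

text \<open>
  A graph is given by the map \<open>v\<close> that sends each oriented edge to its origin. Collapsing the
  non-loop edge \<open>e\<close> deletes the letters of index \<open>e\<close> from every path.
\<close>

fun path :: "(letter \<Rightarrow> 'v) \<Rightarrow> 'v \<Rightarrow> word \<Rightarrow> 'v \<Rightarrow> bool" where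
  "path v s [] t \<longleftrightarrow> s = t"
| "path v s (x # w) t \<longleftrightarrow> s = v x \<and> path v (v (linv x)) w t"

definition del :: "nat \<Rightarrow> word \<Rightarrow> word" where
  "del e w = filter (\<lambda>x. fst x \<noteq> e) w"

definition cnt :: "nat \<Rightarrow> word \<Rightarrow> nat" where
  "cnt e w = length (filter (\<lambda>x. fst x = e) w)"

definition nonloop :: "(letter \<Rightarrow> 'v) \<Rightarrow> nat \<Rightarrow> bool" where
  "nonloop v e \<longleftrightarrow> v (e, False) \<noteq> v (e, True)"

lemma nonloopD: "nonloop v (fst x) \<Longrightarrow> v (linv x) \<noteq> v x"
  by (cases x; cases "snd x") (auto simp: nonloop_def)

lemma del_simps [simp]: "del e [] = []"
  "del e (x # w) = (if fst x = e then del e w else x # del e w)"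
  by (auto simp: del_def)

lemma cnt_simps [simp]: "cnt e [] = 0" "cnt e (u @ w) = cnt e u + cnt e w"
  "cnt e (x # w) = (if fst x = e then Suc (cnt e w) else cnt e w)"
  by (auto simp: cnt_def)

lemma length_del: "length (del e w) + cnt e w = length w"
  by (induction w) auto

lemma cnt_del: "e \<noteq> f \<Longrightarrow> cnt e (del f w) = cnt e w"
  by (induction w) auto

lemma del_commute: "del e (del f w) = del f (del e w)"
  by (simp add: del_def conj_commute)

lemma set_del: "set (del e w) = {x \<in> set w. fst x \<noteq> e}"
  by (auto simp: del_def)

lemma path_two:
  assumes "path v s (x # y # w) t" "reduced (x # y # w)" "nonloop v (fst x)"
  shows "fst y \<noteq> fst x"
proof
  assume "fst y = fst x"
  then have "y = x" using same_index[of y x] assms(2) by auto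
  then show False using assms nonloopD[of v x] by auto
qed

text \<open>Deleting a passage through \<open>e\<close> creates a cancelling pair only in a piece
  \<open>x e x^-1\<close>, but there \<open>e\<close> starts and ends at the same vertex. Two
  successive passages are excluded by \<open>path_two\<close>.\<close>

lemma reduced_del:
  "path v s W t \<Longrightarrow> reduced W \<Longrightarrow> nonloop v e \<Longrightarrow> reduced (del e W)"
proof (induction W arbitrary: s)
  case (Cons x W)
  have IH: "reduced (del e W)"
    using Cons.IH[of "v (linv x)"] Cons.prems by (auto dest: reduced_ConsD)
  show ?case
  proof (cases "fst x = e")
    case True
    then show ?thesis using IH by simp
  next
    case x: False
    show ?thesis
    proof (cases W)
      case Nil
      then show ?thesis using x by simp
    next
      case W: (Cons y W')
      show ?thesis
      proof (cases "fst y = e")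
        case False
        then show ?thesis using W x IH Cons.prems by auto
      next
        case y: True
        show ?thesis
        proof (cases W')
          case Nil
          then show ?thesis using W x y by simp
        next
          case W': (Cons z W'')
          have z: "fst z \<noteq> e"
            using path_two[of v "v (linv x)" y z W'' t] Cons.prems W W' y by auto
          have "v (linv y) \<noteq> v y" using nonloopD[of v y] Cons.prems y by auto
          then have "z \<noteq> linv x" using Cons.prems W W' by auto
          then show ?thesis using W W' x y z IH by simp
        qed
      qed
    qed
  qed
qed simp

lemma path_del:
  assumes "m (v (e, False)) = m (v (e, True))"
  shows "path v s W t \<Longrightarrow> path (\<lambda>x. m (v x)) (m s) (del e W) (m t)"
proof (induction W arbitrary: s)
  case (Cons x W)
  have "m (v x) = m (v (linv x))" if "fst x = e"
    using assms that by (cases x; cases "snd x") auto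
  then show ?case using Cons by (auto; metis)
qed simp

lemma path_cong: "(\<And>x. x \<in> set W \<Longrightarrow> v x = v' x \<and> v (linv x) = v' (linv x)) \<Longrightarrow>
  path v s W t \<longleftrightarrow> path v' s W t"
  by (induction W arbitrary: s) auto

section \<open>Lifting loops through a collapse\<close>

definition conn :: "(letter \<Rightarrow> 'v) \<Rightarrow> nat \<Rightarrow> 'v \<Rightarrow> 'v \<Rightarrow> word" where
  "conn v e s t = (if s = t then [] else if s = v (e, False) then [(e, False)] else [(e, True)])"

text \<open>The inverse of collapsing \<open>e\<close>: wherever two consecutive letters, or a
  letter and the base point, have been separated, the missing passage through \<open>e\<close> is
  put back.\<close>

primrec lift :: "(letter \<Rightarrow> 'v) \<Rightarrow> nat \<Rightarrow> 'v \<Rightarrow> word \<Rightarrow> 'v \<Rightarrow> word" where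
  "lift v e s [] t = conn v e s t"
| "lift v e s (x # w) t = conn v e s (v x) @ x # lift v e (v (linv x)) w t"

text \<open>Between two other letters a reduced path passes a non-loop edge at most once, so what
  \<open>del\<close> removes there is determined by the mismatch of the adjacent ends.\<close>

lemma lift_del:
  "path v s W t \<Longrightarrow> reduced W \<Longrightarrow> nonloop v e \<Longrightarrow> lift v e s (del e W) t = W"
proof (induction W arbitrary: s)
  case Nil
  then show ?case by (simp add: conn_def)
next
  case (Cons x W)
  have IH: "lift v e (v (linv x)) (del e W) t = W"
    using Cons.IH[of "v (linv x)"] Cons.prems by (auto dest: reduced_ConsD)
  show ?case
  proof (cases "fst x = e")
    case False
    then show ?thesis using IH Cons.prems by (simp add: conn_def)
  next
    case x: True
    have c: "u = v (linv x) \<Longrightarrow> conn v e s u = [x]" for u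
      using x Cons.prems nonloopD[of v x] by (cases x; cases "snd x") (auto simp: conn_def)
    show ?thesis
    proof (cases W)
      case Nil
      then show ?thesis using x Cons.prems c[of t] by simp
    next
      case W: (Cons y W')
      have y: "fst y \<noteq> e" using path_two[of v s x y W' t] Cons.prems W x by auto
      have "v y = v (linv x)" using Cons.prems W by simp
      then show ?thesis using W x y IH c[of "v y"] by (simp add: conn_def)
    qed
  qed
qed

lemma set_conn: "fst ` set (conn v e s t) \<subseteq> {e}"
  by (simp add: conn_def)

lemma set_lift: "fst ` set (lift v e s w t) \<subseteq> insert e (fst ` set w)"
proof (induction w arbitrary: s)
  case Nil
  then show ?case using set_conn[of v e s t] by simp
next
  case (Cons x w)
  then show ?case using set_conn[of v e s "v x"] by (simp add: image_Un) blast
qed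

lemma del_append [simp]: "del e (u @ w) = del e u @ del e w"
  by (simp add: del_def)

lemma del_conn [simp]: "del e (conn v e s t) = []"
  by (simp add: conn_def)

lemma del_lift: "e \<notin> fst ` set w \<Longrightarrow> del e (lift v e s w t) = w"
  by (induction w arbitrary: s) auto

lemma reduced_lift:
  "reduced w \<Longrightarrow> e \<notin> fst ` set w \<Longrightarrow> reduced (lift v e s w t)"
proof (induction w arbitrary: s)
  case Nil
  then show ?case by (simp add: conn_def)
next
  case (Cons x w)
  have IH: "reduced (lift v e (v (linv x)) w t)"
    using Cons by (auto dest: reduced_ConsD)
  have "reduced (x # lift v e (v (linv x)) w t)"
  proof (cases w)
    case Nil
    then show ?thesis using Cons.prems by (auto simp: conn_def linv_def)
  next
    case (Cons y w')
    then show ?thesis using IH Cons.prems by (auto simp: conn_def linv_def)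
  qed
  then show ?case using Cons.prems by (auto simp: conn_def linv_def)
qed

lemma path_append: "path v s (u @ w) t \<longleftrightarrow> (\<exists>q. path v s u q \<and> path v q w t)"
  by (induction u arbitrary: s) auto

text \<open>Here \<open>V\<close> is the vertex set and \<open>m\<close> the map of vertices induced
  by the collapse; the first hypothesis says that \<open>m\<close> glues at most the two ends of
  \<open>e\<close>. A proper subset \<open>V\<close> is needed because the three-vertex graph of the
  peak argument sits inside the four pairs of booleans.\<close>

lemma path_lift:
  assumes V: "\<And>p q. p \<in> V \<Longrightarrow> q \<in> V \<Longrightarrow> m p = m q \<Longrightarrow>
      p = q \<or> p = v (e, False) \<and> q = v (e, True) \<or> p = v (e, True) \<and> q = v (e, False)"
    and v: "\<And>x. v x \<in> V"
  shows "s \<in> V \<Longrightarrow> t \<in> V \<Longrightarrow> path (\<lambda>x. m (v x)) (m s) w (m t) \<Longrightarrow> path v s (lift v e s w t) t"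
proof -
  have conn: "path v p (conn v e p q) q" if "p \<in> V" "q \<in> V" "m p = m q" for p q
    using V[OF that] by (auto simp: conn_def)
  assume "t \<in> V"
  then show "s \<in> V \<Longrightarrow> path (\<lambda>x. m (v x)) (m s) w (m t) \<Longrightarrow> path v s (lift v e s w t) t"
  proof (induction w arbitrary: s)
    case Nil
    then show ?case using conn by simp
  next
    case (Cons x w)
    have "path v (v (linv x)) (lift v e (v (linv x)) w t) t"
      using Cons v by simp
    then show ?case using conn[of s "v x"] Cons.prems v by (auto simp: path_append)
  qed
qed

text \<open>The number of turns, including the two at the base point, whose sides lie in different
  classes of the bipartition \<open>v\<close>.\<close>

primrec cutf :: "(letter \<Rightarrow> bool) \<Rightarrow> bool \<Rightarrow> word \<Rightarrow> bool \<Rightarrow> nat" where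
  "cutf v s [] t = of_bool (s \<noteq> t)"
| "cutf v s (x # w) t = of_bool (s \<noteq> v x) + cutf v (v (linv x)) w t"

lemma cnt_lift: "e \<notin> fst ` set w \<Longrightarrow> cnt e (lift v e s w t) = cutf v s w t"
  by (induction w arbitrary: s) (auto simp: conn_def)

lemma cutf_cong: "(\<And>x. x \<in> set w \<Longrightarrow> v x = v' x \<and> v (linv x) = v' (linv x)) \<Longrightarrow>
  cutf v s w t = cutf v' s w t"
  by (induction w arbitrary: s) auto

text \<open>The inequality holds turn by turn: a turn cut by opposite corners of two bipartitions is
  cut at least as often by the bipartitions themselves. The parameters \<open>\<sigma>\<close> and
  \<open>\<tau>\<close> select the corner, so that both diagonals are covered.\<close>

lemma cutf_submodular:
  "cutf (\<lambda>x. vA x = \<sigma> \<and> vB x = \<tau>) (sA = \<sigma> \<and> sB = \<tau>) w (tA = \<sigma> \<and> tB = \<tau>) +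
   cutf (\<lambda>x. vA x \<noteq> \<sigma> \<and> vB x \<noteq> \<tau>) (sA \<noteq> \<sigma> \<and> sB \<noteq> \<tau>) w (tA \<noteq> \<sigma> \<and> tB \<noteq> \<tau>)
   \<le> cutf vA sA w tA + cutf vB sB w tB"
proof (induction w arbitrary: sA sB)
  case Nil
  then show ?case
    by (cases sA; cases sB; cases tA; cases tB; cases \<sigma>; cases \<tau>; simp)
next
  case (Cons x w)
  have "of_bool ((sA = \<sigma> \<and> sB = \<tau>) \<noteq> (vA x = \<sigma> \<and> vB x = \<tau>)) +
    of_bool ((sA \<noteq> \<sigma> \<and> sB \<noteq> \<tau>) \<noteq> (vA x \<noteq> \<sigma> \<and> vB x \<noteq> \<tau>))
    \<le> (of_bool (sA \<noteq> vA x) + of_bool (sB \<noteq> vB x) :: nat)"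
    by (cases sA; cases sB; cases "vA x"; cases "vB x"; cases \<sigma>; cases \<tau>; simp)
  then show ?case using Cons[of "vA (linv x)" "vB (linv x)"] by simp
qed

section \<open>States and steps\<close>

text \<open>
  A state is a family of reduced words over the alphabet \<open>I\<close>; the word with key \<open>(i, j)\<close> lies in
  the block \<open>i\<close>. It is thought of as a family of loops in a rose with petals \<open>I\<close>. Every block
  has a base point; a step blows up the vertex of the rose and separates the base points and the
  ends of the petals into two groups, and then collapses another edge \<open>f\<close>.
\<close>

type_synonym key = "nat \<times> nat"
type_synonym state = "nat set \<times> (key \<Rightarrow> word)"

definition valid :: "state \<Rightarrow> bool" where
  "valid x \<longleftrightarrow> finite (fst x) \<and> (\<forall>k. reduced (snd x k) \<and> fst ` set (snd x k) \<subseteq> fst x)"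

definition graph :: "nat set \<Rightarrow> (letter \<Rightarrow> 'v) \<Rightarrow> (nat \<Rightarrow> 'v) \<Rightarrow> (key \<Rightarrow> word) \<Rightarrow> bool" where
  "graph J v p W \<longleftrightarrow> valid (J, W) \<and> (\<forall>k. path v (p (fst k)) (W k) (p (fst k)))"

definition collapse :: "nat \<Rightarrow> state \<Rightarrow> state" where
  "collapse e x = (fst x - {e}, \<lambda>k. del e (snd x k))"

text \<open>Booleans as vertices make this a graph with two vertices. The loops are reduced in the
  graph itself, so both roses receive reduced words by mere deletion of letters. The case
  \<open>e = f\<close> is the trivial step.\<close>

definition step0 :: "state \<Rightarrow> state \<Rightarrow> bool" where
  "step0 x y \<longleftrightarrow> (\<exists>J (v :: letter \<Rightarrow> bool) p W e f. graph J v p W \<and> e \<in> J \<and> f \<in> J \<and>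
     nonloop v e \<and> nonloop v f \<and> x = collapse e (J, W) \<and> y = collapse f (J, W))"

definition mapl :: "(nat \<Rightarrow> nat) \<Rightarrow> letter \<Rightarrow> letter" where
  "mapl \<rho> l = (\<rho> (fst l), snd l)"

definition rename :: "(nat \<Rightarrow> nat) \<Rightarrow> state \<Rightarrow> state" where
  "rename \<rho> x = (\<rho> ` fst x, \<lambda>k. map (mapl \<rho>) (snd x k))"

definition ren :: "state \<Rightarrow> state \<Rightarrow> bool" where
  "ren x y \<longleftrightarrow> (\<exists>\<rho>. bij \<rho> \<and> y = rename \<rho> x)"

text \<open>The new rose carries the name of the blown-up edge in place of that of the collapsed
  one; the renaming allows the return to a given alphabet.\<close>

definition step :: "state \<Rightarrow> state \<Rightarrow> bool" where
  "step x y \<longleftrightarrow> (\<exists>y'. step0 x y' \<and> ren y' y)"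

definition height :: "key set \<Rightarrow> state \<Rightarrow> nat" where
  "height K x = (\<Sum>k\<in>K. length (snd x k))"

section \<open>Renaming of letters and its compatibility with steps\<close>

lemma mapl_simps [simp]: "fst (mapl \<rho> l) = \<rho> (fst l)" "linv (mapl \<rho> l) = mapl \<rho> (linv l)"
  "mapl id = id" "mapl \<rho> (i, b) = (\<rho> i, b)"
  by (auto simp: mapl_def linv_def)

lemma mapl_mapl: "mapl \<rho> (mapl \<tau> l) = mapl (\<rho> \<circ> \<tau>) l"
  by (simp add: mapl_def)

lemma inj_mapl: "inj \<rho> \<Longrightarrow> mapl \<rho> x = mapl \<rho> y \<longleftrightarrow> x = y"
  by (auto simp: mapl_def prod_eq_iff inj_eq)

lemma reduced_mapl: "inj \<rho> \<Longrightarrow> reduced (map (mapl \<rho>) w) \<longleftrightarrow> reduced w"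
proof (induction w rule: remdups_adj.induct)
  case (3 x y w)
  then show ?case by (cases "x = y") (auto simp: inj_mapl)
qed auto

lemma rename_rename: "rename \<rho> (rename \<tau> x) = rename (\<rho> \<circ> \<tau>) x"
  by (simp add: rename_def image_image mapl_mapl o_def)

lemma rename_id [simp]: "rename id x = x"
  by (simp add: rename_def)

lemma ren_refl [simp]: "ren x x"
  unfolding ren_def by (metis bij_id rename_id)

lemma ren_trans: "ren x y \<Longrightarrow> ren y z \<Longrightarrow> ren x z"
  unfolding ren_def by (metis bij_comp rename_rename)

lemma rename_inv: "bij \<rho> \<Longrightarrow> rename (inv_into UNIV \<rho>) (rename \<rho> x) = x"
  by (simp add: rename_rename bij_is_inj)

lemma ren_sym: "ren x y \<Longrightarrow> ren y x"
  unfolding ren_def by (metis bij_imp_bij_inv rename_inv)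

lemma height_ren: "ren x y \<Longrightarrow> height K x = height K y"
  by (auto simp: ren_def height_def rename_def)

lemma validD:
  assumes "valid x"
  shows "finite (fst x)" "reduced (snd x k)" "fst ` set (snd x k) \<subseteq> fst x"
    "l \<in> set (snd x k) \<Longrightarrow> fst l \<in> fst x"
  using assms unfolding valid_def by blast+

lemma validI:
  assumes "finite (fst x)" "\<And>k. reduced (snd x k)" "\<And>k l. l \<in> set (snd x k) \<Longrightarrow> fst l \<in> fst x"
  shows "valid x"
  using assms unfolding valid_def by blast

lemma valid_rename: "bij \<rho> \<Longrightarrow> valid x \<Longrightarrow> valid (rename \<rho> x)"
  by (rule validI) (auto simp: rename_def reduced_mapl bij_is_inj dest: validD)

lemma rename_cong: "valid x \<Longrightarrow> (\<And>i. i \<in> fst x \<Longrightarrow> \<rho> i = \<tau> i) \<Longrightarrow> rename \<rho> x = rename \<tau> x"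
proof -
  assume x: "valid x" and eq: "\<And>i. i \<in> fst x \<Longrightarrow> \<rho> i = \<tau> i"
  have "map (mapl \<rho>) (snd x k) = map (mapl \<tau>) (snd x k)" for k
    using validD(4)[OF x] eq by (simp add: mapl_def)
  moreover have "\<rho> ` fst x = \<tau> ` fst x" by (rule image_cong) (simp_all add: eq)
  ultimately show ?thesis unfolding rename_def by presburger
qed

lemma valid_ren: "valid x \<Longrightarrow> ren x y \<Longrightarrow> valid y"
  by (auto simp: ren_def valid_rename)

lemma path_mapl: "path (\<lambda>x. v (mapl \<tau> x)) s W t \<longleftrightarrow> path v s (map (mapl \<tau>) W) t"
  by (induction W arbitrary: s) auto

lemma del_mapl: "inj \<tau> \<Longrightarrow> del (\<tau> e) (map (mapl \<tau>) W) = map (mapl \<tau>) (del e W)"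
  by (induction W) (auto simp: inj_eq)

lemma rename_collapse: "inj \<tau> \<Longrightarrow> rename \<tau> (collapse e x) = collapse (\<tau> e) (rename \<tau> x)"
  by (simp add: rename_def collapse_def del_mapl image_set_diff)

lemma graph_rename:
  assumes "bij \<tau>" "graph J v p W"
  shows "graph (\<tau> ` J) (\<lambda>x. v (mapl (inv_into UNIV \<tau>) x)) p (\<lambda>k. map (mapl \<tau>) (W k))"
proof -
  have "map (mapl (inv_into UNIV \<tau>)) (map (mapl \<tau>) w) = w" for w
    using assms by (simp add: mapl_mapl o_def bij_is_inj mapl_def)
  then show ?thesis
    using assms valid_rename[of \<tau> "(J, W)"]
    by (simp add: graph_def path_mapl rename_def del: map_map)
qed

lemma step0_rename: assumes "bij \<tau>" "step0 x y" shows "step0 (rename \<tau> x) (rename \<tau> y)"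
proof -
  obtain J and v :: "letter \<Rightarrow> bool" and p W e f where *: "graph J v p W" "e \<in> J" "f \<in> J"
     "nonloop v e" "nonloop v f" "x = collapse e (J, W)" "y = collapse f (J, W)"
    using assms unfolding step0_def by blast
  let ?v = "\<lambda>x. v (mapl (inv_into UNIV \<tau>) x)"
  have "nonloop ?v (\<tau> i) \<longleftrightarrow> nonloop v i" for i
    using assms by (simp add: nonloop_def bij_is_inj)
  then show ?thesis
    unfolding step0_def using graph_rename[OF assms(1) *(1)] * bij_is_inj[OF assms(1)]
    by (intro exI[of _ "\<tau> ` J"] exI[of _ ?v] exI[of _ p] exI[of _ "\<lambda>k. map (mapl \<tau>) (W k)"]
        exI[of _ "\<tau> e"] exI[of _ "\<tau> f"]) (simp_all add: rename_collapse, simp add: rename_def)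
qed

lemma step0_sym: "step0 x y \<Longrightarrow> step0 y x"
  unfolding step0_def by metis

lemma valid_collapse: "graph J v p W \<Longrightarrow> nonloop v e \<Longrightarrow> valid (collapse e (J, W))"
  by (fastforce simp: graph_def valid_def collapse_def set_del intro: reduced_del)

lemma step0_valid: "step0 x y \<Longrightarrow> valid x"
  unfolding step0_def using valid_collapse by blast

lemma step_sym: "step x y \<Longrightarrow> step y x"
proof -
  assume "step x y"
  then obtain y' \<rho> where *: "step0 x y'" "bij \<rho>" "y = rename \<rho> y'" by (auto simp: step_def ren_def)
  then have "step0 y (rename \<rho> x)" by (simp add: step0_rename step0_sym)
  moreover have "ren x (rename \<rho> x)" using * unfolding ren_def by blast
  then have "ren (rename \<rho> x) x" by (rule ren_sym)
  ultimately show ?thesis unfolding step_def by blast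
qed

lemma step_valid: "step x y \<Longrightarrow> valid x" "step x y \<Longrightarrow> valid y"
  using step_sym step0_valid unfolding step_def by blast+

lemma step_card: "step x y \<Longrightarrow> card (fst x) = card (fst y)"
  by (auto simp: step_def step0_def ren_def collapse_def rename_def card_image bij_is_inj
      inj_on_subset graph_def valid_def dest: bij_is_inj inj_on_subset[of _ UNIV])

lemma step_ren: "step x y \<Longrightarrow> ren y z \<Longrightarrow> step x z"
  unfolding step_def using ren_trans by blast

lemma ren_step: "ren x y \<Longrightarrow> step y z \<Longrightarrow> step x z"
  by (meson step_sym step_ren ren_sym)

lemma path_const: "path (\<lambda>x. c) c w c"
  by (induction w) auto

lemma graph_lift:
  fixes v :: "letter \<Rightarrow> bool" and p :: "nat \<Rightarrow> bool"
  assumes "valid (I, w)" "e \<notin> I" "nonloop v e"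
    and W_def: "W = (\<lambda>k. lift v e (p (fst k)) (w k) (p (fst k)))"
  shows "graph (insert e I) v p W" "collapse e (insert e I, W) = (I, w)"
proof -
  have *: "finite I" "reduced (w k)" "fst ` set (w k) \<subseteq> I" "e \<notin> fst ` set (w k)" for k
    using validD(1)[OF assms(1)] validD(2,3)[OF assms(1), of k] assms(2) by auto
  have "path v (p (fst k)) (W k) (p (fst k))" for k
    unfolding W_def
    by (rule path_lift[where V = UNIV and m = "\<lambda>x. ()"])
       (use assms in \<open>auto simp: nonloop_def intro: path_const\<close>)
  then show "graph (insert e I) v p W"
    using * reduced_lift set_lift unfolding graph_def valid_def W_def fst_conv snd_conv
    by (meson finite_insert insert_mono order_trans)
  show "collapse e (insert e I, W) = (I, w)"
    using * assms(2) by (auto simp: collapse_def W_def del_lift)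
qed

lemma step_lift:
  fixes v :: "letter \<Rightarrow> bool"
  assumes "valid (I, w)" "e \<notin> I" "nonloop v e" "nonloop v f" "f \<in> insert e I"
  shows "step0 (I, w) (collapse f (insert e I, \<lambda>k. lift v e (p (fst k)) (w k) (p (fst k))))"
proof -
  let ?W = "\<lambda>k. lift v e (p (fst k)) (w k) (p (fst k))"
  have "graph (insert e I) v p ?W" "collapse e (insert e I, ?W) = (I, w)"
    by (rule graph_lift; use assms in simp)+
  then show ?thesis
  unfolding step0_def
  using assms
  by (intro exI[of _ "insert e I"] exI[of _ v] exI[of _ p] exI[of _ e] exI[of _ f]
      exI[of _ ?W]) simp
qed

text \<open>A dangling edge, one end of which meets no petal and no marked point, can be blown up
  and collapsed at once. So the identity is a step, and a renaming may follow it.\<close>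

lemma ren_imp_step: assumes "valid x" "ren x y" shows "step x y"
proof -
  obtain e where e: "e \<notin> fst x" using assms(1) ex_new_if_finite[of "fst x"] by (auto simp: valid_def)
  let ?v = "\<lambda>x. x = (e, False)"
  have "step0 x (collapse e (insert e (fst x), \<lambda>k. lift ?v e False (snd x k) False))"
    using step_lift[of "fst x" "snd x" e ?v e "\<lambda>_. False"] assms e by (simp add: nonloop_def)
  then have "step0 x x"
    using graph_lift(2)[of "fst x" "snd x" e ?v _ "\<lambda>_. False"] assms e by (simp add: nonloop_def)
  then show ?thesis using assms unfolding step_def by blast
qed

text \<open>The name of the blown-up edge is immaterial: transposing it with a prescribed fresh
  \<open>\<alpha>\<close> fixes the family, in which neither name occurs. Only so can different
  moves be compared inside one graph.\<close>

lemma step_normal_form: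
  assumes "step (I, w) y" "\<alpha> \<notin> I"
  obtains v :: "letter \<Rightarrow> bool" and p f where "nonloop v \<alpha>" "f \<in> insert \<alpha> I" "nonloop v f"
    "ren (collapse f (insert \<alpha> I, \<lambda>k. lift v \<alpha> (p (fst k)) (w k) (p (fst k)))) y"
proof -
  obtain y' where y': "step0 (I, w) y'" "ren y' y" using assms by (auto simp: step_def)
  then obtain J and v :: "letter \<Rightarrow> bool" and p W e f where *: "graph J v p W" "e \<in> J" "f \<in> J"
     "nonloop v e" "nonloop v f" "(I, w) = collapse e (J, W)" "y' = collapse f (J, W)"
    unfolding step0_def by blast
  define \<tau> where "\<tau> = transpose e \<alpha>"
  have \<tau>: "bij \<tau>" "inj \<tau>" "inv_into UNIV \<tau> = \<tau>" "\<tau> e = \<alpha>" by (simp_all add: \<tau>_def)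
  have I: "I = J - {e}" using * by (simp add: collapse_def)
  have "rename \<tau> (I, w) = rename id (I, w)"
    by (rule rename_cong) (use assms y' I step0_valid in \<open>auto simp: \<tau>_def transpose_def\<close>)
  then have x: "rename \<tau> (I, w) = (I, w)" by simp
  define W' where "W' = (\<lambda>k. map (mapl \<tau>) (W k))"
  define v' where "v' = (\<lambda>x. v (mapl \<tau> x))"
  have x': "collapse \<alpha> (\<tau> ` J, W') = (I, w)"
    using x * \<tau> rename_collapse[of \<tau> e "(J, W)"] by (simp add: rename_def W'_def)
  have J: "\<tau> ` J = insert \<alpha> I"
    using x' *(2) \<tau>(4) by (auto simp: collapse_def)
  have g: "graph (insert \<alpha> I) v' p W'"
    using graph_rename[OF \<tau>(1) *(1)] by (simp add: J \<tau> v'_def W'_def)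
  have nl: "nonloop v' \<alpha>" "nonloop v' (\<tau> f)"
    using * by (auto simp: v'_def nonloop_def \<tau>_def)
  have "W' k = lift v' \<alpha> (p (fst k)) (w k) (p (fst k))" for k
  proof -
    have "path v' (p (fst k)) (W' k) (p (fst k))" "reduced (W' k)"
      using g validD(2)[of "(insert \<alpha> I, W')" k] unfolding graph_def snd_conv by blast+
    moreover have "w k = del \<alpha> (W' k)" using x' by (auto simp: collapse_def)
    ultimately show ?thesis using lift_del[of v'] nl by simp
  qed
  then have W': "W' = (\<lambda>k. lift v' \<alpha> (p (fst k)) (w k) (p (fst k)))" by blast
  have "ren (collapse (\<tau> f) (insert \<alpha> I, W')) y'"
  proof (rule ren_sym)
    have "rename \<tau> (J, W) = (insert \<alpha> I, W')" by (simp add: rename_def J W'_def)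
    then have "rename \<tau> y' = collapse (\<tau> f) (insert \<alpha> I, W')"
      using rename_collapse[OF \<tau>(2), of f "(J, W)"] *(7) by simp
    then show "ren y' (collapse (\<tau> f) (insert \<alpha> I, W'))"
      unfolding ren_def using \<tau>(1) by metis
  qed
  then have r: "ren (collapse (\<tau> f) (insert \<alpha> I, W')) y" using y' ren_trans by blast
  have "\<tau> f \<in> insert \<alpha> I" using J *(3) by blast
  from that[OF nl(1) this nl(2)] r W' show ?thesis by blast
qed

section \<open>Peak reduction\<close>

lemma lift_map:
  "inj m \<Longrightarrow> lift (\<lambda>x. m (v x)) e (m s) w (m t) = lift v e s w t"
  by (induction w arbitrary: s) (auto simp: conn_def inj_eq)

lemma lift_cong:
  assumes "\<And>b. v (e, b) = v' (e, b)"
  shows "(\<And>x. fst x \<in> fst ` set w \<Longrightarrow> v x = v' x) \<Longrightarrow> lift v e s w t = lift v' e s w t"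
proof (induction w arbitrary: s)
  case Nil
  then show ?case using assms by (simp add: conn_def)
next
  case (Cons x w)
  then show ?case using assms Cons.prems[of x] Cons.prems[of "linv x"] by (simp add: conn_def)
qed

section \<open>Blow-ups and the change of height\<close>

definition orient :: "nat \<Rightarrow> (letter \<Rightarrow> bool) \<Rightarrow> letter \<Rightarrow> bool" where
  "orient e v x = (if fst x = e then snd x else v x)"

definition blow :: "nat \<Rightarrow> (letter \<Rightarrow> bool) \<Rightarrow> (nat \<Rightarrow> bool) \<Rightarrow> state \<Rightarrow> state" where
  "blow e v p x = (insert e (fst x), \<lambda>k. lift (orient e v) e (p (fst k)) (snd x k) (p (fst k)))"

definition cut :: "key set \<Rightarrow> (letter \<Rightarrow> bool) \<Rightarrow> (nat \<Rightarrow> bool) \<Rightarrow> state \<Rightarrow> nat" where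
  "cut K v p x = (\<Sum>k\<in>K. cutf v (p (fst k)) (snd x k) (p (fst k)))"

definition deg :: "key set \<Rightarrow> nat \<Rightarrow> state \<Rightarrow> nat" where
  "deg K e x = (\<Sum>k\<in>K. cnt e (snd x k))"

lemma nonloop_orient [simp]: "nonloop (orient e v) e" "f \<noteq> e \<Longrightarrow> nonloop (orient e v) f = nonloop v f"
  by (auto simp: nonloop_def orient_def)

lemma step_blow:
  assumes "step x y" "\<alpha> \<notin> fst x"
  obtains v p f where "f = \<alpha> \<or> f \<in> fst x \<and> nonloop v f" "ren (collapse f (blow \<alpha> v p x)) y"
proof -
  obtain v :: "letter \<Rightarrow> bool" and p f where *: "nonloop v \<alpha>" "f \<in> insert \<alpha> (fst x)" "nonloop v f"
    "ren (collapse f (insert \<alpha> (fst x), \<lambda>k. lift v \<alpha> (p (fst k)) (snd x k) (p (fst k)))) y"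
    by (rule step_normal_form[of "fst x" "snd x" y \<alpha>]) (use assms in simp_all)
  \<comment> \<open>If necessary the two vertices are exchanged, so that the new edge runs from
    \<open>False\<close> to \<open>True\<close> as \<open>orient\<close> prescribes.\<close>
  let ?m = "\<lambda>b. b = v (\<alpha>, True)"
  have m: "inj ?m" by (auto simp: inj_def)
  have "?m (v (\<alpha>, b)) = b" for b
    using *(1) by (cases b) (auto simp: nonloop_def)
  then have "orient \<alpha> (\<lambda>x. ?m (v x)) = (\<lambda>x. ?m (v x))"
    by (auto simp: orient_def fun_eq_iff)
  then have "blow \<alpha> (\<lambda>x. ?m (v x)) (\<lambda>i. ?m (p i)) x =
      (insert \<alpha> (fst x), \<lambda>k. lift v \<alpha> (p (fst k)) (snd x k) (p (fst k)))"
    by (simp add: blow_def lift_map[OF m])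
  moreover have "nonloop (\<lambda>x. ?m (v x)) f" using *(3) by (auto simp: nonloop_def)
  ultimately show thesis using that[of f "\<lambda>x. ?m (v x)" "\<lambda>i. ?m (p i)"] * by simp
qed

lemma graph_blow:
  assumes "valid x" "e \<notin> fst x"
  shows "graph (fst (blow e v p x)) (orient e v) p (snd (blow e v p x))" "collapse e (blow e v p x) = x"
  using graph_lift[of "fst x" "snd x" e "orient e v" _ p] assms by (simp_all add: blow_def)

lemma height_collapse: "height K (collapse f x) + deg K f x = height K x"
  by (simp add: height_def deg_def collapse_def length_del flip: sum.distrib)

lemma deg_collapse: "f \<noteq> e \<Longrightarrow> deg K f (collapse e x) = deg K f x"
  by (simp add: deg_def collapse_def cnt_del)

lemma cut_cong: "valid x \<Longrightarrow> (\<And>l. fst l \<in> fst x \<Longrightarrow> v l = v' l) \<Longrightarrow> cut K v p x = cut K v' p x"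
  unfolding cut_def by (rule sum.cong[OF refl], rule cutf_cong) (simp add: validD(4))

lemma deg_blow: assumes "valid x" "e \<notin> fst x" shows "deg K e (blow e v p x) = cut K v p x"
proof -
  have "cnt e (lift (orient e v) e s (snd x k) t) = cutf (orient e v) s (snd x k) t" for k s t
    by (rule cnt_lift) (use assms in \<open>auto dest: validD(4)\<close>)
  then have "deg K e (blow e v p x) = cut K (orient e v) p x"
    by (simp add: deg_def blow_def cut_def)
  also have "\<dots> = cut K v p x"
    by (rule cut_cong[OF assms(1)]) (use assms in \<open>auto simp: orient_def\<close>)
  finally show ?thesis .
qed

text \<open>Blowing up adds one letter per cut turn, and collapsing \<open>f\<close> removes its
  passages, whose number is the same in \<open>x\<close> and in the blown-up graph. So a move
  descends exactly when \<open>deg\<close> exceeds \<open>cut\<close>.\<close>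

lemma height_blow:
  assumes "valid x" "e \<notin> fst x" "f \<in> fst x"
  shows "height K (collapse f (blow e v p x)) + deg K f x = height K x + cut K v p x"
proof -
  have "f \<noteq> e" using assms by auto
  then have "deg K f x = deg K f (blow e v p x)"
    using deg_collapse[of f e K "blow e v p x"] graph_blow(2)[of x e v p] assms by simp
  then show ?thesis
    using height_collapse[of K f "blow e v p x"] height_collapse[of K e "blow e v p x"]
      graph_blow(2)[of x e v p] deg_blow[of x e K v p] assms by simp
qed

lemma graph_collapse:
  assumes "graph J v p W" "nonloop v c" "m (v (c, False)) = m (v (c, True))"
  shows "graph (J - {c}) (\<lambda>x. m (v x)) (\<lambda>i. m (p i)) (\<lambda>k. del c (W k))"
proof -
  have "path v (p (fst k)) (W k) (p (fst k))" for k
    using assms(1) unfolding graph_def by blast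
  then have "path (\<lambda>x. m (v x)) (m (p (fst k))) (del c (W k)) (m (p (fst k)))" for k
    using path_del[of m v c] assms(3) by blast
  moreover have "valid (J - {c}, \<lambda>k. del c (W k))"
    using valid_collapse[OF assms(1,2)] by (simp add: collapse_def)
  ultimately show ?thesis unfolding graph_def by blast
qed

text \<open>The exchange step: two spanning trees that share the edge \<open>c\<close> differ by a
  move, because contracting \<open>c\<close> leaves a graph with two vertices, labelled by
  \<open>m\<close>.\<close>

lemma step0_collapse:
  fixes m :: "'v \<Rightarrow> bool"
  assumes "graph J v p W" "nonloop v c" "m (v (c, False)) = m (v (c, True))"
    "e \<in> J" "f \<in> J" "nonloop (\<lambda>x. m (v x)) e" "nonloop (\<lambda>x. m (v x)) f"
  shows "step0 (collapse e (collapse c (J, W))) (collapse f (collapse c (J, W)))"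
proof -
  have "e \<noteq> c" "f \<noteq> c" using assms by (auto simp: nonloop_def)
  then show ?thesis
    using graph_collapse[OF assms(1-3)] assms(4-7) unfolding step0_def
    by (intro exI[of _ "J - {c}"] exI[of _ "\<lambda>x. m (v x)"] exI[of _ "\<lambda>i. m (p i)"]
        exI[of _ "\<lambda>k. del c (W k)"] exI[of _ e] exI[of _ f])
       (simp add: collapse_def)
qed

lemma collapse_commute: "collapse e (collapse f x) = collapse f (collapse e x)"
  by (auto simp: collapse_def del_commute)

text \<open>Two different two-element subsets of a three-element set share exactly one element.
  Hence two non-loop edges that are not parallel form a spanning tree: after the contraction of one,
  the other is still no loop.\<close>

lemma three_vertices:
  fixes P1 P2 Q1 Q2 :: "bool \<times> bool"
  assumes "P1 \<noteq> (\<sigma>, \<tau>)" "P2 \<noteq> (\<sigma>, \<tau>)" "Q1 \<noteq> (\<sigma>, \<tau>)" "Q2 \<noteq> (\<sigma>, \<tau>)" "P1 \<noteq> P2" "Q1 \<noteq> Q2"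
    "{P1, P2} \<noteq> {Q1, Q2}"
  shows "(Q1 = P1 \<or> Q1 = P2) \<noteq> (Q2 = P1 \<or> Q2 = P2)"
proof -
  have P: "P1 = (\<sigma>, \<not> \<tau>) \<or> P1 = (\<not> \<sigma>, \<tau>) \<or> P1 = (\<not> \<sigma>, \<not> \<tau>)"
     "P2 = (\<sigma>, \<not> \<tau>) \<or> P2 = (\<not> \<sigma>, \<tau>) \<or> P2 = (\<not> \<sigma>, \<not> \<tau>)"
     "Q1 = (\<sigma>, \<not> \<tau>) \<or> Q1 = (\<not> \<sigma>, \<tau>) \<or> Q1 = (\<not> \<sigma>, \<not> \<tau>)"
     "Q2 = (\<sigma>, \<not> \<tau>) \<or> Q2 = (\<not> \<sigma>, \<tau>) \<or> Q2 = (\<not> \<sigma>, \<not> \<tau>)"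
    using assms(1-4) by (cases P1; cases P2; cases Q1; cases Q2; auto)+
  show ?thesis
    using P assms(5-7) by (elim disjE; simp add: insert_commute)
qed

text \<open>
  Two compatible blow-ups \<open>A\<close>, \<open>C\<close> come from one graph with three vertices, the pairs
  \<open>(x \<in> A, x \<in> C)\<close> other than \<open>(\<sigma>, \<tau>)\<close>. The roses obtained from it correspond to its spanning
  trees, and the peak is removed by exchanging the edges of the tree in another order.
\<close>

lemma compatible_peak:
  assumes x: "valid x" and ab: "\<alpha> \<notin> fst x" "\<beta> \<notin> fst x" "\<alpha> \<noteq> \<beta>"
    and a: "a \<in> fst x" "nonloop vA a" and c: "c \<in> fst x" "nonloop vC c"
    and v: "\<And>l. \<not> (vA l = \<sigma> \<and> vC l = \<tau>)" and p: "\<And>i. \<not> (pA i = \<sigma> \<and> pC i = \<tau>)"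
    and cut: "cut K vA pA x < deg K a x" "cut K vC pC x \<le> deg K c x"
  obtains m where "step0 (collapse a (blow \<alpha> vA pA x)) m" "step0 m (collapse c (blow \<beta> vC pC x))"
    "height K m < height K x"
proof -
  \<comment> \<open>On the three admissible pairs \<open>\<alpha>\<close> and \<open>\<beta>\<close>
    form a path with middle vertex \<open>(\<not> \<sigma>, \<not> \<tau>)\<close>; along
    \<open>\<alpha>\<close> the first coordinate changes, along \<open>\<beta>\<close> the second.
    So \<open>fst\<close> is the collapse of \<open>\<beta>\<close> and \<open>snd\<close> that of
    \<open>\<alpha>\<close>.\<close>
  define v3 where "v3 = (\<lambda>l. if fst l = \<alpha> then (snd l, \<not> \<tau>) else if fst l = \<beta> then (\<not> \<sigma>, snd l)
    else (vA l, vC l))"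
  define p3 where "p3 = (\<lambda>i. (pA i, pC i))"
  define WA where "WA = snd (blow \<alpha> vA pA x)"
  define W3 where "W3 = (\<lambda>k. lift v3 \<beta> (p3 (fst k)) (WA k) (p3 (fst k)))"
  define J where "J = insert \<beta> (insert \<alpha> (fst x))"
  let ?V = "{q. q \<noteq> (\<sigma>, \<tau>)}"
  have V: "v3 l \<noteq> (\<sigma>, \<tau>)" "p3 i \<noteq> (\<sigma>, \<tau>)" for l i
    using v p by (auto simp: v3_def p3_def)
  have gA: "graph (insert \<alpha> (fst x)) (orient \<alpha> vA) pA WA"
    using graph_blow(1)[OF x ab(1), of vA pA] by (simp add: WA_def blow_def)
  have vA: "valid (insert \<alpha> (fst x), WA)" using gA by (simp add: graph_def)
  have \<beta>: "\<beta> \<notin> fst ` set (WA k)" for k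
    using validD(3)[OF vA, of k] ab by auto
  have pathA: "path (\<lambda>l. fst (v3 l)) (fst (p3 (fst k))) (WA k) (fst (p3 (fst k)))" for k
  proof -
    have "path (orient \<alpha> vA) (pA (fst k)) (WA k) (pA (fst k))"
      using gA unfolding graph_def by blast
    moreover have "orient \<alpha> vA l = fst (v3 l) \<and> orient \<alpha> vA (linv l) = fst (v3 (linv l))"
      if "l \<in> set (WA k)" for l
      using \<beta>[of k] that by (auto simp: orient_def v3_def)
    ultimately show ?thesis
      using path_cong[of "WA k" "orient \<alpha> vA" "\<lambda>l. fst (v3 l)"] by (simp add: p3_def)
  qed
  have path3: "path v3 (p3 (fst k)) (W3 k) (p3 (fst k))" for k
    unfolding W3_def
  proof (rule path_lift[where V = ?V and m = fst])
    show "path (\<lambda>l. fst (v3 l)) (fst (p3 (fst k))) (WA k) (fst (p3 (fst k)))" by (rule pathA)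
    show "q = r \<or> q = v3 (\<beta>, False) \<and> r = v3 (\<beta>, True) \<or> q = v3 (\<beta>, True) \<and> r = v3 (\<beta>, False)"
      if "q \<in> ?V" "r \<in> ?V" "fst q = fst r" for q r
      using that ab(3) by (cases q; cases r) (auto simp: v3_def)
  qed (use V in auto)
  have "valid (J, W3)"
  proof (rule validI)
    show "finite (fst (J, W3))" using validD(1)[OF x] by (simp add: J_def)
    show "reduced (snd (J, W3) k)" for k
      unfolding snd_conv W3_def using validD(2)[OF vA, of k] by (intro reduced_lift[OF _ \<beta>]) simp
    show "fst l \<in> fst (J, W3)" if "l \<in> set (snd (J, W3) k)" for k l
    proof -
      have "fst l \<in> insert \<beta> (fst ` set (WA k))"
        using that set_lift[of v3 \<beta> "p3 (fst k)" "WA k" "p3 (fst k)"] by (force simp: W3_def)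
      then show ?thesis using validD(3)[OF vA, of k] by (auto simp: J_def)
    qed
  qed
  then have g3: "graph J v3 p3 W3" using path3 unfolding graph_def by blast
  have nl: "nonloop v3 \<alpha>" "nonloop v3 \<beta>" "nonloop v3 a" "nonloop v3 c"
    using ab a c by (auto simp: nonloop_def v3_def)
  have A: "collapse \<beta> (J, W3) = blow \<alpha> vA pA x"
  proof -
    have "del \<beta> (W3 k) = WA k" for k unfolding W3_def using \<beta> by (rule del_lift)
    then show ?thesis using ab by (auto simp: collapse_def J_def WA_def blow_def)
  qed
  have AC: "collapse \<alpha> (collapse \<beta> (J, W3)) = x"
    using graph_blow(2)[OF x ab(1), of vA pA] A by simp
  have C: "collapse \<alpha> (J, W3) = blow \<beta> vC pC x"
  proof -
    have "del \<alpha> (W3 k) = lift (orient \<beta> vC) \<beta> (pC (fst k)) (snd x k) (pC (fst k))" for k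
    proof -
      have "path (\<lambda>l. snd (v3 l)) (snd (p3 (fst k))) (del \<alpha> (W3 k)) (snd (p3 (fst k)))"
        by (rule path_del[OF _ path3]) (simp add: v3_def)
      moreover have "reduced (del \<alpha> (W3 k))"
        using reduced_del[OF path3 _ nl(1)] validD(2)[OF \<open>valid (J, W3)\<close>] by simp
      moreover have "nonloop (\<lambda>l. snd (v3 l)) \<beta>"
        using ab by (simp add: nonloop_def v3_def)
      ultimately have "del \<alpha> (W3 k) =
          lift (\<lambda>l. snd (v3 l)) \<beta> (pC (fst k)) (del \<beta> (del \<alpha> (W3 k))) (pC (fst k))"
        using lift_del[of "\<lambda>l. snd (v3 l)"] by (simp add: p3_def)
      also have "del \<beta> (del \<alpha> (W3 k)) = snd x k"
        using AC by (subst del_commute) (auto simp: collapse_def)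
      also have "lift (\<lambda>l. snd (v3 l)) \<beta> (pC (fst k)) (snd x k) (pC (fst k)) =
          lift (orient \<beta> vC) \<beta> (pC (fst k)) (snd x k) (pC (fst k))"
      proof (rule lift_cong)
        show "snd (v3 l) = orient \<beta> vC l" if "fst l \<in> fst ` set (snd x k)" for l
          using that validD(3)[OF x, of k] ab by (auto simp: v3_def orient_def)
      qed (use ab in \<open>simp add: v3_def orient_def\<close>)
      finally show ?thesis .
    qed
    then show ?thesis using ab by (auto simp: collapse_def J_def blow_def)
  qed
  \<comment> \<open>Collapsing two edges subtracts their degrees from the height of the big graph,
    so all roses below are compared through degrees.\<close>
  have H: "height K (collapse e (collapse f (J, W3))) + deg K e (J, W3) + deg K f (J, W3) =
      height K (J, W3)" if "e \<noteq> f" for e f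
    using height_collapse[of K e "collapse f (J, W3)"] height_collapse[of K f "(J, W3)"]
      deg_collapse[OF that, of K "(J, W3)"] by simp
  have D: "deg K \<alpha> (J, W3) = cut K vA pA x" "deg K \<beta> (J, W3) = cut K vC pC x"
    "deg K a (J, W3) = deg K a x" "deg K c (J, W3) = deg K c x"
  proof -
    show "deg K \<alpha> (J, W3) = cut K vA pA x"
      using deg_blow[OF x ab(1), of K vA pA] A deg_collapse[of \<alpha> \<beta> K "(J, W3)"] ab by simp
    show "deg K \<beta> (J, W3) = cut K vC pC x"
      using deg_blow[OF x ab(2), of K vC pC] C deg_collapse[of \<beta> \<alpha> K "(J, W3)"] ab by simp
    have "deg K f (J, W3) = deg K f x" if "f \<in> fst x" for f
    proof -
      have "f \<noteq> \<alpha>" "f \<noteq> \<beta>" using that ab by auto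
      then show ?thesis
        using deg_collapse[of f \<alpha> K "collapse \<beta> (J, W3)"] deg_collapse[of f \<beta> K "(J, W3)"] AC by simp
    qed
    then show "deg K a (J, W3) = deg K a x" "deg K c (J, W3) = deg K c x" using a c by auto
  qed
  have x_height: "height K x + cut K vA pA x + cut K vC pC x = height K (J, W3)"
    using H[of \<alpha> \<beta>] ab AC D by simp
  let ?S = "\<lambda>e f. collapse e (collapse f (J, W3))"
  have J: "a \<in> J" "c \<in> J" "\<alpha> \<in> J" "\<beta> \<in> J" using a c by (auto simp: J_def)
  have y: "collapse a (blow \<alpha> vA pA x) = ?S a \<beta>" using A by simp
  have z: "collapse c (blow \<beta> vC pC x) = ?S c \<alpha>" using C by simp
  \<comment> \<open>Labels of the two vertices left after contracting \<open>e\<close>: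
    \<open>True\<close> for the merged ends, \<open>False\<close> for the third vertex.\<close>
  define M where "M = (\<lambda>e q. q = v3 (e, False) \<or> q = v3 (e, True))"
  have M: "M e (v3 (e, False)) = M e (v3 (e, True))" for e by (simp add: M_def)
  have abne: "a \<noteq> \<alpha>" "a \<noteq> \<beta>" "c \<noteq> \<alpha>" "c \<noteq> \<beta>" using ab a c by auto
  have fa: "fst (v3 (a, False)) \<noteq> fst (v3 (a, True))" and sc: "snd (v3 (c, False)) \<noteq> snd (v3 (c, True))"
    using a c abne by (auto simp: v3_def nonloop_def)
  have v\<alpha>: "v3 (\<alpha>, b) = (b, \<not> \<tau>)" and v\<beta>: "v3 (\<beta>, b) = (\<not> \<sigma>, b)" for b
    using ab by (auto simp: v3_def)
  have M\<beta>: "nonloop (\<lambda>l. M e (v3 l)) \<beta>" if "fst (v3 (e, False)) \<noteq> fst (v3 (e, True))" for e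
    using that unfolding nonloop_def M_def v\<beta>
    by (cases "v3 (e, False)"; cases "v3 (e, True)") auto
  have M\<alpha>: "nonloop (\<lambda>l. M e (v3 l)) \<alpha>" if "snd (v3 (e, False)) \<noteq> snd (v3 (e, True))" for e
    using that unfolding nonloop_def M_def v\<alpha>
    by (cases "v3 (e, False)"; cases "v3 (e, True)") auto
  show thesis
  proof (cases "{v3 (a, False), v3 (a, True)} = {v3 (c, False), v3 (c, True)}")
    case False
    \<comment> \<open>Here \<open>a\<close> and \<open>c\<close> form a spanning tree, and
      \<open>{\<beta>, a}\<close>, \<open>{c, a}\<close>, \<open>{\<alpha>, c}\<close> arise by
      successive exchanges. The middle tree gives a lower rose by both cut inequalities
      together.\<close>
    have "step0 (?S \<beta> a) (?S c a)"
    proof (rule step0_collapse[OF g3 nl(3), where m = "M a"])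
      show "nonloop (\<lambda>l. M a (v3 l)) c"
        using three_vertices[OF V(1) V(1) V(1) V(1) _ _ False] nl unfolding nonloop_def M_def by blast
    qed (use M M\<beta>[OF fa] J in auto)
    moreover have "step0 (?S a c) (?S \<alpha> c)"
    proof (rule step0_collapse[OF g3 nl(4), where m = "M c"])
      show "nonloop (\<lambda>l. M c (v3 l)) a"
        using three_vertices[OF V(1) V(1) V(1) V(1) _ _ False[symmetric]] nl
        unfolding nonloop_def M_def by blast
    qed (use M M\<alpha>[OF sc] J in auto)
    moreover have "height K (?S c a) < height K x"
    proof -
      have "c \<noteq> a" using False by auto
      then show ?thesis using H[of c a] D cut x_height by simp
    qed
    ultimately show thesis using that[of "?S c a"] y z collapse_commute by metis
  next
    case True
    then have fc: "fst (v3 (c, False)) \<noteq> fst (v3 (c, True))" and sa: "snd (v3 (a, False)) \<noteq> snd (v3 (a, True))"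
      using fa sc by (auto simp: doubleton_eq_iff)
    \<comment> \<open>Now \<open>a\<close> and \<open>c\<close> are parallel and cannot both be
      collapsed, but each of them forms a tree with \<open>\<alpha>\<close> and with
      \<open>\<beta>\<close>. If the cut of \<open>C\<close> is less than \<open>deg a\<close>, the
      tree \<open>{a, \<alpha>}\<close> lies below \<open>x\<close>. Otherwise \<open>deg c\<close>
      is at least the cut of \<open>C\<close>, hence at least \<open>deg a\<close>, hence more than
      the cut of \<open>A\<close>, and \<open>{c, \<beta>}\<close> lies below
      \<open>x\<close>.\<close>
    show thesis
    proof (cases "cut K vC pC x < deg K a x")
      case True
      have "step0 (?S \<beta> a) (?S \<alpha> a)"
        by (rule step0_collapse[OF g3 nl(3), where m = "M a"])
           (use M M\<beta>[OF fa] M\<alpha>[OF sa] J in auto)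
      moreover have "step0 (?S a \<alpha>) (?S c \<alpha>)"
        by (rule step0_collapse[OF g3 nl(1), where m = snd])
           (use sa sc J v\<alpha> in \<open>auto simp: nonloop_def\<close>)
      moreover have "height K (?S a \<alpha>) < height K x"
        using H[of a \<alpha>] D cut x_height abne True by simp
      ultimately show thesis using that[of "?S a \<alpha>"] y z collapse_commute by metis
    next
      case False
      have "step0 (?S a \<beta>) (?S c \<beta>)"
        by (rule step0_collapse[OF g3 nl(2), where m = fst])
           (use fa fc J v\<beta> in \<open>auto simp: nonloop_def\<close>)
      moreover have "step0 (?S \<beta> c) (?S \<alpha> c)"
        by (rule step0_collapse[OF g3 nl(4), where m = "M c"])
           (use M M\<beta>[OF fc] M\<alpha>[OF sc] J in auto)
      moreover have "height K (?S c \<beta>) < height K x"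
        using H[of c \<beta>] D cut x_height abne False by simp
      ultimately show thesis using that[of "?S c \<beta>"] y z collapse_commute by metis
    qed
  qed
qed

text \<open>Suppose that the cuts at all corners containing an end of \<open>a\<close> or
  \<open>b\<close> are too large. Either an end of \<open>a\<close> lies opposite to an end of
  \<open>b\<close>, which contradicts the bound on that diagonal, or the ends of \<open>a\<close>
  occupy one diagonal and those of \<open>b\<close> the other, and adding up both diagonals gives a
  contradiction.\<close>

lemma corner_choice:
  fixes h :: "bool \<Rightarrow> bool \<Rightarrow> nat"
  assumes "h True True + h False False < da + db" "h True False + h False True < da + db"
    "p1 \<noteq> p2" "q1' \<noteq> q2'"
  shows "h p1 p1' < da \<or> h p2 p2' < da \<or> h q1 q1' < db \<or> h q2 q2' < db"
  using assms by (cases p1; cases p2; cases p1'; cases p2'; cases q1; cases q2; cases q1'; cases q2'; simp; linarith)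

section \<open>Chains of steps below a given height\<close>

definition below :: "key set \<Rightarrow> nat \<Rightarrow> state \<Rightarrow> state \<Rightarrow> bool" where
  "below K h = (\<lambda>x y. step x y \<and> height K x < h \<and> height K y < h)\<^sup>*\<^sup>*"

lemma belowI: "step x y \<Longrightarrow> height K x < h \<Longrightarrow> height K y < h \<Longrightarrow> below K h x y"
  unfolding below_def by blast

lemma below_trans: "below K h x y \<Longrightarrow> below K h y z \<Longrightarrow> below K h x z"
  unfolding below_def by (rule rtranclp_trans)

lemma below_refl [simp]: "below K h x x"
  unfolding below_def by simp

lemma step0_step: "step0 x y \<Longrightarrow> step x y"
  unfolding step_def using ren_refl by blast

text \<open>By submodularity opposite corners of the two bipartitions together cost less than
  \<open>deg a + deg b\<close>, so some corner yields a strictly descending move. A corner is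
  contained in one side of each bipartition, hence compatible with both moves, and
  \<open>compatible_peak\<close> is applied on either side of its target. One strict descent
  suffices, so \<open>z\<close> may be as high as \<open>x\<close>.\<close>

lemma peak:
  assumes xy: "step x y" "height K y < height K x" and xz: "step x z" "height K z \<le> height K x"
  obtains m where "below K (height K x) y m" "step m z"
proof -
  have x: "valid x" using xy step_valid by blast
  obtain \<alpha> where \<alpha>: "\<alpha> \<notin> fst x" using validD(1)[OF x] ex_new_if_finite[of "fst x"] by auto
  obtain \<beta> where "\<beta> \<notin> insert \<alpha> (fst x)"
    using validD(1)[OF x] ex_new_if_finite[of "insert \<alpha> (fst x)"] by auto
  then have \<beta>: "\<beta> \<notin> fst x" "\<alpha> \<noteq> \<beta>" by auto
  obtain vA pA a where a: "a = \<alpha> \<or> a \<in> fst x \<and> nonloop vA a" and y: "ren (collapse a (blow \<alpha> vA pA x)) y"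
    using step_blow[OF xy(1) \<alpha>] .
  obtain vB pB b where b: "b = \<alpha> \<or> b \<in> fst x \<and> nonloop vB b" and z: "ren (collapse b (blow \<alpha> vB pB x)) z"
    using step_blow[OF xz(1) \<alpha>] .
  have hy: "height K (collapse a (blow \<alpha> vA pA x)) < height K x" using height_ren[OF y] xy by simp
  have hz: "height K (collapse b (blow \<alpha> vB pB x)) \<le> height K x" using height_ren[OF z] xz by simp
  have "a \<noteq> \<alpha>" using hy graph_blow(2)[OF x \<alpha>, of vA pA] by auto
  then have a: "a \<in> fst x" "nonloop vA a" using a by auto
  show thesis
  proof (cases "b = \<alpha>")
    case True
    then have "ren x z" using z graph_blow(2)[OF x \<alpha>, of vB pB] by simp
    then have "step y z" using step_ren[OF step_sym[OF xy(1)]] by blast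
    then show thesis using that[of y] by simp
  next
    case False
    then have b: "b \<in> fst x" "nonloop vB b" using b by auto
    have cA: "cut K vA pA x < deg K a x" using height_blow[OF x \<alpha> a(1), of K vA pA] hy by simp
    have cB: "cut K vB pB x \<le> deg K b x" using height_blow[OF x \<alpha> b(1), of K vB pB] hz by simp
    define vC where "vC = (\<lambda>\<sigma> \<tau> l. vA l = \<sigma> \<and> vB l = \<tau>)"
    define pC where "pC = (\<lambda>\<sigma> \<tau> i. pA i = \<sigma> \<and> pB i = \<tau>)"
    have sub: "cut K (vC \<sigma> \<tau>) (pC \<sigma> \<tau>) x + cut K (vC (\<not> \<sigma>) (\<not> \<tau>)) (pC (\<not> \<sigma>) (\<not> \<tau>)) x
        \<le> cut K vA pA x + cut K vB pB x" for \<sigma> \<tau>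
    proof -
      have *: "vC (\<not> \<sigma>) (\<not> \<tau>) = (\<lambda>l. vA l \<noteq> \<sigma> \<and> vB l \<noteq> \<tau>)" "pC (\<not> \<sigma>) (\<not> \<tau>) = (\<lambda>i. pA i \<noteq> \<sigma> \<and> pB i \<noteq> \<tau>)"
        by (auto simp: vC_def pC_def)
      show ?thesis unfolding * unfolding cut_def vC_def pC_def sum.distrib[symmetric]
        by (rule sum_mono) (rule cutf_submodular)
    qed
    \<comment> \<open>The ends of \<open>a\<close> differ in the first coordinate and those of
      \<open>b\<close> in the second, so a corner containing one end of such a petal never contains
      the other; this makes the petal a non-loop for the corner.\<close>
    obtain \<sigma> \<tau> c where c: "c \<in> fst x" "nonloop (vC \<sigma> \<tau>) c" "cut K (vC \<sigma> \<tau>) (pC \<sigma> \<tau>) x < deg K c x"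
    proof -
      let ?h = "\<lambda>\<sigma> \<tau>. cut K (vC \<sigma> \<tau>) (pC \<sigma> \<tau>) x"
      let ?P = "\<lambda>v b. (vA (v, b), vB (v, b))"
      have "nonloop (vC (vA (a, s)) (vB (a, s))) a" for s
        using a(2) by (cases s) (auto simp: nonloop_def vC_def)
      moreover have "nonloop (vC (vA (b, s)) (vB (b, s))) b" for s
        using b(2) by (cases s) (auto simp: nonloop_def vC_def)
      moreover have "?h (vA (a, False)) (vB (a, False)) < deg K a x \<or> ?h (vA (a, True)) (vB (a, True)) < deg K a x \<or>
          ?h (vA (b, False)) (vB (b, False)) < deg K b x \<or> ?h (vA (b, True)) (vB (b, True)) < deg K b x"
        by (rule corner_choice)
           (use sub[of True True] sub[of True False] cA cB a(2) b(2) in \<open>auto simp: nonloop_def\<close>)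
      ultimately show thesis using that a(1) b(1) by blast
    qed
    let ?y = "collapse a (blow \<alpha> vA pA x)"
    let ?z = "collapse b (blow \<alpha> vB pB x)"
    let ?u = "collapse c (blow \<beta> (vC \<sigma> \<tau>) (pC \<sigma> \<tau>) x)"
    have hu: "height K ?u < height K x"
      using height_blow[OF x \<beta>(1) c(1), of K "vC \<sigma> \<tau>" "pC \<sigma> \<tau>"] c(3) by simp
    obtain m1 where m1: "step0 ?y m1" "step0 m1 ?u" "height K m1 < height K x"
      using compatible_peak[OF x \<alpha> \<beta> a c(1,2), where pA = pA and pC = "pC \<sigma> \<tau>" and \<sigma> = "\<not> \<sigma>" and \<tau> = True and K = K]
        cA c(3) by (auto simp: vC_def pC_def)
    obtain m2 where m2: "step0 ?u m2" "step0 m2 ?z" "height K m2 < height K x"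
      using compatible_peak[OF x \<beta>(1) \<alpha> \<beta>(2)[symmetric] c(1,2) b, where pA = "pC \<sigma> \<tau>" and pC = pB and \<sigma> = True and \<tau> = "\<not> \<tau>" and K = K]
        cB c(3) by (auto simp: vC_def pC_def)
    have "step y m1" using ren_step[OF ren_sym[OF y]] m1 step0_step by blast
    then have "below K (height K x) y m1" using belowI xy(2) m1(3) by blast
    moreover have "below K (height K x) m1 ?u" using belowI step0_step m1 hu by blast
    moreover have "below K (height K x) ?u m2" using belowI step0_step m2 hu by blast
    moreover have "step m2 z" using step_ren[OF _ z] m2 step0_step by blast
    ultimately show thesis using that below_trans by meson
  qed
qed

text \<open>Visits to the height \<open>h\<close> are removed from left to right. The part already
  treated stays below \<open>h\<close>, except that its last step may end at \<open>h\<close>; if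
  the chain continues from there, \<open>peak\<close> replaces this step and the next one.\<close>

lemma below_lower:
  assumes "below K (Suc h) x y" "height K x < h"
  shows "(height K y < h \<longrightarrow> below K h x y) \<and>
    (height K y = h \<longrightarrow> (\<exists>m. below K h x m \<and> height K m < h \<and> step m y))"
  using assms(1) unfolding below_def[of K "Suc h"]
proof (induction rule: rtranclp_induct)
  case base
  then show ?case using assms(2) by auto
next
  case (step y z)
  show ?case
  proof (cases "height K y < h")
    case True
    then show ?thesis using step below_trans belowI by blast
  next
    case False
    then have y: "height K y = h" using step.hyps by simp
    then obtain m where m: "below K h x m" "height K m < h" "step m y" using step.IH by blast
    have "step y m" using m(3) by (rule step_sym)
    then obtain m' where m': "below K h m m'" "step m' z"
      using peak[of y m K z] m y step.hyps by auto
    have "height K m' < h"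
      using m'(1)[unfolded below_def] m(2) by (induction rule: rtranclp_induct) auto
    then show ?thesis using m m' below_trans belowI by meson
  qed
qed

theorem below_reduce:
  assumes "below K H x y" "height K x < h" "height K y < h"
  shows "below K h x y"
proof (cases "h \<le> H")
  case True
  then show ?thesis
  proof (induction rule: inc_induct)
    case base
    show ?case by (rule assms(1))
  next
    case (step n)
    then have "below K (Suc n) x y" by blast
    moreover have "height K x < n" "height K y < n" using assms step.hyps by auto
    ultimately show ?case using below_lower by blast
  qed
next
  case False
  then show ?thesis using assms(1) unfolding below_def
    by (auto elim: rtranclp_mono[THEN predicate2D, rotated])
qed

section \<open>Steps as automorphisms\<close>

lemmas grp = add.assoc diff_conv_add_uminus minus_add

text \<open>An isomorphism between the free groups on \<open>I\<close> and \<open>J\<close> together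
  with its inverse. On letters outside, only compatibility with inversion is asked.\<close>

definition fgiso :: "nat set \<Rightarrow> nat set \<Rightarrow> (letter \<Rightarrow> fg) \<Rightarrow> (letter \<Rightarrow> fg) \<Rightarrow> bool" where
  "fgiso I J f g \<longleftrightarrow> symf f \<and> symf g \<and>
     (\<forall>l. fst l \<in> I \<longrightarrow> f l \<in> gset J \<and> ext g (f l) = gl l) \<and>
     (\<forall>l. fst l \<in> J \<longrightarrow> g l \<in> gset I \<and> ext f (g l) = gl l)"

lemma fgisoD:
  assumes "fgiso I J f g"
  shows "symf f" "symf g" "fst l \<in> I \<Longrightarrow> f l \<in> gset J" "fst l \<in> I \<Longrightarrow> ext g (f l) = gl l"
    "fst l \<in> J \<Longrightarrow> g l \<in> gset I" "fst l \<in> J \<Longrightarrow> ext f (g l) = gl l"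
  using assms unfolding fgiso_def by blast+

lemma fgisoI:
  assumes "symf f" "symf g" "\<And>l. fst l \<in> I \<Longrightarrow> f l \<in> gset J" "\<And>l. fst l \<in> I \<Longrightarrow> ext g (f l) = gl l"
    "\<And>l. fst l \<in> J \<Longrightarrow> g l \<in> gset I" "\<And>l. fst l \<in> J \<Longrightarrow> ext f (g l) = gl l"
  shows "fgiso I J f g"
  using assms unfolding fgiso_def by blast

lemma fgiso_sym: "fgiso I J f g \<Longrightarrow> fgiso J I g f"
  unfolding fgiso_def by blast

lemma fgiso_id: "fgiso I I gl gl"
  by (rule fgisoI) auto

lemma fgiso_ext: assumes "fgiso I J f g" "x \<in> gset I"
  shows "ext f x \<in> gset J" "ext g (ext f x) = x"
proof -
  show "ext f x \<in> gset J" using assms ext_gset fgisoD(3) by metis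
  have "ext g (ext f x) = ext (\<lambda>l. ext g (f l)) x" using ext_comp fgisoD(1,2)[OF assms(1)] by metis
  also have "\<dots> = ext gl x" by (rule ext_cong[OF assms(2)]) (rule fgisoD(4)[OF assms(1)])
  finally show "ext g (ext f x) = x" by simp
qed

lemma fgiso_comp:
  assumes f: "fgiso I J f f'" and g: "fgiso J K g g'"
  shows "fgiso I K (\<lambda>l. ext g (f l)) (\<lambda>l. ext f' (g' l))"
proof (rule fgisoI)
  show "symf (\<lambda>l. ext g (f l))" "symf (\<lambda>l. ext f' (g' l))"
    by (simp_all add: symf_comp fgisoD(1,2)[OF f] fgisoD(1,2)[OF g])
  show "ext g (f l) \<in> gset K" if "fst l \<in> I" for l using fgiso_ext(1)[OF g] fgisoD(3)[OF f] that by blast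
  show "ext f' (g' l) \<in> gset I" if "fst l \<in> K" for l
    using fgiso_ext(1)[OF fgiso_sym[OF f]] fgisoD(5)[OF g] that by blast
  show "ext (\<lambda>l. ext f' (g' l)) (ext g (f l)) = gl l" if "fst l \<in> I" for l
    using fgiso_ext(2)[OF g] fgisoD[OF f] fgisoD(2)[OF g] that by (simp add: ext_comp)
  show "ext (\<lambda>l. ext g (f l)) (ext f' (g' l)) = gl l" if "fst l \<in> K" for l
    using fgiso_ext(2)[OF fgiso_sym[OF f]] fgisoD[OF g] fgisoD(1)[OF f] that by (simp add: ext_comp)
qed

text \<open>The correction by \<open>h\<close> is a coboundary: it telescopes along a path and
  leaves its values at the two end points.\<close>

lemma sum_list_path:
  "path v s W t \<Longrightarrow> sum_list (map (\<lambda>x. h (v x) + c x - h (v (linv x))) W) =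
    h s + sum_list (map c W) - h (t :: 'v)" for h :: "'v \<Rightarrow> 'a::group_add"
proof (induction W arbitrary: s)
  case (Cons x W)
  then have "path v (v (linv x)) W t" by simp
  note IH = Cons.IH[OF this]
  show ?case using Cons.prems by (simp add: IH) (simp add: grp del: add_uminus_conv_diff)
qed simp

text \<open>The path in the spanning tree from the vertex \<open>False\<close> to the vertex
  \<open>b\<close>, if \<open>l\<close> is the tree edge directed from \<open>False\<close> to
  \<open>True\<close>.\<close>

definition gauge :: "letter \<Rightarrow> bool \<Rightarrow> fg" where
  "gauge l b = (if b then gl l else 0)"

text \<open>
  The change of marking between the collapses of \<open>e\<close> and \<open>f\<close>: the first vertex is joined to the
  second one by the edge \<open>l\<close>, which is no longer collapsed.
\<close>

definition transit :: "letter \<Rightarrow> nat \<Rightarrow> (letter \<Rightarrow> bool) \<Rightarrow> letter \<Rightarrow> fg" where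
  "transit l f v = (\<lambda>x. gauge l (v x) + (if fst x = f then 0 else gl x) - gauge l (v (linv x)))"

lemma symf_trans: "symf (transit l f v)"
  by (rule symfI) (auto simp: transit_def grp simp del: add_uminus_conv_diff)

definition edge :: "(letter \<Rightarrow> bool) \<Rightarrow> nat \<Rightarrow> letter" where
  "edge v e = (e, v (e, False))"

lemma fst_edge [simp]: "fst (edge v e) = e"
  by (simp add: edge_def)

lemma v_edge: "nonloop v e \<Longrightarrow> \<not> v (edge v e) \<and> v (linv (edge v e))"
  by (cases "v (e, False)") (auto simp: edge_def nonloop_def)

lemma trans_e: "nonloop v e \<Longrightarrow> fst x = e \<Longrightarrow> e \<noteq> f \<Longrightarrow> transit (edge v e) f v x = 0"
proof -
  assume *: "nonloop v e" "fst x = e" "e \<noteq> f"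
  obtain c where c: "edge v e = c" "\<not> v c" "v (linv c)" "fst c = e"
    using v_edge[OF *(1)] by simp
  then have "x = c \<or> x = linv c" using * same_index by metis
  then show ?thesis using c *(3) by (elim disjE) (simp_all add: transit_def gauge_def)
qed

text \<open>Both words come from the same loop \<open>W\<close>. The transit map kills the letters
  of index \<open>e\<close>, so it may be applied to \<open>W\<close> itself, where its corrections
  telescope to a conjugation by the gauge of the base point.\<close>

lemma gw_del_trans:
  assumes "path v s W s" "nonloop v e" "e \<noteq> f"
  shows "gw (del f W) = - gauge (edge v e) s + ext (transit (edge v e) f v) (gw (del e W)) + gauge (edge v e) s"
proof -
  let ?t = "transit (edge v e) f v" and ?h = "gauge (edge v e)"
  have del: "sum_list (map ?t (del e W)) = sum_list (map ?t W)" for W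
    by (induction W) (auto simp: trans_e[OF assms(2) _ assms(3)])
  have c: "sum_list (map (\<lambda>x. if fst x = f then 0 else gl x) W) = gw (del f W)" for W
    by (induction W) auto
  have "ext ?t (gw (del e W)) = sum_list (map ?t W)"
    using symf_trans by (simp add: ext_gw del)
  also have "\<dots> = ?h s + gw (del f W) - ?h s"
    using sum_list_path[OF assms(1), of ?h "\<lambda>x. if fst x = f then 0 else gl x"]
    by (simp add: transit_def c)
  finally show ?thesis by (simp add: grp del: add_uminus_conv_diff)
qed

lemma ext_gauge: "symf f \<Longrightarrow> ext f (gauge l b) = (if b then f l else 0)"
  by (simp add: gauge_def)

lemma gauge_gset: "fst l \<in> I \<Longrightarrow> gauge l b \<in> gset I"
  by (simp add: gauge_def)

lemma trans_gset:
  assumes "fst l \<in> J - {f}" "fst x \<in> J"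
  shows "transit l f v x \<in> gset (J - {f})"
  unfolding transit_def using assms by (intro gset_diff gset_add gauge_gset) auto

text \<open>The map back sends the gauge along \<open>e\<close> to the inverse of the gauge along
  \<open>f\<close>, so the two corrections cancel.\<close>

lemma trans_inverse:
  assumes "nonloop v e" "nonloop v f" "e \<noteq> f" "fst x \<noteq> e"
  shows "ext (transit (edge v f) e v) (transit (edge v e) f v x) = gl x"
proof -
  let ?g = "transit (edge v f) e v" and ?k = "gauge (edge v f)"
  have sg: "symf ?g" by (rule symf_trans)
  have "?g (edge v e) = - gl (edge v f)"
    using v_edge[OF assms(1)] by (simp add: transit_def[of _ e] gauge_def)
  then have h: "ext ?g (gauge (edge v e) b) = - ?k b" for b
    by (simp add: ext_gauge[OF sg] gauge_def)
  have "ext ?g (transit (edge v e) f v x) = - ?k (v x) + (if fst x = f then 0 else ?g x) + ?k (v (linv x))"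
    unfolding transit_def[of _ f] by (simp add: ext_add ext_diff sg h)
  also have "\<dots> = gl x"
  proof (cases "fst x = f")
    case True
    obtain c where c: "edge v f = c" "\<not> v c" "v (linv c)" "fst c = f"
      using v_edge[OF assms(2)] by simp
    then have "x = c \<or> x = linv c" using True same_index by metis
    then show ?thesis using c by (elim disjE) (simp_all add: gauge_def)
  next
    case False
    then show ?thesis using assms(4) by (simp add: transit_def grp del: add_uminus_conv_diff)
  qed
  finally show ?thesis .
qed

lemma fgiso_trans:
  assumes "nonloop v e" "nonloop v f" "e \<noteq> f" "e \<in> J" "f \<in> J"
  shows "fgiso (J - {e}) (J - {f}) (transit (edge v e) f v) (transit (edge v f) e v)"
  by (rule fgisoI) (use assms in \<open>auto intro!: symf_trans trans_gset trans_inverse\<close>)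

lemma length_rep_add: "length (rep_fg (g + h)) \<le> length (rep_fg g) + length (rep_fg h)"
proof -
  have "length (push l w) \<le> Suc (length w)" for l w by (cases w) auto
  then have "length (foldr push u w) \<le> length u + length w" for u w
    by (induction u) (auto intro: order_trans)
  then show ?thesis by (simp add: rep_plus)
qed

lemma length_rep_uminus [simp]: "length (rep_fg (- g)) = length (rep_fg g)"
  by (simp add: rep_uminus)

lemma length_rep_diff: "length (rep_fg (g - h)) \<le> length (rep_fg g) + length (rep_fg h)"
  using length_rep_add[of g "- h"] by simp

lemma length_gauge: "length (rep_fg (gauge l b)) \<le> 1"
  by (simp add: gauge_def)

lemma length_trans: "length (rep_fg (transit l f v x)) \<le> 3"
proof -
  let ?c = "if fst x = f then 0 else gl x"
  have "length (rep_fg ?c) \<le> 1" by simp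
  then show ?thesis
    using length_rep_add[of "gauge l (v x)" ?c] length_rep_diff[of "gauge l (v x) + ?c" "gauge l (v (linv x))"]
      length_gauge[of l "v x"] length_gauge[of l "v (linv x)"] by (simp add: transit_def)
qed

section \<open>Steps stay within an orbit, with short automorphisms and conjugators\<close>

definition orb :: "state \<Rightarrow> state \<Rightarrow> (letter \<Rightarrow> fg) \<Rightarrow> (nat \<Rightarrow> fg) \<Rightarrow> bool" where
  "orb x y f z \<longleftrightarrow> (\<exists>g. fgiso (fst x) (fst y) f g) \<and>
     (\<forall>k. gw (snd y k) = - z (fst k) + ext f (gw (snd x k)) + z (fst k))"

definition small :: "nat set \<Rightarrow> (letter \<Rightarrow> fg) \<Rightarrow> (nat \<Rightarrow> fg) \<Rightarrow> bool" where
  "small J f z \<longleftrightarrow> (\<forall>l. length (rep_fg (f l)) \<le> 3) \<and> (\<forall>i. z i = 0 \<or> (\<exists>l. fst l \<in> J \<and> z i = gl l))"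

lemma orb_step0:
  assumes "step0 x y"
  shows "\<exists>f z. orb x y f z \<and> small (fst y) f z"
proof -
  obtain J and v :: "letter \<Rightarrow> bool" and p W e f where *: "graph J v p W" "e \<in> J" "f \<in> J"
     "nonloop v e" "nonloop v f" "x = collapse e (J, W)" "y = collapse f (J, W)"
    using assms unfolding step0_def by blast
  show ?thesis
  proof (cases "e = f")
    case True
    have "orb x y gl (\<lambda>_. 0)" "small (fst y) gl (\<lambda>_. 0)"
      using fgiso_id * True by (auto simp: orb_def small_def)
    then show ?thesis by blast
  next
    case False
    let ?f = "transit (edge v e) f v" and ?z = "\<lambda>i. gauge (edge v e) (p i)"
    have "path v (p (fst k)) (W k) (p (fst k))" for k using *(1) unfolding graph_def by blast
    then have "gw (snd y k) = - ?z (fst k) + ext ?f (gw (snd x k)) + ?z (fst k)" for k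
      using gw_del_trans[OF _ *(4) False, of "p (fst k)" "W k"] *(6,7) by (simp add: collapse_def)
    moreover have "fgiso (fst x) (fst y) ?f (transit (edge v f) e v)"
      using fgiso_trans[of v e f J] * False by (simp add: collapse_def)
    moreover have "?z i = 0 \<or> (\<exists>l. fst l \<in> fst y \<and> ?z i = gl l)" for i
    proof -
      have "fst (edge v e) \<in> fst y" using *(2,7) False by (simp add: collapse_def)
      then show ?thesis by (auto simp: gauge_def simp del: split_paired_Ex)
    qed
    then have "small (fst y) ?f ?z"
      unfolding small_def using length_trans by blast
    ultimately show ?thesis
      unfolding orb_def by (intro exI[of _ ?f] exI[of _ ?z]) blast
  qed
qed

lemma symf_mapl: "symf (\<lambda>l. gl (mapl \<rho> l))"
  by (rule symfI) (metis gl_linv mapl_simps(2))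

lemma gw_mapl: "gw (map (mapl \<rho>) w) = ext (\<lambda>l. gl (mapl \<rho> l)) (gw w)"
  by (simp add: ext_gw[OF symf_mapl]) (simp add: gw_def o_def)

lemma rep_mapl:
  assumes "inj \<rho>" shows "rep_fg (ext (\<lambda>l. gl (mapl \<rho> l)) g) = map (mapl \<rho>) (rep_fg g)"
  using gw_mapl[of \<rho> "rep_fg g"] assms by (metis gw_rep rep_gw_reduced reduced_mapl reduced_rep)

lemma fgiso_mapl:
  assumes "bij \<rho>"
  shows "fgiso I (\<rho> ` I) (\<lambda>l. gl (mapl \<rho> l)) (\<lambda>l. gl (mapl (inv_into UNIV \<rho>) l))"
  by (rule fgisoI) (use assms in \<open>auto simp: symf_mapl mapl_mapl bij_is_inj bij_is_surj surj_iff inv_f_f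
    simp del: linv_Pair intro!: symf_mapl\<close>)

lemma orb_step:
  assumes "step x y"
  shows "\<exists>f z. orb x y f z \<and> small (fst y) f z"
proof -
  obtain y' \<rho> where *: "step0 x y'" "bij \<rho>" "y = rename \<rho> y'"
    using assms by (auto simp: step_def ren_def)
  obtain f z where f: "orb x y' f z" "small (fst y') f z" using orb_step0[OF *(1)] by blast
  let ?r = "\<lambda>l. gl (mapl \<rho> l)"
  have r: "symf ?r" by (rule symf_mapl)
  obtain g where g: "fgiso (fst x) (fst y') f g" using f by (auto simp: orb_def)
  let ?f = "\<lambda>l. ext ?r (f l)" and ?z = "\<lambda>i. ext ?r (z i)"
  have "\<exists>g. fgiso (fst x) (fst y) ?f g"
    using fgiso_comp[OF g fgiso_mapl[OF *(2)]] *(3) by (auto simp: rename_def)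
  moreover have "gw (snd y k) = - ?z (fst k) + ext ?f (gw (snd x k)) + ?z (fst k)" for k
  proof -
    have "gw (snd y' k) = - z (fst k) + ext f (gw (snd x k)) + z (fst k)"
      using f unfolding orb_def by blast
    moreover have "gw (snd y k) = ext ?r (gw (snd y' k))" using *(3) by (simp add: rename_def gw_mapl)
    ultimately show ?thesis
      using ext_comp[OF r fgisoD(1)[OF g]] by (simp add: ext_add ext_uminus r)
  qed
  moreover have "small (fst y) ?f ?z"
    unfolding small_def
  proof (intro conjI allI)
    show "length (rep_fg (?f l)) \<le> 3" for l
      using f(2) *(2) unfolding small_def by (simp add: rep_mapl bij_is_inj del: split_paired_All)
    show "?z i = 0 \<or> (\<exists>l. fst l \<in> fst y \<and> ?z i = gl l)" for i
    proof (cases "z i = 0")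
      case False
      then obtain l where "fst l \<in> fst y'" "z i = gl l" using f(2) unfolding small_def by blast
      then have "fst (mapl \<rho> l) \<in> fst y \<and> ?z i = gl (mapl \<rho> l)" using *(3) by (simp add: rename_def)
      then show ?thesis by blast
    qed simp
  qed
  ultimately show ?thesis
    unfolding orb_def by (intro exI[of _ ?f] exI[of _ ?z]) blast
qed

section \<open>Basic moves are steps\<close>

text \<open>The new edge takes over the name of the collapsed petal \<open>f\<close>. So the
  alphabet is restored, and the transit map becomes the Whitehead automorphism with multiplier
  \<open>l\<close> and cut set \<open>u\<close>; \<open>q\<close> tells which marked points are
  dragged along.\<close>

lemma basic_move:
  assumes x: "valid (I, w)" and f: "f \<in> I" "nonloop u f" and l_def: "l = (f, s)"
  shows "step (I, w) (I, \<lambda>k. rep_fg (- gauge l (q (fst k)) + ext (transit l f u) (gw (w k)) + gauge l (q (fst k))))"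
proof -
  obtain \<alpha> where \<alpha>: "\<alpha> \<notin> I" using validD(1)[OF x] ex_new_if_finite[of I] by auto
  then have ne: "\<alpha> \<noteq> f" using f by auto
  \<comment> \<open>The orientation of \<open>\<alpha>\<close> is chosen such that its letter
    leaving \<open>False\<close> turns into \<open>l\<close> under the renaming.\<close>
  define v where "v = (\<lambda>x. if fst x = \<alpha> then snd x \<noteq> s else u x)"
  have nl: "nonloop v \<alpha>" "nonloop v f" using f ne by (auto simp: v_def nonloop_def)
  have e: "edge v \<alpha> = (\<alpha>, s)" by (simp add: edge_def v_def)
  let ?W = "\<lambda>k. lift v \<alpha> (q (fst k)) (w k) (q (fst k))"
  let ?x = "(insert \<alpha> I, ?W)"
  define \<rho> where "\<rho> = transpose \<alpha> f"
  have \<rho>: "bij \<rho>" "\<rho> \<alpha> = f" "\<And>i. i \<noteq> \<alpha> \<Longrightarrow> i \<noteq> f \<Longrightarrow> \<rho> i = i" by (auto simp: \<rho>_def)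
  have g: "graph (insert \<alpha> I) v q ?W" and c: "collapse \<alpha> ?x = (I, w)"
    using graph_lift[OF x \<alpha> nl(1) refl] by blast+
  have s0: "step0 (I, w) (collapse f ?x)" by (rule step_lift[OF x \<alpha> nl]) (use f in simp)
  define y where "y = rename \<rho> (collapse f ?x)"
  have "step (I, w) y" unfolding y_def step_def ren_def using s0 \<rho>(1) by blast
  have fy: "fst y = I"
  proof -
    have "fst y = \<rho> ` insert \<alpha> (I - {f})" using ne by (simp add: y_def rename_def collapse_def insert_Diff_if)
    also have "\<dots> = insert f (\<rho> ` (I - {f}))" using \<rho> by simp
    also have "\<rho> ` (I - {f}) = (\<lambda>i. i) ` (I - {f})"
    proof (rule image_cong[OF refl])
      fix i assume "i \<in> I - {f}"
      then have "i \<noteq> \<alpha>" "i \<noteq> f" using \<alpha> by auto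
      then show "\<rho> i = i" by (rule \<rho>(3))
    qed
    finally show ?thesis using f by auto
  qed
  let ?r = "\<lambda>l. gl (mapl \<rho> l)"
  have r: "symf ?r" by (rule symf_mapl)
  have rh: "ext ?r (gauge (\<alpha>, s) b) = gauge l b" for b
    by (simp add: ext_gauge[OF r]) (simp add: gauge_def l_def \<rho>)
  have tr: "ext ?r (transit (\<alpha>, s) f v l') = transit l f u l'" if "fst l' \<in> I" for l'
  proof -
    have "fst l' \<noteq> \<alpha>" using that \<alpha> by auto
    then have "v l' = u l'" "v (linv l') = u (linv l')" "fst l' \<noteq> f \<Longrightarrow> mapl \<rho> l' = l'"
      by (auto simp: v_def \<rho>(3) mapl_def)
    then show ?thesis by (simp add: transit_def ext_add ext_diff r rh)
  qed
  have "snd y k = rep_fg (- gauge l (q (fst k)) + ext (transit l f u) (gw (w k)) + gauge l (q (fst k)))" for k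
  proof -
    have p: "path v (q (fst k)) (?W k) (q (fst k))" using g unfolding graph_def by blast
    have w: "del \<alpha> (?W k) = w k" using c by (simp add: collapse_def) metis
    have "gw (snd y k) = ext ?r (gw (del f (?W k)))"
      by (simp add: y_def rename_def collapse_def gw_mapl)
    also have "\<dots> = - gauge l (q (fst k)) + ext ?r (ext (transit (\<alpha>, s) f v) (gw (w k))) + gauge l (q (fst k))"
      using gw_del_trans[OF p nl(1) ne] by (simp add: w e ext_add ext_uminus r rh)
    also have "ext ?r (ext (transit (\<alpha>, s) f v) (gw (w k))) = ext (\<lambda>l. ext ?r (transit (\<alpha>, s) f v l)) (gw (w k))"
      by (rule ext_comp[symmetric]) (simp_all add: r symf_trans)
    also have "\<dots> = ext (transit l f u) (gw (w k))"
      by (rule ext_cong[where I = I]) (use tr gset_gw validD(3)[OF x, of k] in auto)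
    finally have *: "gw (snd y k) = - gauge l (q (fst k)) + ext (transit l f u) (gw (w k)) + gauge l (q (fst k))" .
    have "reduced (snd y k)" using step_valid(2)[OF \<open>step (I, w) y\<close>] validD(2) by blast
    then show ?thesis by (metis * rep_gw_reduced)
  qed
  then have "y = (I, \<lambda>k. rep_fg (- gauge l (q (fst k)) + ext (transit l f u) (gw (w k)) + gauge l (q (fst k))))"
    using fy by (auto simp: prod_eq_iff)
  then show ?thesis using \<open>step (I, w) y\<close> by simp
qed

section \<open>Transvections, inversions and conjugations of one block\<close>

definition transvect :: "letter \<Rightarrow> letter \<Rightarrow> letter \<Rightarrow> fg" where
  "transvect l m x = (if x = m then gl l + gl m else if x = linv m then - gl m - gl l else gl x)"

lemma symf_transvect: "symf (transvect l m)"
proof (rule symfI)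
  fix x
  consider "x = m" | "x = linv m" | "x \<noteq> m" "x \<noteq> linv m" by blast
  then show "transvect l m (linv x) = - transvect l m x"
  proof cases
    case 3
    then have "linv x \<noteq> m" "linv x \<noteq> linv m" by (simp_all add: linv_swap[symmetric])
    then show ?thesis using 3 unfolding transvect_def by simp
  qed (simp_all add: transvect_def minus_add)
qed

lemma step_transvect:
  assumes "valid (I, w)" "fst l \<in> I" "fst l \<noteq> fst m"
  shows "step (I, w) (I, \<lambda>k. rep_fg (ext (transvect l m) (gw (w k))))"
proof -
  \<comment> \<open>Cutting off the ends \<open>l\<close> and \<open>m\<close> multiplies
    \<open>m\<close> by \<open>l\<close> and fixes every other petal.\<close>
  let ?u = "\<lambda>x. x = l \<or> x = m"
  have "transit l (fst l) ?u = transvect l m"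
  proof
    fix x
    show "transit l (fst l) ?u x = transvect l m x"
    proof (cases "fst x = fst l")
      case True
      then have "x \<noteq> m" "x \<noteq> linv m" "linv x \<noteq> m" using assms(3) by auto
      then show ?thesis using same_index[OF True] by (auto simp: transit_def gauge_def transvect_def)
    next
      case False
      then have x: "x \<noteq> l" "linv x \<noteq> l" by auto
      show ?thesis
      proof (cases "linv x = m")
        case True
        then show ?thesis using x False by (auto simp: transit_def gauge_def transvect_def)
      next
        case F: False
        then have "x \<noteq> linv m" by auto
        then show ?thesis using x F False by (simp add: transit_def gauge_def transvect_def)
      qed
    qed
  qed
  moreover have "nonloop ?u (fst l)"
    using assms(3) by (cases l; cases "snd l") (auto simp: nonloop_def)
  ultimately show ?thesis
    using basic_move[OF assms(1,2) _ prod.collapse[symmetric], of ?u "\<lambda>_. False"] by (simp add: gauge_def[of _ False])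
qed

definition flip :: "nat \<Rightarrow> letter \<Rightarrow> fg" where
  "flip i x = (if fst x = i then - gl x else gl x)"

lemma symf_flip: "symf (flip i)"
  by (rule symfI) (auto simp: flip_def simp del: linv_Pair)

lemma step_flip:
  assumes "valid (I, w)" "i \<in> I"
  shows "step (I, w) (I, \<lambda>k. rep_fg (ext (flip i) (gw (w k))))"
proof -
  let ?u = "\<lambda>x. x = (i, True)"
  have "transit (i, False) i ?u = flip i"
  proof
    fix x
    have "gl (i, True) = - gl (i, False)" using gl_linv[of "(i, False)"] by simp
    then show "transit (i, False) i ?u x = flip i x"
      by (cases x; cases "snd x"; cases "fst x = i") (simp_all add: transit_def gauge_def flip_def)
  qed
  moreover have "nonloop ?u i" by (simp add: nonloop_def)
  ultimately show ?thesis
    using basic_move[OF assms _ refl, of ?u False "\<lambda>_. False"] by (simp add: gauge_def[of _ False])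
qed

lemma step_conj:
  assumes "valid (I, w)" "fst l \<in> I"
  shows "step (I, w) (I, \<lambda>k. rep_fg (if fst k = i then - gl l + gw (w k) + gl l else gw (w k)))"
proof -
  \<comment> \<open>With \<open>l\<close> alone cut off the automorphism is trivial; only the marked
    point of block \<open>i\<close>, put on the same side as \<open>l\<close>, is moved across the
    edge.\<close>
  let ?u = "\<lambda>x. x = l"
  have "transit l (fst l) ?u = gl"
  proof
    fix x
    show "transit l (fst l) ?u x = gl x"
    proof (cases "fst x = fst l")
      case True
      then show ?thesis using same_index[OF True] by (auto simp: transit_def gauge_def)
    next
      case False
      then have "x \<noteq> l" "linv x \<noteq> l" by auto
      then show ?thesis using False by (simp add: transit_def gauge_def)
    qed
  qed
  moreover have "nonloop ?u (fst l)"
    by (cases l; cases "snd l") (auto simp: nonloop_def)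
  moreover have "- gauge l (j = i) + x + gauge l (j = i) = (if j = i then - gl l + x + gl l else x)" for j x
    by (simp add: gauge_def)
  ultimately show ?thesis
    using basic_move[OF assms _ prod.collapse[symmetric], of ?u "\<lambda>j. j = i"] by simp
qed

section \<open>Nielsen reduction\<close>

abbreviation len :: "fg \<Rightarrow> nat" where
  "len g \<equiv> length (rep_fg g)"

section \<open>Common prefixes and cancellation\<close>

fun lcp :: "'a list \<Rightarrow> 'a list \<Rightarrow> nat" where
  "lcp (x # u) (y # v) = (if x = y then Suc (lcp u v) else 0)"
| "lcp _ _ = 0"

lemma le_lcp: "n \<le> lcp u v \<longleftrightarrow> n \<le> length u \<and> n \<le> length v \<and> take n u = take n v"
proof (induction u v arbitrary: n rule: lcp.induct)
  case (1 x u y v)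
  then show ?case by (cases n) auto
qed auto

lemma foldr_push_winv_append: "reduced v \<Longrightarrow> foldr push (winv c) (c @ v) = v"
  by (induction c) auto

lemma length_lcp:
  assumes "reduced u" "reduced v"
  shows "length (foldr push (winv u) v) + 2 * lcp u v = length u + length v"
  using assms
proof (induction u v rule: lcp.induct)
  case (1 x u y v)
  show ?case
  proof (cases "x = y")
    case True
    then show ?thesis using 1 by (auto dest: reduced_ConsD)
  next
    case False
    have "reduced (winv (x # u) @ y # v)"
      using reduced_winv[OF 1(2)] 1(3) False by (auto simp: reduced_append)
    then show ?thesis using foldr_push_reduced[of "winv (x # u)" "y # v"] False by simp
  qed
next
  case ("2_1" v)
  then show ?case by simp
next
  case ("2_2" u)
  then show ?case using foldr_push_reduced[of "winv u" "[]"] reduced_winv[of u] by simp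
qed

text \<open>The Gromov product in the Cayley tree; \<open>gp (- g) h\<close> is the number of
  letters of each factor that cancel in \<open>g + h\<close>.\<close>

definition gp :: "fg \<Rightarrow> fg \<Rightarrow> nat" where
  "gp g h = lcp (rep_fg g) (rep_fg h)"

lemma len_gp: "len (- g + h) + 2 * gp g h = len g + len h"
  by (simp add: gp_def rep_plus rep_uminus length_lcp)

lemma len_gp': "len (g + h) + 2 * gp (- g) h = len g + len h"
  using len_gp[of "- g" h] by simp

lemma gp_sym: "gp g h = gp h g"
proof -
  have "len (- g + h) = len (- h + g)"
    using length_rep_uminus[of "- g + h"] by (simp add: minus_add del: length_rep_uminus)
  then show ?thesis using len_gp[of g h] len_gp[of h g] by simp
qed

lemma gp_ultra: "n \<le> gp a b \<Longrightarrow> n \<le> gp b c \<Longrightarrow> n \<le> gp a c"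
  by (auto simp: gp_def le_lcp)

lemma len_eq_0: "len g = 0 \<longleftrightarrow> g = 0"
  by (metis length_0_conv rep_fg_inject rep_zero)

lemma winv_eq: "reduced w \<Longrightarrow> winv w = w \<Longrightarrow> w = []"
proof (induction w rule: length_induct)
  case (1 w)
  show ?case
  proof (cases w)
    case x: (Cons x v)
    show ?thesis
    proof (cases v rule: rev_cases)
      case Nil
      then show ?thesis using x 1(3) by simp
    next
      case (snoc m y)
      then have w: "w = x # m @ [y]" using x by simp
      then have "linv y = x" "winv m = m" using 1(3) by simp_all
      moreover have "reduced m" using 1(2) by (auto simp: w reduced_append dest: reduced_ConsD)
      ultimately have "m = []" using 1(1) w by simp
      then show ?thesis using 1(2) w \<open>linv y = x\<close> by auto
    qed
  qed
qed

text \<open>If the cancellation in \<open>g + g\<close> reached the middle, symmetry would make the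
  reduced word of \<open>g\<close> equal to that of \<open>- g\<close>, which \<open>winv_eq\<close>
  permits for the empty word only.\<close>

lemma gp_self: assumes "g \<noteq> 0" shows "2 * gp (- g) g < len g"
proof (rule ccontr)
  assume "\<not> ?thesis"
  then have le: "len g \<le> 2 * gp (- g) g" by simp
  let ?w = "rep_fg g"
  let ?n = "gp (- g) g"
  have t: "?n \<le> length ?w" "take ?n (winv ?w) = take ?n ?w"
    using le_lcp[of ?n "rep_fg (- g)" ?w] by (simp_all add: gp_def rep_uminus)
  have nth: "?w ! i = linv (?w ! (length ?w - 1 - i))" if "i < ?n" for i
  proof -
    have "?w ! i = winv ?w ! i" using t that by (metis nth_take)
    then show ?thesis using that t(1) by (simp add: winv_def rev_nth)
  qed
  have all: "?w ! i = linv (?w ! (length ?w - 1 - i))" if i: "i < length ?w" for i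
  proof (cases "i < ?n")
    case True
    then show ?thesis by (rule nth)
  next
    case False
    then have "length ?w - 1 - i < ?n" using le i by linarith
    then have "?w ! (length ?w - 1 - i) = linv (?w ! (length ?w - 1 - (length ?w - 1 - i)))" by (rule nth)
    moreover have "length ?w - 1 - (length ?w - 1 - i) = i" using i by simp
    ultimately show ?thesis by simp
  qed
  have "winv ?w ! i = ?w ! i" if "i < length ?w" for i
  proof -
    have "winv ?w ! i = linv (?w ! (length ?w - 1 - i))"
      using that by (simp add: winv_def rev_nth)
    also have "\<dots> = ?w ! i" using all[OF that] by (rule sym)
    finally show ?thesis .
  qed
  then have "winv ?w = ?w" by (intro nth_equalityI) simp_all
  then have "?w = []" using winv_eq[of ?w] by simp
  then show False using assms len_eq_0 by simp
qed

definition cancel :: "(letter \<Rightarrow> fg) \<Rightarrow> letter \<Rightarrow> letter \<Rightarrow> nat" where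
  "cancel f l m = gp (- f l) (f m)"

lemma len_cancel: "len (f l + f m) + 2 * cancel f l m = len (f l) + len (f m)"
  by (simp add: cancel_def len_gp')

text \<open>Nielsen's condition on triples: no factor is consumed by the cancellations on its two
  sides.\<close>

definition nreduced :: "nat set \<Rightarrow> (letter \<Rightarrow> fg) \<Rightarrow> bool" where
  "nreduced I f \<longleftrightarrow> (\<forall>l m n. fst l \<in> I \<longrightarrow> fst m \<in> I \<longrightarrow> fst n \<in> I \<longrightarrow> m \<noteq> linv l \<longrightarrow> n \<noteq> linv m \<longrightarrow>
     cancel f l m + cancel f m n < len (f m))"

lemma nreducedD: "nreduced I f \<Longrightarrow> fst l \<in> I \<Longrightarrow> fst m \<in> I \<Longrightarrow> fst n \<in> I \<Longrightarrow> m \<noteq> linv l \<Longrightarrow> n \<noteq> linv m \<Longrightarrow>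
     cancel f l m + cancel f m n < len (f m)"
  unfolding nreduced_def by blast

text \<open>After the cancellation with its predecessor the last factor keeps more than
  \<open>cancel f l m\<close> letters at its end, so the next factor does not see the earlier
  ones.\<close>

lemma gp_product:
  assumes f: "symf f" "nreduced I f"
  shows "reduced (u @ [l]) \<Longrightarrow> fst ` set (u @ [l]) \<subseteq> I \<Longrightarrow> fst m \<in> I \<Longrightarrow> m \<noteq> linv l \<Longrightarrow>
    gp (- sum_list (map f (u @ [l]))) (f m) = cancel f l m"
proof (induction u arbitrary: l m rule: rev_induct)
  case Nil
  then show ?case by (simp add: cancel_def)
next
  case (snoc l0 u)
  let ?s = "sum_list (map f (u @ [l0]))"
  have l: "l \<noteq> linv l0" "reduced (u @ [l0])" "fst l0 \<in> I" "fst l \<in> I" "fst ` set (u @ [l0]) \<subseteq> I"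
    using snoc.prems by (auto simp: reduced_append)
  have IH: "gp (- ?s) (f l) = cancel f l0 l"
    using snoc.IH[of l0 l] l by simp
  have b: "cancel f l0 l + cancel f l m < len (f l)"
    using nreducedD[OF f(2)] l snoc.prems by blast
  define a where "a = - (?s + f l)"
  have "len (- a + - f l) = len ?s" by (simp add: a_def grp del: add_uminus_conv_diff)
  moreover have "len a = len (?s + f l)" by (simp add: a_def)
  ultimately have "2 * gp a (- f l) + len ?s = len (?s + f l) + len (f l)"
    using len_gp[of a "- f l"] by simp
  then have ab: "gp a (- f l) + cancel f l0 l = len (f l)"
    using len_gp'[of ?s "f l"] IH by simp
  have d: "gp (- f l) (f m) = cancel f l m" by (simp add: cancel_def)
  have "cancel f l m \<le> gp a (f m)"
    using gp_ultra[of _ a "- f l" "f m"] ab b d by simp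
  moreover have "\<not> Suc (cancel f l m) \<le> gp a (f m)"
  proof
    assume "Suc (cancel f l m) \<le> gp a (f m)"
    moreover have "Suc (cancel f l m) \<le> gp (- f l) a" using ab b gp_sym[of a "- f l"] by simp
    ultimately have "Suc (cancel f l m) \<le> gp (- f l) (f m)" using gp_ultra by blast
    then show False using d by simp
  qed
  ultimately show ?case by (simp add: a_def add.assoc)
qed

text \<open>Each factor contributes at least one letter of its own. The summand
  \<open>cancel f l m\<close> reserves the letters that the next factor may remove, which carries
  the induction.\<close>

lemma len_product:
  assumes f: "symf f" "nreduced I f"
  shows "reduced (u @ [l]) \<Longrightarrow> fst ` set (u @ [l]) \<subseteq> I \<Longrightarrow> fst m \<in> I \<Longrightarrow> m \<noteq> linv l \<Longrightarrow>
    Suc (length u) + cancel f l m \<le> len (sum_list (map f (u @ [l])))"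
proof (induction u arbitrary: l m rule: rev_induct)
  case Nil
  then have "cancel f l l + cancel f l m < len (f l)" using nreducedD[OF f(2), of l l m] by simp
  then show ?case by simp
next
  case (snoc l0 u)
  let ?s = "sum_list (map f (u @ [l0]))"
  have l: "l \<noteq> linv l0" "reduced (u @ [l0])" "fst l0 \<in> I" "fst l \<in> I" "fst ` set (u @ [l0]) \<subseteq> I"
    using snoc.prems by (auto simp: reduced_append)
  have "Suc (length u) + cancel f l0 l \<le> len ?s" using snoc.IH[of l0 l] l by simp
  moreover have "cancel f l0 l + cancel f l m < len (f l)"
    using nreducedD[OF f(2)] l snoc.prems by blast
  moreover have "gp (- ?s) (f l) = cancel f l0 l" using gp_product[OF f] l by blast
  ultimately show ?case using len_gp'[of ?s "f l"] by (simp add: add.assoc)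
qed

lemma nreduced_letter:
  assumes "fgiso I I f g" "nreduced I f" "fst x \<in> I"
  obtains l where "fst l \<in> I" "f l = gl x"
proof -
  let ?w = "rep_fg (g x)"
  have sum: "sum_list (map f ?w) = gl x" using fgisoD(6)[OF assms(1,3)] by (simp add: ext_def)
  then have "?w \<noteq> []" by (metis gl_linv list.map(1) neg_0_equal_iff_equal rep_gl rep_zero sum_list.Nil list.distinct(1))
  then obtain u l where w: "?w = u @ [l]" by (metis rev_exhaust)
  have I: "fst ` set ?w \<subseteq> I" using fgisoD(5)[OF assms(1,3)] by (simp add: gset_def)
  have "Suc (length u) + cancel f l l \<le> len (sum_list (map f (u @ [l])))"
    using len_product[OF fgisoD(1)[OF assms(1)] assms(2), of u l l] w I reduced_rep[of "g x"] by simp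
  then have "u = []" using sum w by simp
  then show thesis using that[of l] sum w I by simp
qed

subsection \<open>Decreasing the measure\<close>

text \<open>The word as a numeral to base \<open>B\<close>. For words of equal length with small
  enough letters this is injective, and it is dominated by the initial part of the word.\<close>

primrec rank :: "nat \<Rightarrow> word \<Rightarrow> nat" where
  "rank B [] = 0"
| "rank B (l # w) = (2 * fst l + of_bool (snd l)) * B ^ length w + rank B w"

lemma rank_append: "rank B (u @ v) = rank B u * B ^ length v + rank B v"
  by (induction u) (auto simp: power_add algebra_simps)

lemma rank_less: "(\<And>l. l \<in> set w \<Longrightarrow> 2 * fst l + 1 < B) \<Longrightarrow> rank B w < B ^ length w"
proof (induction w)
  case (Cons l w)
  have "2 * fst l + of_bool (snd l) \<le> B - 1" using Cons.prems[of l] by (cases "snd l") auto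
  then have "(2 * fst l + of_bool (snd l)) * B ^ length w \<le> (B - 1) * B ^ length w"
    by (rule mult_le_mono1)
  moreover have "rank B w < B ^ length w" using Cons by simp
  ultimately have "rank B (l # w) < (B - 1) * B ^ length w + B ^ length w" by (simp only: rank.simps)
  also have "\<dots> = B ^ length (l # w)" using Cons.prems[of l] by (cases B) auto
  finally show ?case .
qed simp

lemma rank_inject:
  "(\<And>l. l \<in> set u \<union> set v \<Longrightarrow> 2 * fst l + 1 < B) \<Longrightarrow> length u = length v \<Longrightarrow> rank B u = rank B v \<Longrightarrow> u = v"
proof (induction u arbitrary: v)
  case (Cons l u)
  then obtain m w where v: "v = m # w" by (cases v) auto
  let ?d = "\<lambda>l::letter. 2 * fst l + of_bool (snd l)" and ?P = "B ^ length u"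
  have len: "length w = length u" using Cons.prems v by simp
  have r: "rank B u < ?P" "rank B w < ?P"
    using rank_less[of u B] rank_less[of w B] Cons.prems(1) v len by simp_all
  have eq: "?d l * ?P + rank B u = ?d m * ?P + rank B w" using Cons.prems(3) v len by simp
  have "(?d l * ?P + rank B u) div ?P = ?d l" "(?d m * ?P + rank B w) div ?P = ?d m"
  proof -
    have dv: "(c * q + t) div q = c" if "t < q" for c q t :: nat using that by simp
    show "(?d l * ?P + rank B u) div ?P = ?d l" "(?d m * ?P + rank B w) div ?P = ?d m"
      by (rule dv[OF r(1)], rule dv[OF r(2)])
  qed
  then have d: "?d l = ?d m" using eq by simp
  then have "rank B u = rank B w" using eq by simp
  then have "u = w" using Cons.IH[of w] Cons.prems v len by simp
  moreover have "l = m"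
  proof -
    have "even (?d l) \<longleftrightarrow> \<not> snd l" "even (?d m) \<longleftrightarrow> \<not> snd m" by auto
    then have s: "snd l = snd m" using d by simp
    then show ?thesis using d by (simp add: prod_eq_iff)
  qed
  ultimately show ?case using v by simp
qed simp

text \<open>Initial halves of \<open>g\<close> and \<open>- g\<close>, rounded up, cover the word of
  \<open>g\<close>. Their ranks give Nielsen's second measure, which decides when lengths
  tie.\<close>

definition half :: "nat \<Rightarrow> fg \<Rightarrow> nat" where
  "half B g = rank B (take ((len g + 1) div 2) (rep_fg g))"

definition weight :: "nat \<Rightarrow> fg \<Rightarrow> nat" where
  "weight B g = half B g + half B (- g)"

lemma foldr_push_length:
  "length (foldr push u v) = length u + length v \<Longrightarrow> foldr push u v = u @ v"
proof (induction u)
  case (Cons l u)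
  have le: "length (push l w) \<le> Suc (length w)" for w by (cases w) auto
  have "length (foldr push u v) \<le> length u + length v"
  proof (induction u)
    case (Cons a u)
    have "length (push a w) \<le> Suc (length w)" for w by (cases w) auto
    then show ?case using Cons by (auto intro: order_trans)
  qed simp
  then have "length (foldr push u v) = length u + length v"
    using Cons.prems le[of "foldr push u v"] by simp
  then have *: "foldr push u v = u @ v" by (rule Cons.IH)
  have "push l x = l # x" if "length (push l x) = Suc (length x)" for x
    using that by (cases x) (auto split: if_splits)
  then show ?case using Cons.prems * by simp
qed simp

text \<open>Exactly half of \<open>g\<close> cancels, so \<open>g = P Q^-1\<close>,
  \<open>h = Q S\<close>, and \<open>P S\<close> is the product. The initial half of
  \<open>h\<close> improves when \<open>Q\<close> is replaced by the smaller \<open>P\<close>,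
  whereas the final half lies within \<open>S\<close> and is unchanged.\<close>

lemma tie_break:
  assumes len: "len g = 2 * k" "gp (- g) h = k" "2 * k \<le> len h" and B: "0 < B"
    and rank: "rank B (take k (rep_fg g)) < rank B (take k (rep_fg (- g)))"
  shows "len (g + h) = len h" "weight B (g + h) < weight B h"
proof -
  define P where "P = take k (rep_fg g)"
  define Q where "Q = take k (rep_fg (- g))"
  define S where "S = drop k (rep_fg h)"
  have "take k (rep_fg h) = Q"
    using le_lcp[of k "rep_fg (- g)" "rep_fg h"] len(2) by (simp add: gp_def Q_def)
  then have h: "rep_fg h = Q @ S" unfolding S_def by (metis append_take_drop_id)
  have "winv (rep_fg g) = winv (drop k (rep_fg g)) @ winv (take k (rep_fg g))"
    using winv_simps(3)[of "take k (rep_fg g)" "drop k (rep_fg g)"] by simp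
  then have "Q = winv (drop k (rep_fg g))" using len(1) by (simp add: Q_def rep_uminus)
  then have "winv Q = drop k (rep_fg g)" by simp
  then have g: "rep_fg g = P @ winv Q" by (simp add: P_def)
  have lPQ: "length P = k" "length Q = k" using len(1) by (simp_all add: P_def Q_def)
  show l: "len (g + h) = len h" using len_gp'[of g h] len by simp
  have "reduced S" using reduced_rep[of h] h by (simp add: reduced_append)
  then have "rep_fg (g + h) = foldr push P S"
    using h g by (simp add: rep_plus foldr_push_winv_append)
  moreover have "length (rep_fg (g + h)) = length P + length S" using l h lPQ by simp
  ultimately have gh: "rep_fg (g + h) = P @ S" using foldr_push_length by metis
  let ?t = "(len h + 1) div 2"
  have t: "k \<le> ?t" "?t \<le> length S" using len(3) h lPQ by simp_all
  have "half B (g + h) < half B h"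
    unfolding half_def l gh h using t rank lPQ len(3)
    by (simp add: h rank_append P_def[symmetric] Q_def[symmetric] B)
  moreover have "half B (- (g + h)) = half B (- h)"
    using t lPQ by (simp add: half_def rep_uminus gh h)
  ultimately show "weight B (g + h) < weight B h" by (simp add: weight_def)
qed

lemma sum_transvect:
  assumes I: "finite I" "fst m \<in> I" and f: "symf f" and \<mu>: "\<And>g. \<mu> (- g) = (\<mu> g :: nat)"
    and lm: "fst l \<noteq> fst m"
  shows "(\<Sum>i\<in>I. \<mu> (ext f (transvect l m (i, False)))) + \<mu> (f m) = (\<Sum>i\<in>I. \<mu> (f (i, False))) + \<mu> (f l + f m)"
proof -
  let ?f = "\<lambda>i. \<mu> (ext f (transvect l m (i, False)))"
  have m: "\<mu> (h (fst m, False)) = \<mu> (h m)" if "symf h" for h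
    using symfD[OF that, of m] \<mu>[of "h m"] by (cases m; cases "snd m") auto
  have e: "symf (\<lambda>x. ext f (transvect l m x))" using f symf_transvect by (rule symf_comp)
  have "?f i = \<mu> (f (i, False))" if "i \<in> I - {fst m}" for i
  proof -
    have "(i, False) \<noteq> m" "(i, False) \<noteq> linv m" using that by (auto simp: linv_def)
    then show ?thesis by (simp add: transvect_def)
  qed
  then have "sum ?f (I - {fst m}) = (\<Sum>i\<in>I - {fst m}. \<mu> (f (i, False)))" by simp
  moreover have "?f (fst m) = \<mu> (f l + f m)" using m[OF e] by (simp add: transvect_def ext_add f)
  moreover have "\<mu> (f (fst m, False)) = \<mu> (f m)" using m[OF f] .
  ultimately show ?thesis
    using I by (simp add: sum.remove[of I "fst m"])
qed

definition total :: "nat set \<Rightarrow> (fg \<Rightarrow> nat) \<Rightarrow> (letter \<Rightarrow> fg) \<Rightarrow> nat" where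
  "total I \<mu> f = (\<Sum>i\<in>I. \<mu> (f (i, False)))"

text \<open>If some cancellation exceeds half of the left factor, a transvection shortens the right
  one. Otherwise a middle factor that is consumed must be halved exactly from both sides. Its two
  halves differ, and the smaller one decides whether this factor is multiplied onto its right
  neighbour or its inverse onto the inverse of the left one.\<close>

lemma nielsen_decrease:
  assumes I: "finite I" and f: "fgiso I I f g" and B: "\<And>i. i \<in> I \<Longrightarrow> 2 * i + 1 < B"
    and nr: "\<not> nreduced I f"
  obtains l m where "fst l \<in> I" "fst m \<in> I" "fst l \<noteq> fst m"
    "total I len (\<lambda>x. ext f (transvect l m x)) < total I len f \<or>
     total I len (\<lambda>x. ext f (transvect l m x)) = total I len f \<and>
     total I (weight B) (\<lambda>x. ext f (transvect l m x)) < total I (weight B) f"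
proof -
  have sf: "symf f" using fgisoD(1)[OF f] .
  have inv: "f (linv l) = - f l" for l using symfD[OF sf] .
  have \<mu>: "len (- g) = len g" "weight B (- g) = weight B g" for g by (simp_all add: weight_def)
  have S: "total I len (\<lambda>x. ext f (transvect l m x)) + len (f m) = total I len f + len (f l + f m)"
    "total I (weight B) (\<lambda>x. ext f (transvect l m x)) + weight B (f m) = total I (weight B) f + weight B (f l + f m)"
    if "fst m \<in> I" "fst l \<noteq> fst m" for l m
    unfolding total_def using sum_transvect[where \<mu> = len, OF I that(1) sf \<mu>(1) that(2)]
      sum_transvect[where \<mu> = "weight B", OF I that(1) sf \<mu>(2) that(2)] by blast+
  note result = that
  show thesis
  proof (cases "\<exists>l m. fst l \<in> I \<and> fst m \<in> I \<and> fst l \<noteq> fst m \<and> len (f l) < 2 * cancel f l m")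
    case True
    then obtain l m where lm: "fst l \<in> I" "fst m \<in> I" "fst l \<noteq> fst m" "len (f l) < 2 * cancel f l m" by blast
    then show thesis using result[OF lm(1-3)] S(1)[OF lm(2,3)] len_cancel[of f l m] by simp
  next
    case False
    then have c1: "2 * cancel f l m \<le> len (f l)" if "fst l \<in> I" "fst m \<in> I" "fst l \<noteq> fst m" for l m
      using that by (meson not_le)
    have csym: "cancel f (linv m) (linv l) = cancel f l m" for l m
      by (simp add: cancel_def inv gp_sym)
    have c2: "2 * cancel f l m \<le> len (f m)" if "fst l \<in> I" "fst m \<in> I" "fst l \<noteq> fst m" for l m
      using c1[of "linv m" "linv l"] that csym[of m l] by (simp add: inv)
    have cs: "2 * cancel f m m < len (f m)" if "fst m \<in> I" for m
    proof -
      have "f m \<noteq> 0" using fgisoD(4)[OF f that] by (metis ext_zero list.distinct(1) rep_gl rep_zero)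
      then show ?thesis by (simp add: cancel_def gp_self)
    qed
    have tie: thesis if mn: "fst m \<in> I" "fst n \<in> I" "fst m \<noteq> fst n" and k: "len (f m) = 2 * k" "cancel f m n = k"
      and r: "rank B (take k (rep_fg (f m))) < rank B (take k (rep_fg (- f m)))" for m n k
    proof -
      have "2 * k \<le> len (f n)" using c2[OF mn] k by simp
      then have "len (f m + f n) = len (f n)" "weight B (f m + f n) < weight B (f n)"
        using tie_break[OF k(1) k(2)[unfolded cancel_def] _ _ r] B[OF mn(1)] by simp_all
      then show thesis using result[OF mn] S[OF mn(2,3)] by simp
    qed
    obtain l m n where lmn: "fst l \<in> I" "fst m \<in> I" "fst n \<in> I" "m \<noteq> linv l" "n \<noteq> linv m"
      "len (f m) \<le> cancel f l m + cancel f m n"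
      using nr unfolding nreduced_def by (meson not_le)
    have l: "2 * cancel f l m \<le> len (f m)" "fst l = fst m \<Longrightarrow> 2 * cancel f l m < len (f m)"
      using c2[of l m] cs[of m] same_index[of l m] lmn by (cases "fst l = fst m"; auto)+
    have n: "2 * cancel f m n \<le> len (f m)" "fst n = fst m \<Longrightarrow> 2 * cancel f m n < len (f m)"
      using c1[of m n] cs[of m] same_index[of n m] lmn by (cases "fst n = fst m"; auto)+
    define k where "k = cancel f m n"
    \<comment> \<open>Both cancellations are at most half and together reach the full length, so
      both are exactly half. Equal indices are excluded because an element cancels strictly less
      than half against itself.\<close>
    have k: "len (f m) = 2 * k" "cancel f m n = k" "cancel f l m = k" "fst l \<noteq> fst m" "fst n \<noteq> fst m"
      using l n lmn(6) by (auto simp: k_def)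
    have B': "2 * fst x + 1 < B" if "x \<in> set (rep_fg (f m)) \<union> set (rep_fg (- f m))" for x
    proof -
      have "f m \<in> gset I" "- f m \<in> gset I" using fgisoD(3)[OF f lmn(2)] by simp_all
      then have "fst x \<in> I" using that unfolding gset_def by auto
      then show ?thesis by (rule B)
    qed
    have "take k (rep_fg (f m)) \<noteq> take k (rep_fg (- f m))"
    proof
      assume "take k (rep_fg (f m)) = take k (rep_fg (- f m))"
      then have "k \<le> cancel f m m" using k(1) by (simp add: cancel_def gp_def le_lcp)
      then show False using cs[OF lmn(2)] k(1) by simp
    qed
    then have "rank B (take k (rep_fg (f m))) \<noteq> rank B (take k (rep_fg (- f m)))"
      using rank_inject[of "take k (rep_fg (f m))" "take k (rep_fg (- f m))" B] B' k(1)
      by (auto dest: in_set_takeD)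
    then consider "rank B (take k (rep_fg (f m))) < rank B (take k (rep_fg (- f m)))"
      | "rank B (take k (rep_fg (f (linv m)))) < rank B (take k (rep_fg (- f (linv m))))"
      unfolding inv minus_minus by (elim linorder_neqE_nat)
    then show thesis
    proof cases
      case 1
      then show thesis using tie[of m n k] lmn k by simp
    next
      case 2
      then show thesis using tie[of "linv m" "linv l" k] lmn k csym[of m l] by (simp add: inv)
    qed
  qed
qed

subsection \<open>Every automorphism is a product of steps\<close>

abbreviation reach :: "state \<Rightarrow> state \<Rightarrow> bool" where
  "reach \<equiv> step\<^sup>*\<^sup>*"

definition act :: "nat set \<Rightarrow> (letter \<Rightarrow> fg) \<Rightarrow> (key \<Rightarrow> word) \<Rightarrow> state" where
  "act I f w = (I, \<lambda>k. rep_fg (ext f (gw (w k))))"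

definition gen :: "nat set \<Rightarrow> (letter \<Rightarrow> fg) \<Rightarrow> bool" where
  "gen I f \<longleftrightarrow> (\<forall>w. valid (I, w) \<longrightarrow> reach (I, w) (act I f w))"

lemma reach_valid: "reach x y \<Longrightarrow> valid x \<Longrightarrow> valid y"
  by (induction rule: rtranclp_induct) (auto dest: step_valid)

lemma gen_cong: "gen I f \<Longrightarrow> (\<And>l. fst l \<in> I \<Longrightarrow> f l = g l) \<Longrightarrow> gen I g"
proof -
  assume f: "gen I f" and eq: "\<And>l. fst l \<in> I \<Longrightarrow> f l = g l"
  have "act I f w = act I g w" if "valid (I, w)" for w
  proof -
    have "ext f (gw (w k)) = ext g (gw (w k))" for k
    proof -
      have "gw (w k) \<in> gset I" using gset_gw validD(3)[OF that, of k] by simp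
      then show ?thesis by (rule ext_cong) (rule eq)
    qed
    then show ?thesis by (simp add: act_def)
  qed
  then show ?thesis using f by (simp add: gen_def)
qed

lemma gen_comp:
  assumes "gen I f" "gen I g" "symf f" "symf g"
  shows "gen I (\<lambda>l. ext f (g l))"
  unfolding gen_def
proof (intro allI impI)
  fix w assume w: "valid (I, w)"
  let ?w = "snd (act I g w)"
  have r: "reach (I, w) (I, ?w)" using assms(2) w by (simp add: gen_def act_def)
  then have "reach (I, ?w) (act I f ?w)" using assms(1) reach_valid[OF _ w] by (simp add: gen_def)
  moreover have "act I f ?w = act I (\<lambda>l. ext f (g l)) w" by (simp add: act_def ext_comp assms)
  ultimately show "reach (I, w) (act I (\<lambda>l. ext f (g l)) w)" using r by simp
qed

lemma gen_id: "gen I gl"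
proof -
  have "act I gl w = (I, w)" if "valid (I, w)" for w
    using validD(2)[OF that] by (simp add: act_def)
  then show ?thesis by (simp add: gen_def)
qed

lemma gen_transvect: "fst l \<in> I \<Longrightarrow> fst l \<noteq> fst m \<Longrightarrow> gen I (transvect l m)"
  using step_transvect unfolding gen_def act_def by blast

lemma gen_flip: "i \<in> I \<Longrightarrow> gen I (flip i)"
  using step_flip unfolding gen_def act_def by blast

lemma gen_perm:
  assumes "bij \<rho>" "\<rho> ` I = I"
  shows "gen I (\<lambda>l. gl (mapl \<rho> l))"
  unfolding gen_def
proof (intro allI impI)
  fix w assume w: "valid (I, w)"
  have "rename \<rho> (I, w) = act I (\<lambda>l. gl (mapl \<rho> l)) w"
    using assms validD(2)[OF w] by (simp add: rename_def act_def rep_mapl bij_is_inj)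
  then have "ren (I, w) (act I (\<lambda>l. gl (mapl \<rho> l)) w)" using assms(1) unfolding ren_def by metis
  then show "reach (I, w) (act I (\<lambda>l. gl (mapl \<rho> l)) w)" using ren_imp_step[OF w] by blast
qed

definition flips :: "nat set \<Rightarrow> letter \<Rightarrow> fg" where
  "flips S x = (if fst x \<in> S then - gl x else gl x)"

lemma symf_flips: "symf (flips S)"
  by (rule symfI) (simp add: flips_def)

lemma gen_flips: "finite S \<Longrightarrow> S \<subseteq> I \<Longrightarrow> gen I (flips S)"
proof (induction S rule: finite_induct)
  case empty
  have "flips {} = gl" by (simp add: flips_def fun_eq_iff)
  then show ?case using gen_id by simp
next
  case (insert i S)
  have "flips (insert i S) = (\<lambda>l. ext (flip i) (flips S l))"
    using insert.hyps by (auto simp: flips_def flip_def fun_eq_iff ext_uminus symf_flip)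
  then show ?case using gen_comp[OF gen_flip _ symf_flip symf_flips] insert by simp
qed

text \<open>Every basis letter is the image of a letter, so on the finite set \<open>I\<close> the
  map permutes letters up to inversion: sign changes followed by a renaming.\<close>

lemma gen_nreduced:
  assumes I: "finite I" and f: "fgiso I I f g" and nr: "nreduced I f"
  shows "gen I f"
proof -
  have sf: "symf f" by (rule fgisoD(1)[OF f])
  have inv: "f (linv l) = - f l" for l using symfD[OF sf] .
  have "\<exists>l. fst l \<in> I \<and> f l = gl (i, False)" if "i \<in> I" for i
    using nreduced_letter[OF f nr, of "(i, False)"] that by (metis fst_conv)
  then obtain t where t: "\<And>i. i \<in> I \<Longrightarrow> fst (t i) \<in> I \<and> f (t i) = gl (i, False)" by metis
  let ?\<sigma> = "\<lambda>i. fst (t i)"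
  have inj: "inj_on ?\<sigma> I"
  proof (rule inj_onI)
    fix i j assume ij: "i \<in> I" "j \<in> I" "fst (t i) = fst (t j)"
    then have "t i = t j \<or> t i = linv (t j)" by (simp add: same_index)
    then have "gl (i, False) = gl (j, False) \<or> gl (i, False) = gl (linv (j, False))"
      using t ij inv by (metis gl_linv)
    then show "i = j" unfolding gl_inject by auto
  qed
  then have bij: "bij_betw ?\<sigma> I I" using I t endo_inj_surj[of I ?\<sigma>] by (auto simp: bij_betw_def)
  define \<pi> where "\<pi> i = (if i \<in> I then inv_into I ?\<sigma> i else i)" for i
  have \<pi>: "bij \<pi>" "\<pi> ` I = I"
  proof -
    have "bij_betw (inv_into I ?\<sigma>) I I" by (rule bij_betw_inv_into[OF bij])
    then have "bij_betw \<pi> I I" by (simp add: \<pi>_def cong: bij_betw_cong)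
    then show "\<pi> ` I = I" by (simp add: bij_betw_def)
    have "\<pi> permutes I" using \<open>bij_betw \<pi> I I\<close> by (rule bij_imp_permutes) (simp add: \<pi>_def)
    then show "bij \<pi>" by (rule permutes_bij)
  qed
  define S where "S = {i \<in> I. f (i, False) \<noteq> gl (\<pi> i, False)}"
  have F: "f (i, False) = (if i \<in> S then - gl (\<pi> i, False) else gl (\<pi> i, False))" if i: "i \<in> I" for i
  proof -
    have p: "\<pi> i \<in> I" "fst (t (\<pi> i)) = i"
      using i \<pi>(2) bij f_inv_into_f[of i ?\<sigma> I] by (auto simp: \<pi>_def bij_betw_def)
    then have "t (\<pi> i) = (i, False) \<or> t (\<pi> i) = linv (i, False)" using same_index[of "t (\<pi> i)" "(i, False)"] by simp
    then have "f (i, False) = gl (\<pi> i, False) \<or> f (i, False) = - gl (\<pi> i, False)"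
      using t[OF p(1)] inv by (metis minus_minus)
    then show ?thesis using i by (auto simp: S_def)
  qed
  have "ext (\<lambda>l. gl (mapl \<pi> l)) (flips S l) = f l" if "fst l \<in> I" for l
  proof -
    have 0: "ext (\<lambda>l. gl (mapl \<pi> l)) (flips S (i, False)) = f (i, False)" if "i \<in> I" for i
      using F[OF that] by (simp add: flips_def ext_uminus symf_mapl)
    show ?thesis
    proof (cases "snd l")
      case False
      then show ?thesis using 0[OF that] by (cases l) simp
    next
      case True
      then have l: "l = linv (fst l, False)" by (cases l) simp
      show ?thesis
        by (subst (1 2) l) (simp add: inv 0[OF that] symfD[OF symf_flips] ext_uminus symf_mapl del: linv_Pair)
    qed
  qed
  moreover have "gen I (\<lambda>l. ext (\<lambda>l. gl (mapl \<pi> l)) (flips S l))"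
    by (rule gen_comp[OF gen_perm[OF \<pi>] gen_flips symf_mapl symf_flips])
       (use I in \<open>auto simp: S_def\<close>)
  ultimately show ?thesis by (rule gen_cong[rotated])
qed

lemma transvect_inverse: "fst l \<noteq> fst m \<Longrightarrow> ext (transvect l m) (transvect (linv l) m x) = gl x"
proof -
  assume lm: "fst l \<noteq> fst m"
  then have "transvect l m l = gl l" by (auto simp: transvect_def)
  moreover have "transvect l m m = gl l + gl m" by (simp add: transvect_def)
  ultimately show ?thesis
    unfolding transvect_def[of "linv l"]
    by (auto simp: ext_add ext_diff ext_uminus symf_transvect symfD[OF symf_transvect] grp simp del: add_uminus_conv_diff)
      (simp add: transvect_def)
qed

lemma fgiso_transvect:
  assumes "fst l \<in> I" "fst m \<in> I" "fst l \<noteq> fst m"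
  shows "fgiso I I (transvect l m) (transvect (linv l) m)"
proof (rule fgisoI)
  have "transvect l' m x \<in> gset I" if "fst x \<in> I" "fst l' \<in> I" for x l'
    using that assms by (auto simp: transvect_def)
  then show "transvect l m x \<in> gset I" "transvect (linv l) m x \<in> gset I" if "fst x \<in> I" for x using that assms by simp_all
  show "ext (transvect l m) (transvect (linv l) m x) = gl x" for x using transvect_inverse assms by simp
  show "ext (transvect (linv l) m) (transvect l m x) = gl x" for x using transvect_inverse[of "linv l" m x] assms by simp
qed (rule symf_transvect)+

text \<open>Well-founded induction along Nielsen reduction: precomposition with a transvection
  lowers total length or, at equal length, total weight, and the inverse transvection, itself a
  step, undoes it.\<close>

theorem gen_fgiso:
  assumes I: "finite I"
  shows "fgiso I I f g \<Longrightarrow> gen I f"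
proof -
  obtain B where B: "\<And>i. i \<in> I \<Longrightarrow> 2 * i + 1 < B"
  proof -
    obtain b where "\<forall>i\<in>I. i \<le> b" using I finite_nat_set_iff_bounded_le by blast
    then show thesis using that[of "2 * b + 2"] by fastforce
  qed
  show "fgiso I I f g \<Longrightarrow> gen I f"
  proof (induction f arbitrary: g rule: wf_induct_rule[OF wf_measures[of "[total I len, total I (weight B)]"]])
    case (1 f)
    show ?case
    proof (cases "nreduced I f")
      case True
      then show ?thesis using gen_nreduced[OF I 1(2)] by blast
    next
      case False
      obtain l m where lm: "fst l \<in> I" "fst m \<in> I" "fst l \<noteq> fst m"
        and dec: "total I len (\<lambda>x. ext f (transvect l m x)) < total I len f \<or>
         total I len (\<lambda>x. ext f (transvect l m x)) = total I len f \<and>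
         total I (weight B) (\<lambda>x. ext f (transvect l m x)) < total I (weight B) f"
        using nielsen_decrease[OF I 1(2) B False] by blast
      let ?f = "\<lambda>x. ext f (transvect l m x)"
      have sf: "symf f" by (rule fgisoD(1)[OF 1(2)])
      have "gen I ?f"
      proof (rule 1(1))
        show "(?f, f) \<in> measures [total I len, total I (weight B)]" using dec by simp
        show "fgiso I I ?f (\<lambda>l'. ext (transvect (linv l) m) (g l'))"
          by (rule fgiso_comp[OF fgiso_transvect[OF lm] 1(2)])
      qed
      moreover have "gen I (transvect (linv l) m)" using gen_transvect lm by simp
      ultimately have "gen I (\<lambda>x. ext ?f (transvect (linv l) m x))"
        using gen_comp symf_transvect symf_comp sf by blast
      moreover have "ext ?f (transvect (linv l) m x) = f x" for x
        by (simp add: ext_comp sf symf_transvect transvect_inverse lm)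
      ultimately show ?thesis by simp
    qed
  qed
qed

lemma reach_conj_word:
  assumes "valid (I, w)" "fst ` set u \<subseteq> I"
  shows "reach (I, w) (I, \<lambda>k. rep_fg (if fst k = i then - gw u + gw (w k) + gw u else gw (w k)))"
  using assms
proof (induction u arbitrary: w)
  case Nil
  have "rep_fg (if fst k = i then - gw [] + gw (w k) + gw [] else gw (w k)) = w k" for k
    using validD(2)[OF Nil(1), of k] by simp
  then have "(\<lambda>k. rep_fg (if fst k = i then - gw [] + gw (w k) + gw [] else gw (w k))) = w" by (rule HOL.ext)
  then show ?case by (simp only: rtranclp.rtrancl_refl)
next
  case (Cons l u)
  let ?w = "\<lambda>k. rep_fg (if fst k = i then - gl l + gw (w k) + gl l else gw (w k))"
  have s: "step (I, w) (I, ?w)" using step_conj[OF Cons.prems(1)] Cons.prems(2) by simp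
  then have "reach (I, ?w) (I, \<lambda>k. rep_fg (if fst k = i then - gw u + gw (?w k) + gw u else gw (?w k)))"
    using Cons step_valid by simp
  moreover have "(\<lambda>k. rep_fg (if fst k = i then - gw u + gw (?w k) + gw u else gw (?w k))) =
     (\<lambda>k. rep_fg (if fst k = i then - gw (l # u) + gw (w k) + gw (l # u) else gw (w k)))"
    by (auto simp: grp fun_eq_iff simp del: add_uminus_conv_diff)
  ultimately show ?case using s by (metis (no_types, lifting) converse_rtranclp_into_rtranclp)
qed

text \<open>A conjugation step drags a single marked point, so a finite chain can treat all blocks
  only if almost all conjugators are trivial.\<close>

lemma reach_conj:
  assumes "finite N"
  shows "(\<And>i. z i \<in> gset I) \<Longrightarrow> (\<And>i. i \<notin> N \<Longrightarrow> z i = 0) \<Longrightarrow> valid (I, w) \<Longrightarrow>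
    reach (I, w) (I, \<lambda>k. rep_fg (- z (fst k) + gw (w k) + z (fst k)))"
  using assms
proof (induction N arbitrary: z rule: finite_induct)
  case empty
  have "rep_fg (gw (w k)) = w k" for k using validD(2)[OF empty(3), of k] by simp
  then show ?case using empty(2) by simp
next
  case (insert i N)
  let ?z = "z(i := 0)"
  let ?w = "\<lambda>k. rep_fg (- ?z (fst k) + gw (w k) + ?z (fst k))"
  let ?u = "rep_fg (z i)"
  have r: "reach (I, w) (I, ?w)" by (rule insert.IH) (use insert.prems in auto)
  have "reach (I, ?w) (I, \<lambda>k. rep_fg (if fst k = i then - gw ?u + gw (?w k) + gw ?u else gw (?w k)))"
    by (rule reach_conj_word) (use reach_valid[OF r] insert.prems(1)[of i] insert.prems(3) in \<open>auto simp: gset_def\<close>)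
  moreover have "(\<lambda>k. rep_fg (if fst k = i then - gw ?u + gw (?w k) + gw ?u else gw (?w k))) =
     (\<lambda>k. rep_fg (- z (fst k) + gw (w k) + z (fst k)))"
    by (auto simp: fun_eq_iff)
  ultimately show ?case using r by (metis (no_types, lifting) rtranclp_trans)
qed

theorem orb_reach:
  assumes "orb x y f z" "valid x" "valid y" "fst x = fst y" "finite N" "\<And>i. i \<notin> N \<Longrightarrow> z i = 0"
    "\<And>i. z i \<in> gset (fst x)"
  shows "reach x y"
proof -
  obtain I w where x: "x = (I, w)" by (cases x)
  obtain g where "fgiso I I f g" using assms(1,4) x unfolding orb_def by auto
  then have r: "reach x (act I f w)"
    using gen_fgiso assms(2) validD(1)[OF assms(2)] by (simp add: gen_def x)
  let ?w = "snd (act I f w)"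
  have "reach (I, ?w) (I, \<lambda>k. rep_fg (- z (fst k) + gw (?w k) + z (fst k)))"
    by (rule reach_conj[OF assms(5)]) (use assms(6,7) x reach_valid[OF r assms(2)] in \<open>auto simp: act_def\<close>)
  moreover have "(\<lambda>k. rep_fg (- z (fst k) + gw (?w k) + z (fst k))) = snd y"
  proof
    fix k
    have "gw (snd y k) = - z (fst k) + ext f (gw (snd x k)) + z (fst k)"
      using assms(1) unfolding orb_def by blast
    then have "rep_fg (- z (fst k) + gw (?w k) + z (fst k)) = rep_fg (gw (snd y k))"
      by (simp add: act_def x)
    also have "\<dots> = snd y k" using validD(2)[OF assms(3)] by simp
    finally show "rep_fg (- z (fst k) + gw (?w k) + z (fst k)) = snd y k" .
  qed
  ultimately have "reach (I, ?w) y" using assms(4) x by (metis fst_conv prod.collapse)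
  then show ?thesis using r by (simp add: act_def)
qed

subsection \<open>Chains of bounded height\<close>

lemma below_mono: "below K h x y \<Longrightarrow> h \<le> h' \<Longrightarrow> below K h' x y"
  unfolding below_def by (induction rule: rtranclp_induct) (auto elim: rtranclp.rtrancl_into_rtrancl)

lemma reach_below: "reach x y \<Longrightarrow> \<exists>h. below K h x y"
proof (induction rule: rtranclp_induct)
  case base
  then show ?case using below_refl by blast
next
  case (step y z)
  then obtain h where h: "below K h x y" by blast
  let ?h = "h + Suc (height K y + height K z)"
  have "below K ?h x y" using below_mono[OF h] by simp
  moreover have "below K ?h y z" using step.hyps by (intro belowI) auto
  ultimately show ?case using below_trans by blast
qed

text \<open>Renamings act on all names, so a bijection from \<open>A\<close> to \<open>B\<close> has
  to be completed by one from \<open>B - A\<close> back to \<open>A - B\<close>.\<close>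

lemma finite_bij:
  fixes A B :: "nat set"
  assumes "finite A" "finite B" "card A = card B"
  obtains \<rho> where "bij \<rho>" "\<rho> ` A = B"
proof -
  obtain f where f: "bij_betw f A B" using assms finite_same_card_bij by blast
  have "card (A - B) = card (B - A)"
    using assms by (metis card_Diff_subset_Int finite_Int inf_commute)
  then obtain g where g: "bij_betw g (B - A) (A - B)"
    using assms finite_same_card_bij[of "B - A" "A - B"] by auto
  define \<rho> where "\<rho> x = (if x \<in> A then f x else if x \<in> B then g x else x)" for x
  have 1: "bij_betw \<rho> A B" using f by (simp add: \<rho>_def cong: bij_betw_cong)
  have 2: "bij_betw \<rho> (B - A) (A - B)" using g by (subst bij_betw_cong[of _ _ g]) (auto simp: \<rho>_def)
  have "bij_betw \<rho> (A \<union> (B - A)) (B \<union> (A - B))" by (rule bij_betw_combine[OF 1 2]) auto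
  then have "bij_betw \<rho> (A \<union> B) (A \<union> B)" by (simp add: Un_commute)
  then have "\<rho> permutes (A \<union> B)" by (rule bij_imp_permutes) (simp add: \<rho>_def)
  then show thesis using that[of \<rho>] 1 permutes_bij by (auto simp: bij_betw_def)
qed

text \<open>The form of a step that the search can imitate: the same alphabet at both ends, and only
  the short automorphism and conjugators remembered.\<close>

definition link :: "nat set \<Rightarrow> key set \<Rightarrow> nat \<Rightarrow> state \<Rightarrow> state \<Rightarrow> bool" where
  "link I K h x y \<longleftrightarrow> fst x = I \<and> fst y = I \<and> valid x \<and> valid y \<and> height K x \<le> h \<and> height K y \<le> h \<and>
     (\<exists>f z. orb x y f z \<and> small I f z)"

lemma linkI: "step x y \<Longrightarrow> fst x = I \<Longrightarrow> fst y = I \<Longrightarrow> height K x < Suc h \<Longrightarrow> height K y < Suc h \<Longrightarrow> link I K h x y"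
  using step_valid[of x y] orb_step[of x y] unfolding link_def by simp

text \<open>Each family of the chain is renamed back to the alphabet \<open>I\<close>, which changes
  no height; the renaming is absorbed into the adjacent steps.\<close>

lemma below_link:
  assumes "below K (Suc h) x y" "valid x" "fst x = I"
  shows "\<exists>y'. ren y y' \<and> fst y' = I \<and> (link I K h)\<^sup>*\<^sup>* x y' \<and> valid y'"
  using assms(1) unfolding below_def
proof (induction rule: rtranclp_induct)
  case base
  then show ?case using assms(2,3) ren_refl by blast
next
  case (step y z)
  then obtain y' where y': "ren y y'" "fst y' = I" "(link I K h)\<^sup>*\<^sup>* x y'" "valid y'" by blast
  have st: "step y' z" using ren_step[OF ren_sym[OF y'(1)]] step.hyps by blast
  have fin: "finite (fst z)" "finite I" using step_valid[OF st] y'(2) validD(1) by blast+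
  obtain \<rho> where \<rho>: "bij \<rho>" "\<rho> ` fst z = I"
    using finite_bij[OF fin] step_card[OF st] y'(2) by auto
  let ?z = "rename \<rho> z"
  have z: "ren z ?z" "fst ?z = I" using \<rho> by (auto simp: ren_def rename_def)
  have "link I K h y' ?z"
    by (rule linkI[OF step_ren[OF st z(1)]])
       (use y'(2) z step.hyps height_ren[OF y'(1), of K] height_ren[OF z(1), of K] in auto)
  then have "(link I K h)\<^sup>*\<^sup>* x ?z" using y'(3) by simp
  moreover have "valid ?z" using valid_ren[OF step_valid(2)[OF st] z(1)] .
  ultimately show ?case using z by blast
qed

theorem bounded_chain:
  assumes "orb x y f z" "valid x" "valid y" "fst x = I" "fst y = I" "finite N" "\<And>i. i \<notin> N \<Longrightarrow> z i = 0"
    "\<And>i. z i \<in> gset I" "height K x \<le> h" "height K y \<le> h"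
  shows "(link I K h)\<^sup>*\<^sup>* x y"
proof -
  have "reach x y" by (rule orb_reach[OF assms(1-3)]) (use assms in auto)
  then obtain H where "below K H x y" using reach_below by blast
  then have "below K (Suc h) x y" by (rule below_reduce) (use assms(9,10) in auto)
  then obtain y' where y': "ren y y'" "fst y' = I" "(link I K h)\<^sup>*\<^sup>* x y'" "valid y'"
    using below_link assms(2,4) by blast
  \<comment> \<open>The chain ends at a renaming of \<open>y\<close>; one more step, at the same
    height, repairs this.\<close>
  have "link I K h y' y"
    by (rule linkI[OF ren_imp_step[OF y'(4) ren_sym[OF y'(1)]]])
       (use y'(2) assms(5,10) height_ren[OF y'(1), of K] in auto)
  then show ?thesis using y'(3) by simp
qed

section \<open>Recursive functions on coded data\<close>

definition rec1 :: "(nat \<Rightarrow> nat) \<Rightarrow> bool" where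
  "rec1 f \<longleftrightarrow> recursive 1 (\<lambda>xs. f (xs ! 0))"

definition rec2 :: "(nat \<Rightarrow> nat \<Rightarrow> nat) \<Rightarrow> bool" where
  "rec2 f \<longleftrightarrow> recursive 2 (\<lambda>xs. f (xs ! 0) (xs ! 1))"

definition rec3 :: "(nat \<Rightarrow> nat \<Rightarrow> nat \<Rightarrow> nat) \<Rightarrow> bool" where
  "rec3 f \<longleftrightarrow> recursive 3 (\<lambda>xs. f (xs ! 0) (xs ! 1) (xs ! 2))"

lemma recursive_comp1: "rec1 f \<Longrightarrow> recursive k g \<Longrightarrow> recursive k (\<lambda>xs. f (g xs))"
  using recursive.comp[of "[g]" "\<lambda>xs. f (xs ! 0)" k] by (simp add: rec1_def)

lemma recursive_comp2:
  "rec2 f \<Longrightarrow> recursive k g \<Longrightarrow> recursive k h \<Longrightarrow> recursive k (\<lambda>xs. f (g xs) (h xs))"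
  using recursive.comp[of "[g, h]" "\<lambda>xs. f (xs ! 0) (xs ! 1)" k]
  by (simp add: rec2_def numeral_2_eq_2)

lemma length_Suc0: "length xs = Suc 0 \<longleftrightarrow> (\<exists>x. xs = [x])"
  by (auto simp: length_Suc_conv)

lemma rec2_rec_nat:
  assumes "rec1 f" "rec3 g"
  shows "rec2 (\<lambda>n p. rec_nat (f p) (\<lambda>y r. g y r p) n)"
proof -
  have "recursive (Suc 1) (\<lambda>xs. rec_nat (f (tl xs ! 0))
      (\<lambda>y r. g ((y # r # tl xs) ! 0) ((y # r # tl xs) ! 1) ((y # r # tl xs) ! 2)) (hd xs))"
    by (rule recursive.prim_rec) (use assms in \<open>simp_all add: rec1_def rec3_def numeral_3_eq_3\<close>)
  then show ?thesis
    unfolding rec2_def numeral_2_eq_2 One_nat_def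
    by (rule recursive.cong) (auto simp: length_Suc_conv)
qed

lemma rec1_rec_nat:
  assumes "rec3 (\<lambda>y r p. g y r)"
  shows "rec1 (\<lambda>n. rec_nat c g n)"
proof -
  have c: "rec1 (\<lambda>_. c)"
  proof (induction c)
    case 0
    then show ?case unfolding rec1_def by (rule recursive.zero)
  next
    case (Suc c)
    then show ?case unfolding rec1_def
      using recursive_comp1[of Suc 1 "\<lambda>_. c"] recursive.suc by (simp add: rec1_def)
  qed
  have "rec2 (\<lambda>n p. rec_nat c (\<lambda>y r. g y r) n)"
    by (rule rec2_rec_nat[OF c assms])
  then have "recursive 1 (\<lambda>xs. rec_nat c g (xs ! 0))"
    by (rule recursive_comp2) (rule recursive.proj, simp)+
  then show ?thesis by (simp add: rec1_def)
qed

lemma rec3_proj: "rec3 (\<lambda>y r p. y)" "rec3 (\<lambda>y r p. r)" "rec3 (\<lambda>y r p. p)"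
  unfolding rec3_def by (rule recursive.proj, simp)+

lemma rec3_comp: "rec1 f \<Longrightarrow> rec3 g \<Longrightarrow> rec3 (\<lambda>y r p. f (g y r p))"
  "rec2 h \<Longrightarrow> rec3 g \<Longrightarrow> rec3 g' \<Longrightarrow> rec3 (\<lambda>y r p. h (g y r p) (g' y r p))"
  unfolding rec3_def by (erule recursive_comp1, assumption) (erule recursive_comp2, assumption+)

lemma rec1_Suc: "rec1 Suc"
  using recursive.suc by (simp add: rec1_def)

lemma rec1_id: "rec1 (\<lambda>x. x)"
  unfolding rec1_def by (rule recursive.proj) simp

lemma rec1_comp: "rec1 f \<Longrightarrow> rec1 g \<Longrightarrow> rec1 (\<lambda>x. f (g x))"
  unfolding rec1_def[of g] rec1_def[of "\<lambda>x. f (g x)"] by (rule recursive_comp1)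

lemma rec1_comp2: "rec2 h \<Longrightarrow> rec1 f \<Longrightarrow> rec1 g \<Longrightarrow> rec1 (\<lambda>x. h (f x) (g x))"
  unfolding rec1_def by (rule recursive_comp2)

lemma rec1_const: "rec1 (\<lambda>_. c)"
  by (induction c) (auto simp: rec1_def intro: recursive.zero dest: recursive_comp1[OF rec1_Suc])

section \<open>Arithmetic, pairing and reduction to unary functions\<close>

lemma rec2_add: "rec2 (+)"
proof -
  have "rec_nat p (\<lambda>y r. Suc r) n = n + p" for n p :: nat by (induction n) auto
  then show ?thesis
    using rec2_rec_nat[OF rec1_id rec3_comp(1)[OF rec1_Suc rec3_proj(2)]] by simp
qed

lemma rec1_pred: "rec1 (\<lambda>x. x - 1)"
proof -
  have "rec_nat 0 (\<lambda>y r. y) n = n - 1" for n :: nat by (cases n) auto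
  then show ?thesis using rec1_rec_nat[OF rec3_proj(1), of 0] by simp
qed

lemma rec2_swap: "rec2 f \<Longrightarrow> rec2 (\<lambda>x y. f y x)"
  unfolding rec2_def[of "\<lambda>x y. f y x"]
  by (erule recursive_comp2) (rule recursive.proj, simp)+

lemma rec2_sub: "rec2 (-)"
proof -
  have "rec_nat p (\<lambda>y r. r - 1) n = p - n" for n p :: nat by (induction n) auto
  then have "rec2 (\<lambda>n p. p - n)"
    using rec2_rec_nat[OF rec1_id rec3_comp(1)[OF rec1_pred rec3_proj(2)]] by simp
  then show ?thesis using rec2_swap[of "\<lambda>n p. p - n"] by simp
qed

lemma rec1_triangle: "rec1 triangle"
proof -
  have *: "rec_nat 0 (\<lambda>y r. r + Suc y) n = triangle n" for n by (induction n) auto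
  have "rec3 (\<lambda>y r p. r + Suc y)"
    by (rule rec3_comp(2)[OF rec2_add rec3_proj(2) rec3_comp(1)[OF rec1_Suc rec3_proj(1)]])
  then show ?thesis using rec1_rec_nat[of "\<lambda>y r. r + Suc y" 0] by (simp only: *)
qed

abbreviation pr :: "nat \<Rightarrow> nat \<Rightarrow> nat" where
  "pr a b \<equiv> prod_encode (a, b)"

abbreviation p1 :: "nat \<Rightarrow> nat" where
  "p1 x \<equiv> fst (prod_decode x)"

abbreviation p2 :: "nat \<Rightarrow> nat" where
  "p2 x \<equiv> snd (prod_decode x)"

lemma rec2_pr: "rec2 pr"
proof -
  have p: "recursive 2 (\<lambda>xs. xs ! 0)" "recursive 2 (\<lambda>xs. xs ! 1)"
    by (rule recursive.proj, simp)+
  have "recursive 2 (\<lambda>xs. triangle (xs ! 0 + xs ! 1) + xs ! 0)"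
    by (intro recursive_comp2[OF rec2_add] recursive_comp1[OF rec1_triangle] p)
  then show ?thesis by (simp add: rec2_def prod_encode_def)
qed

lemma triangle_mono: "m \<le> n \<Longrightarrow> triangle m \<le> triangle n"
  by (induction n) (auto simp: le_Suc_eq)

text \<open>The diagonal \<open>a + b = s\<close> occupies the codes from \<open>triangle s\<close>
  to just below \<open>triangle (Suc s)\<close>. The truncated difference vanishes once the code
  lies below the next diagonal, so minimisation finds the right one.\<close>

lemma diagonal: "(LEAST s. Suc (pr a b) - triangle (Suc s) = 0) = a + b"
proof (rule Least_equality)
  show "Suc (pr a b) - triangle (Suc (a + b)) = 0" by (simp add: prod_encode_def)
  show "a + b \<le> s" if "Suc (pr a b) - triangle (Suc s) = 0" for s
  proof (rule ccontr)
    assume "\<not> a + b \<le> s"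
    then have "triangle (Suc s) \<le> triangle (a + b)" by (intro triangle_mono) simp
    then show False using that by (simp add: prod_encode_def)
  qed
qed

lemma rec1_p1: "rec1 p1" and rec1_p2: "rec1 p2"
proof -
  let ?d = "\<lambda>z. LEAST s. Suc z - triangle (Suc s) = 0"
  have p: "recursive (Suc 1) (\<lambda>xs. xs ! 0)" "recursive (Suc 1) (\<lambda>xs. xs ! 1)"
    by (rule recursive.proj, simp)+
  have le: "n \<le> triangle n" for n by (induction n) auto
  have "recursive (Suc 1) (\<lambda>xs. Suc (xs ! 1) - triangle (Suc (xs ! 0)))"
    by (intro recursive_comp2[OF rec2_sub] recursive_comp1[OF rec1_triangle] recursive_comp1[OF rec1_Suc] p)
  moreover have "Suc x - triangle (Suc x) = 0" for x using le[of "Suc x"] by simp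
  then have "\<forall>xs. length xs = 1 \<longrightarrow> (\<exists>y. Suc ((y # xs) ! 1) - triangle (Suc ((y # xs) ! 0)) = 0)"
  proof (intro allI impI)
    fix xs :: "nat list" assume *: "\<And>x. Suc x - triangle (Suc x) = 0" and "length xs = 1"
    then obtain x where "xs = [x]" by (auto simp: length_Suc0)
    then show "\<exists>y. Suc ((y # xs) ! 1) - triangle (Suc ((y # xs) ! 0)) = 0"
      using *[of x] by (intro exI[of _ x]) (simp only: nth_Cons_0 One_nat_def nth_Cons_Suc)
  qed
  ultimately have "recursive 1 (\<lambda>xs. LEAST y. Suc ((y # xs) ! 1) - triangle (Suc ((y # xs) ! 0)) = 0)"
    by (rule recursive.minimise)
  then have d: "rec1 ?d" by (simp add: rec1_def)
  have dz: "?d z = p1 z + p2 z" for z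
    using diagonal[of "p1 z" "p2 z"] by (simp del: triangle_Suc)
  have z: "z = triangle (p1 z + p2 z) + p1 z" for z
  proof -
    have "prod_encode (p1 z, p2 z) = z" by simp
    then show ?thesis unfolding prod_encode_def prod.case by (rule sym)
  qed
  have "rec1 (\<lambda>z. z - triangle (?d z))"
    by (intro rec1_comp2[OF rec2_sub] rec1_comp[OF rec1_triangle] d rec1_id)
  moreover have "z - triangle (?d z) = p1 z" for z
    unfolding dz using z[of z] by linarith
  ultimately show 1: "rec1 p1" by simp
  have "rec1 (\<lambda>z. ?d z - p1 z)" by (intro rec1_comp2[OF rec2_sub] d 1)
  then show "rec1 p2" unfolding dz by simp
qed

lemma rec1_pr: "rec1 f \<Longrightarrow> rec1 g \<Longrightarrow> rec1 (\<lambda>x. pr (f x) (g x))"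
  by (rule rec1_comp2[OF rec2_pr])

lemma rec1_primrec:
  assumes "rec1 b" "rec1 s" "rec1 n"
  shows "rec1 (\<lambda>x. rec_nat (b x) (\<lambda>y r. s (pr y (pr r x))) (n x))"
proof -
  have "rec3 (\<lambda>y r p. s (pr y (pr r p)))"
    by (intro rec3_comp(1)[OF assms(2)] rec3_comp(2)[OF rec2_pr] rec3_proj)
  then have "rec2 (\<lambda>n p. rec_nat (b p) (\<lambda>y r. s (pr y (pr r p))) n)" by (rule rec2_rec_nat[OF assms(1)])
  then show ?thesis using rec1_comp2[OF _ assms(3) rec1_id] by blast
qed

lemma rec1_if:
  assumes "rec1 c" "rec1 f" "rec1 g"
  shows "rec1 (\<lambda>x. if c x = 0 then f x else g x)"
proof -
  have "rec1 (\<lambda>x. g (p2 (p2 x)))" by (intro rec1_comp[OF assms(3)] rec1_comp[OF rec1_p2] rec1_p2)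
  from rec1_primrec[OF assms(2) this assms(1)]
  have "rec1 (\<lambda>x. rec_nat (f x) (\<lambda>y r. g x) (c x))" by simp
  moreover have "rec_nat (f x) (\<lambda>y r. g x) (c x) = (if c x = 0 then f x else g x)" for x
    by (cases "c x") auto
  ultimately show ?thesis by simp
qed

lemma rec1_minimise:
  assumes "rec1 f" "\<And>x. \<exists>y. f (pr y x) = 0"
  shows "rec1 (\<lambda>x. LEAST y. f (pr y x) = 0)"
proof -
  have p: "recursive (Suc 1) (\<lambda>xs. xs ! 0)" "recursive (Suc 1) (\<lambda>xs. xs ! 1)"
    by (rule recursive.proj, simp)+
  have "recursive (Suc 1) (\<lambda>xs. f (pr (xs ! 0) (xs ! 1)))"
    by (intro recursive_comp1[OF assms(1)] recursive_comp2[OF rec2_pr] p)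
  then have "recursive 1 (\<lambda>xs. LEAST y. f (pr ((y # xs) ! 0) ((y # xs) ! 1)) = 0)"
    by (rule recursive.minimise) (use assms(2) in simp)
  then show ?thesis by (simp add: rec1_def)
qed

lemma rec1_update: "rec1 f \<Longrightarrow> rec1 (f(a := c))"
proof -
  assume f: "rec1 f"
  have "rec1 (\<lambda>x. if (x - a) + (a - x) = 0 then c else f x)"
    by (intro rec1_if rec1_comp2[OF rec2_add] rec1_comp2[OF rec2_sub] rec1_id rec1_const f)
  moreover have "(\<lambda>x. if (x - a) + (a - x) = 0 then c else f x) = f(a := c)" by auto
  ultimately show ?thesis by simp
qed

text \<open>A finite table is recursive whatever its entries are; this permits the table of
  automorphisms to be hard-wired.\<close>

lemma rec1_finite_support:
  assumes "finite {x. f x \<noteq> 0}" shows "rec1 f"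
proof -
  have "finite A \<Longrightarrow> {x. f x \<noteq> 0} \<subseteq> A \<Longrightarrow> rec1 f" for A f
  proof (induction A arbitrary: f rule: finite_induct)
    case empty
    then have "f = (\<lambda>_. 0)" by auto
    then show ?case using rec1_const by simp
  next
    case (insert a A)
    have "rec1 ((f(a := 0))(a := f a))" by (rule rec1_update, rule insert.IH) (use insert in auto)
    then show ?case by simp
  qed
  then show ?thesis using assms by blast
qed

subsection \<open>Typed codes\<close>

definition encP :: "('a \<Rightarrow> nat) \<Rightarrow> ('b \<Rightarrow> nat) \<Rightarrow> 'a \<times> 'b \<Rightarrow> nat" where
  "encP ea eb x = pr (ea (fst x)) (eb (snd x))"

definition encL :: "('a \<Rightarrow> nat) \<Rightarrow> 'a list \<Rightarrow> nat" where
  "encL ea xs = list_encode (map ea xs)"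

definition encN :: "nat \<Rightarrow> nat" where
  "encN n = n"

definition encB :: "bool \<Rightarrow> nat" where
  "encB b = of_bool b"

text \<open>Computability relative to codings of source and target. The closure rules below form a
  combinator language in which the search is assembled without arithmetic on codes.\<close>

definition cmp :: "('a \<Rightarrow> nat) \<Rightarrow> ('b \<Rightarrow> nat) \<Rightarrow> ('a \<Rightarrow> 'b) \<Rightarrow> bool" where
  "cmp ea eb f \<longleftrightarrow> (\<exists>g. rec1 g \<and> (\<forall>x. g (ea x) = eb (f x)))"

lemma cmpI: "rec1 g \<Longrightarrow> (\<And>x. g (ea x) = eb (f x)) \<Longrightarrow> cmp ea eb f"
  unfolding cmp_def by blast

lemma cmpE: "cmp ea eb f \<Longrightarrow> (\<And>g. rec1 g \<Longrightarrow> (\<And>x. g (ea x) = eb (f x)) \<Longrightarrow> thesis) \<Longrightarrow> thesis"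
  unfolding cmp_def by blast

lemma cmp_id: "cmp ea ea (\<lambda>x. x)"
  by (rule cmpI[OF rec1_id]) simp

lemma cmp_const: "cmp ea eb (\<lambda>_. c)"
  by (rule cmpI[OF rec1_const]) simp

lemma cmp_comp: "cmp eb ec g \<Longrightarrow> cmp ea eb f \<Longrightarrow> cmp ea ec (\<lambda>x. g (f x))"
  by (elim cmpE, rule cmpI, erule rec1_comp, assumption) simp

lemma cmp_pair: "cmp ea eb f \<Longrightarrow> cmp ea ec g \<Longrightarrow> cmp ea (encP eb ec) (\<lambda>x. (f x, g x))"
  by (elim cmpE, rule cmpI, erule rec1_pr, assumption) (simp add: encP_def)

lemma cmp_fst: "cmp ea (encP eb ec) f \<Longrightarrow> cmp ea eb (\<lambda>x. fst (f x))"
  by (elim cmpE, rule cmpI, rule rec1_comp[OF rec1_p1], assumption) (simp add: encP_def)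

lemma cmp_snd: "cmp ea (encP eb ec) f \<Longrightarrow> cmp ea ec (\<lambda>x. snd (f x))"
  by (elim cmpE, rule cmpI, rule rec1_comp[OF rec1_p2], assumption) (simp add: encP_def)

lemma cmp_if: "cmp ea encB c \<Longrightarrow> cmp ea eb f \<Longrightarrow> cmp ea eb g \<Longrightarrow> cmp ea eb (\<lambda>x. if c x then f x else g x)"
proof (elim cmpE)
  fix c' f' g'
  assume r: "rec1 c'" "rec1 f'" "rec1 g'" and *: "\<And>x. c' (ea x) = encB (c x)"
    "\<And>x. f' (ea x) = eb (f x)" "\<And>x. g' (ea x) = eb (g x)"
  show ?thesis
    by (rule cmpI[OF rec1_if[OF r(1,3,2)]]) (simp add: * encB_def)
qed

lemma cmp_and: "cmp ea encB c \<Longrightarrow> cmp ea encB d \<Longrightarrow> cmp ea encB (\<lambda>x. c x \<and> d x)"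
proof -
  assume "cmp ea encB c" "cmp ea encB d"
  then have "cmp ea encB (\<lambda>x. if c x then d x else False)" by (intro cmp_if cmp_const)
  moreover have "(\<lambda>x. if c x then d x else False) = (\<lambda>x. c x \<and> d x)" by auto
  ultimately show ?thesis by simp
qed

lemma cmp_not: "cmp ea encB c \<Longrightarrow> cmp ea encB (\<lambda>x. \<not> c x)"
proof -
  assume "cmp ea encB c"
  then have "cmp ea encB (\<lambda>x. if c x then False else True)" by (intro cmp_if cmp_const)
  moreover have "(\<lambda>x. if c x then False else True) = (\<lambda>x. \<not> c x)" by auto
  ultimately show ?thesis by simp
qed

lemma cmp_le: "cmp ea encN f \<Longrightarrow> cmp ea encN g \<Longrightarrow> cmp ea encB (\<lambda>x. f x \<le> g x)"
proof (elim cmpE)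
  fix f' g' assume r: "rec1 f'" "rec1 g'" and *: "\<And>x. f' (ea x) = encN (f x)" "\<And>x. g' (ea x) = encN (g x)"
  show ?thesis
    by (rule cmpI[OF rec1_if[OF rec1_comp2[OF rec2_sub r] rec1_const[of 1] rec1_const[of 0]]])
       (simp add: * encB_def encN_def)
qed

lemma cmp_eq:
  "inj eb \<Longrightarrow> cmp ea eb f \<Longrightarrow> cmp ea eb g \<Longrightarrow> cmp ea encB (\<lambda>x. f x = g x)"
proof (elim cmpE)
  fix f' g' assume r: "rec1 f'" "rec1 g'" and *: "\<And>x. f' (ea x) = eb (f x)" "\<And>x. g' (ea x) = eb (g x)"
    and inj: "inj eb"
  show ?thesis
  proof (rule cmpI)
    show "rec1 (\<lambda>x. if (f' x - g' x) + (g' x - f' x) = 0 then 1 else 0)"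
      by (intro rec1_if rec1_comp2[OF rec2_add] rec1_comp2[OF rec2_sub] r rec1_const)
    show "(if (f' (ea x) - g' (ea x)) + (g' (ea x) - f' (ea x)) = 0 then 1 else 0) = encB (f x = g x)" for x
      using inj_eq[OF inj, of "f x" "g x"] by (auto simp: * encB_def)
  qed
qed

lemma cmp_Suc: "cmp ea encN f \<Longrightarrow> cmp ea encN (\<lambda>x. Suc (f x))"
  by (elim cmpE, rule cmpI, rule rec1_comp[OF rec1_Suc], assumption) (simp add: encN_def)

lemma cmp_add: "cmp ea encN f \<Longrightarrow> cmp ea encN g \<Longrightarrow> cmp ea encN (\<lambda>x. f x + g x)"
  by (elim cmpE, rule cmpI, rule rec1_comp2[OF rec2_add], assumption, assumption) (simp add: encN_def)

lemma cmp_Cons: "cmp ea eb f \<Longrightarrow> cmp ea (encL eb) g \<Longrightarrow> cmp ea (encL eb) (\<lambda>x. f x # g x)"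
  by (elim cmpE, rule cmpI, rule rec1_comp[OF rec1_Suc], erule rec1_pr, assumption) (simp add: encL_def)

lemma cmp_funpow:
  assumes "cmp ea encN n" "cmp ea es b" "cmp (encP ea es) es (\<lambda>(a, s). F a s)"
  shows "cmp ea es (\<lambda>a. (F a ^^ n a) (b a))"
  using assms
proof (elim cmpE)
  fix n' b' F'
  assume r: "rec1 n'" "rec1 b'" "rec1 F'" and *: "\<And>x. n' (ea x) = encN (n x)" "\<And>x. b' (ea x) = es (b x)"
    "\<And>x. F' (encP ea es x) = es (case x of (a, s) \<Rightarrow> F a s)"
  have s: "rec1 (\<lambda>x. F' (pr (p2 (p2 x)) (p1 (p2 x))))"
    by (intro rec1_comp[OF r(3)] rec1_pr rec1_comp[OF rec1_p2] rec1_comp[OF rec1_p1] rec1_p2)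
  have F': "F' (pr (ea a) (es t)) = es (F a t)" for a t using *(3)[of "(a, t)"] by (simp add: encP_def)
  show ?thesis
  proof (rule cmpI[OF rec1_primrec[OF r(2) s r(1)]])
    fix x
    have "rec_nat (es (b x)) (\<lambda>y r. F' (pr (ea x) r)) m = es ((F x ^^ m) (b x))" for m
      by (induction m) (simp_all add: F')
    then show "rec_nat (b' (ea x)) (\<lambda>y r. F' (pr (p2 (p2 (pr y (pr r (ea x))))) (p1 (p2 (pr y (pr r (ea x)))))))
        (n' (ea x)) = es ((F x ^^ n x) (b x))"
      by (simp add: * encN_def)
  qed
qed

lemma length_le_list_encode: "length xs \<le> list_encode xs"
proof (induction xs)
  case (Cons x xs)
  then show ?case using le_prod_encode_2[of "list_encode xs" x] by simp
qed simp

text \<open>One step takes off the head of the list, and it is iterated as often as the code of the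
  list says. The code is at least the length, and surplus iterations do nothing because the empty
  list has code 0.\<close>

lemma cmp_foldl:
  assumes "cmp ea es b" "cmp ea (encL ex) l" "cmp (encP ea (encP es ex)) es (\<lambda>(a, s, x). F a s x)"
  shows "cmp ea es (\<lambda>a. foldl (F a) (b a) (l a))"
  using assms
proof (elim cmpE)
  fix b' l' F'
  assume r: "rec1 b'" "rec1 l'" "rec1 F'" and *: "\<And>x. b' (ea x) = es (b x)" "\<And>x. l' (ea x) = encL ex (l x)"
    "\<And>x. F' (encP ea (encP es ex) x) = es (case x of (a, s, x) \<Rightarrow> F a s x)"
  define h where "h a q = (if p2 q = 0 then q else
    pr (F' (pr a (pr (p1 q) (p1 (p2 q - 1))))) (p2 (p2 q - 1)))" for a q
  have F': "F' (pr (ea a) (pr (es t) (ex x))) = es (F a t x)" for a t x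
    using *(3)[of "(a, t, x)"] by (simp add: encP_def)
  have pow: "length xs \<le> m \<Longrightarrow> (h (ea a) ^^ m) (pr (es t) (encL ex xs)) = pr (es (foldl (F a) t xs)) 0" for a t xs m
  proof (induction xs arbitrary: t m)
    case Nil
    show ?case by (induction m) (simp_all add: h_def encL_def)
  next
    case (Cons x xs)
    then obtain m' where m: "m = Suc m'" "length xs \<le> m'" by (cases m) auto
    have "h (ea a) (pr (es t) (encL ex (x # xs))) = pr (es (F a t x)) (encL ex xs)"
      by (simp add: h_def encL_def F')
    then show ?case using Cons.IH[OF m(2)] unfolding m(1) funpow_Suc_right by simp
  qed
  have i: "rec1 (\<lambda>x. pr (b' x) (l' x))" by (intro rec1_pr r)
  have q: "rec1 (\<lambda>x. p1 (p2 x))" "rec1 (\<lambda>x. p2 (p2 x))" by (intro rec1_comp[OF rec1_p1] rec1_comp[OF rec1_p2] rec1_p2)+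
  have "rec1 (\<lambda>x. h (p2 (p2 x)) (p1 (p2 x)))"
    unfolding h_def
    by (intro rec1_if rec1_pr rec1_comp[OF r(3)] rec1_comp[OF rec1_p1] rec1_comp[OF rec1_p2]
        rec1_comp[OF rec1_pred] q rec1_p2)
  from rec1_primrec[OF i this r(2)]
  have g: "rec1 (\<lambda>x. rec_nat (pr (b' x) (l' x)) (\<lambda>y r. h x r) (l' x))" by simp
  show ?thesis
  proof (rule cmpI[OF rec1_comp[OF rec1_p1 g]])
    fix a
    have "rec_nat c (\<lambda>y r. h x r) m = (h x ^^ m) c" for x m c by (induction m) simp_all
    then show "p1 (rec_nat (pr (b' (ea a)) (l' (ea a))) (\<lambda>y r. h (ea a) r) (l' (ea a))) =
        es (foldl (F a) (b a) (l a))"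
      using pow[of "l a" "encL ex (l a)" a "b a"] length_le_list_encode[of "map ex (l a)"]
      by (simp add: * encL_def)
  qed
qed

lemma cmp_minimise:
  assumes "surj ea" "cmp (encP encN ea) encB (\<lambda>(n, a). P n a)" "\<And>a. \<exists>n. P n a"
  shows "cmp ea encN (\<lambda>a. LEAST n. P n a)"
  using assms(2)
proof (rule cmpE)
  fix g assume g: "rec1 g" "\<And>x. g (encP encN ea x) = encB (case x of (n, a) \<Rightarrow> P n a)"
  have g': "g (pr n (ea a)) = encB (P n a)" for n a using g(2)[of "(n, a)"] by (simp add: encP_def encN_def)
  let ?f = "\<lambda>x. 1 - g x"
  have f: "?f (pr n (ea a)) = 0 \<longleftrightarrow> P n a" for n a by (simp add: g' encB_def)
  have "rec1 (\<lambda>x. LEAST y. ?f (pr y x) = 0)"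
  proof (rule rec1_minimise)
    show "rec1 ?f" by (intro rec1_comp2[OF rec2_sub] rec1_const g)
    fix x
    obtain a where "x = ea a" using assms(1) by (auto simp: surj_def)
    then show "\<exists>y. ?f (pr y x) = 0" using f assms(3)[of a] by simp
  qed
  then show ?thesis by (rule cmpI) (simp only: f encN_def)
qed

lemma cmp_uncurry:
  "cmp (encP ea ex) ey (\<lambda>(a, x). F a x) \<Longrightarrow> cmp e ea f \<Longrightarrow> cmp e ex g \<Longrightarrow> cmp e ey (\<lambda>y. F (f y) (g y))"
  using cmp_comp[of "encP ea ex" ey "\<lambda>(a, x). F a x" e "\<lambda>y. (f y, g y)"] cmp_pair[of e ea f ex g] by simp

lemma cmp_uncurry3:
  "cmp (encP ea (encP eb ex)) ey (\<lambda>(a, b, x). F a b x) \<Longrightarrow> cmp e ea f \<Longrightarrow> cmp e eb g \<Longrightarrow> cmp e ex h \<Longrightarrow>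
    cmp e ey (\<lambda>y. F (f y) (g y) (h y))"
  using cmp_uncurry[of ea "encP eb ex" ey "\<lambda>a (b, x). F a b x" e f "\<lambda>y. (g y, h y)"] cmp_pair[of e eb g ex h]
  by simp

lemma cmp_rev: assumes "cmp ea (encL ex) l" shows "cmp ea (encL ex) (\<lambda>a. rev (l a))"
proof -
  have *: "foldl (\<lambda>s x. x # s) t xs = rev xs @ t" for t xs :: "'b list" by (induction xs arbitrary: t) auto
  have "cmp ea (encL ex) (\<lambda>a. foldl (\<lambda>s x. x # s) [] (l a))"
    by (rule cmp_foldl[OF cmp_const assms])
       (simp only: case_prod_unfold, (rule cmp_id cmp_Cons cmp_fst cmp_snd)+)
  then show ?thesis by (simp add: *)
qed

lemma cmp_foldr:
  assumes "cmp ea es b" "cmp ea (encL ex) l" "cmp (encP ea (encP ex es)) es (\<lambda>(a, x, s). F a x s)"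
  shows "cmp ea es (\<lambda>a. foldr (F a) (l a) (b a))"
proof -
  have "cmp ea es (\<lambda>a. foldl (\<lambda>s x. F a x s) (b a) (rev (l a)))"
    by (rule cmp_foldl[OF assms(1) cmp_rev[OF assms(2)]])
      (simp only: case_prod_unfold, (rule cmp_id cmp_uncurry3[OF assms(3)] cmp_fst cmp_snd)+)
  then show ?thesis by (simp add: foldr_conv_foldl)
qed

lemma cmp_append:
  assumes "cmp ea (encL ex) l" "cmp ea (encL ex) m" shows "cmp ea (encL ex) (\<lambda>a. l a @ m a)"
proof -
  have "cmp ea (encL ex) (\<lambda>a. foldr (\<lambda>x s. x # s) (l a) (m a))"
    by (rule cmp_foldr[OF assms(2,1)]) (simp only: case_prod_unfold, (rule cmp_id cmp_Cons cmp_fst cmp_snd)+)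
  moreover have "foldr (\<lambda>x s. x # s) xs ys = xs @ ys" for xs ys :: "'b list" by (induction xs) auto
  ultimately show ?thesis by simp
qed

lemma cmp_map:
  assumes "cmp ea (encL ex) l" "cmp (encP ea ex) ey (\<lambda>(a, x). F a x)"
  shows "cmp ea (encL ey) (\<lambda>a. map (F a) (l a))"
proof -
  have "cmp ea (encL ey) (\<lambda>a. foldr (\<lambda>x s. F a x # s) (l a) [])"
    by (rule cmp_foldr[OF cmp_const assms(1)])
      (simp only: case_prod_unfold, (rule cmp_id cmp_Cons cmp_uncurry[OF assms(2)] cmp_fst cmp_snd)+)
  moreover have "foldr (\<lambda>x s. f x # s) xs [] = map f xs" for f :: "'b \<Rightarrow> 'c" and xs by (induction xs) auto
  ultimately show ?thesis by simp
qed

lemma cmp_concat: assumes "cmp ea (encL (encL ex)) l" shows "cmp ea (encL ex) (\<lambda>a. concat (l a))"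
proof -
  have "cmp ea (encL ex) (\<lambda>a. foldr (\<lambda>x s. x @ s) (l a) [])"
    by (rule cmp_foldr[OF cmp_const assms(1)])
      (simp only: case_prod_unfold, (rule cmp_id cmp_append cmp_fst cmp_snd)+)
  moreover have "foldr (\<lambda>x s. x @ s) xs [] = concat xs" for xs :: "'b list list" by (induction xs) auto
  ultimately show ?thesis by simp
qed

lemma cmp_filter:
  assumes "cmp ea (encL ex) l" "cmp (encP ea ex) encB (\<lambda>(a, x). P a x)"
  shows "cmp ea (encL ex) (\<lambda>a. filter (P a) (l a))"
proof -
  have "cmp ea (encL ex) (\<lambda>a. foldr (\<lambda>x s. if P a x then x # s else s) (l a) [])"
    by (rule cmp_foldr[OF cmp_const assms(1)])
      (simp only: case_prod_unfold, (rule cmp_id cmp_if cmp_Cons cmp_uncurry[OF assms(2)] cmp_fst cmp_snd)+)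
  moreover have "foldr (\<lambda>x s. if f x then x # s else s) xs [] = filter f xs" for f :: "'b \<Rightarrow> bool" and xs
    by (induction xs) auto
  ultimately show ?thesis by simp
qed

lemma cmp_Ball:
  assumes "cmp ea (encL ex) l" "cmp (encP ea ex) encB (\<lambda>(a, x). P a x)"
  shows "cmp ea encB (\<lambda>a. \<forall>x\<in>set (l a). P a x)"
proof -
  have "cmp ea encB (\<lambda>a. foldr (\<lambda>x s. P a x \<and> s) (l a) True)"
    by (rule cmp_foldr[OF cmp_const assms(1)])
      (simp only: case_prod_unfold, (rule cmp_id cmp_and cmp_uncurry[OF assms(2)] cmp_fst cmp_snd)+)
  moreover have "foldr (\<lambda>x s. f x \<and> s) xs True \<longleftrightarrow> (\<forall>x\<in>set xs. f x)" for f :: "'b \<Rightarrow> bool" and xs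
    by (induction xs) auto
  ultimately show ?thesis by simp
qed

lemma cmp_member:
  assumes "inj ex" "cmp ea (encL ex) l" "cmp ea ex f"
  shows "cmp ea encB (\<lambda>a. f a \<in> set (l a))"
proof -
  have "cmp (encP ea ex) encB (\<lambda>(a, x). f a \<noteq> x)"
    by (simp only: case_prod_unfold) (rule cmp_id cmp_not cmp_eq[OF assms(1)] cmp_comp[OF assms(3)] cmp_fst cmp_snd)+
  then have "cmp ea encB (\<lambda>a. \<not> (\<forall>x\<in>set (l a). f a \<noteq> x))"
    by (rule cmp_not[OF cmp_Ball[OF assms(2)]])
  then show ?thesis by simp
qed

lemma cmp_sum_list:
  assumes "cmp ea (encL ex) l" "cmp (encP ea ex) encN (\<lambda>(a, x). F a x)"
  shows "cmp ea encN (\<lambda>a. sum_list (map (F a) (l a)))"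
proof -
  have "cmp ea encN (\<lambda>a. foldr (\<lambda>x s. F a x + s) (l a) 0)"
    by (rule cmp_foldr[OF cmp_const assms(1)])
      (simp only: case_prod_unfold, (rule cmp_id cmp_add cmp_uncurry[OF assms(2)] cmp_fst cmp_snd)+)
  moreover have "foldr (\<lambda>x s. f x + s) xs 0 = sum_list (map f xs)" for f :: "'b \<Rightarrow> nat" and xs
    by (induction xs) auto
  ultimately show ?thesis by simp
qed

lemma cmp_length: assumes "cmp ea (encL ex) l" shows "cmp ea encN (\<lambda>a. length (l a))"
proof -
  have "cmp ea encN (\<lambda>a. sum_list (map ((\<lambda>_ _. 1) a) (l a)))"
    by (rule cmp_sum_list[OF assms]) (simp only: case_prod_unfold cmp_const)
  then show ?thesis by (simp add: sum_list_triv)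
qed

lemma cmp_map_fixed: "(\<And>t. t \<in> set T \<Longrightarrow> cmp ea ex (F t)) \<Longrightarrow> cmp ea (encL ex) (\<lambda>a. map (\<lambda>t. F t a) T)"
  by (induction T) (simp_all add: cmp_const cmp_Cons)

lemma inj_encP: "inj ea \<Longrightarrow> inj eb \<Longrightarrow> inj (encP ea eb)"
  by (auto simp: inj_def encP_def)

lemma surj_encP: "surj ea \<Longrightarrow> surj eb \<Longrightarrow> surj (encP ea eb)"
proof -
  assume *: "surj ea" "surj eb"
  show ?thesis
  proof (rule surjI)
    show "encP ea eb (inv_into UNIV ea (p1 n), inv_into UNIV eb (p2 n)) = n" for n
      using * by (simp add: encP_def surj_f_inv_f)
  qed
qed

lemma inj_encL: "inj ea \<Longrightarrow> inj (encL ea)"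
  by (rule injI) (metis encL_def list_encode_inverse inj_map_eq_map)

lemma surj_encL: "surj ea \<Longrightarrow> surj (encL ea)"
proof -
  assume *: "surj ea"
  show ?thesis
  proof (rule surjI)
    show "encL ea (map (inv_into UNIV ea) (list_decode n)) = n" for n
      using * by (simp add: encL_def o_def surj_f_inv_f)
  qed
qed

section \<open>The search\<close>

definition subst :: "(letter \<Rightarrow> word) \<Rightarrow> word list list \<Rightarrow> word list list" where
  "subst t s = map (map (\<lambda>w. red (concat (map t w)))) s"

definition conjb :: "letter \<Rightarrow> word list \<Rightarrow> word list" where
  "conjb l b = map (\<lambda>w. red (linv l # w @ [l])) b"

text \<open>The fold carries the unchanged tail together with all its variants. Thus a right fold,
  as treated by \<open>cmp_foldr\<close>, lists all ways of conjugating one block.\<close>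

definition conjs :: "letter \<Rightarrow> word list list \<Rightarrow> word list list list" where
  "conjs l s = snd (foldr (\<lambda>b (u, us). (b # u, (conjb l b # u) # map ((#) b) us)) s ([], []))"

definition letters :: "nat \<Rightarrow> letter list" where
  "letters r = List.product [0..<r] [False, True]"

definition moves :: "nat \<Rightarrow> (letter \<Rightarrow> word) list \<Rightarrow> word list list \<Rightarrow> word list list list" where
  "moves r T s = map (\<lambda>t. subst t s) T @ concat (map (\<lambda>l. conjs l s) (letters r))"

definition wsum :: "word list \<Rightarrow> nat" where
  "wsum b = sum_list (map length b)"

definition tsize :: "word list list \<Rightarrow> nat" where
  "tsize s = sum_list (map wsum s)"

definition num_words :: "word list list \<Rightarrow> nat" where
  "num_words s = sum_list (map length s)"

definition move_rel :: "nat \<Rightarrow> (letter \<Rightarrow> word) list \<Rightarrow> nat \<Rightarrow> word list list \<Rightarrow> word list list \<Rightarrow> bool" where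
  "move_rel r T h s s' \<longleftrightarrow> s' \<in> set (moves r T s) \<and> tsize s' \<le> h"

lemma set_letters: "l \<in> set (letters r) \<longleftrightarrow> fst l < r"
  by (cases l) (auto simp: letters_def)

lemma set_conjs: "set (conjs l s) = {s[i := conjb l (s ! i)] |i. i < length s}"
proof -
  let ?F = "\<lambda>b (u, us). (b # u, (conjb l b # u) # map ((#) b) us)"
  have "foldr ?F s ([], []) = (s, map (\<lambda>i. s[i := conjb l (s ! i)]) [0..<length s])" for s
  proof (induction s)
    case (Cons b s)
    have "[0..<length (b # s)] = 0 # map Suc [0..<length s]" 
      using upt_conv_Cons[of 0 "Suc (length s)"] by (simp only: length_Cons map_Suc_upt zero_less_Suc)
    then show ?case using Cons by (simp add: o_def)
  qed simp
  then show ?thesis by (auto simp: conjs_def)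
qed

section \<open>Families of words as states, and the finite table\<close>

definition good :: "nat \<Rightarrow> word list list \<Rightarrow> bool" where
  "good r s \<longleftrightarrow> (\<forall>b\<in>set s. \<forall>w\<in>set b. reduced w \<and> fst ` set w \<subseteq> {..<r})"

text \<open>Keys outside the shape get the empty word, which automorphisms and conjugations fix. The
  state therefore forgets the shape, which is tracked separately.\<close>

definition state_of :: "nat \<Rightarrow> word list list \<Rightarrow> state" where
  "state_of r s = ({..<r}, \<lambda>k. if fst k < length s \<and> snd k < length (s ! fst k) then s ! fst k ! snd k else [])"

text \<open>The cut-off outside the rank leaves only finitely many tables and gives each of them
  finite support.\<close>

definition table :: "nat \<Rightarrow> (letter \<Rightarrow> fg) \<Rightarrow> letter \<Rightarrow> word" where
  "table r f l = (if fst l < r then rep_fg (f l) else [])"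

definition tables :: "nat \<Rightarrow> (letter \<Rightarrow> word) set" where
  "tables r = {table r f |f g. fgiso {..<r} {..<r} f g \<and> (\<forall>l. len (f l) \<le> 3)}"

lemma finite_tables: "finite (tables r)"
proof -
  let ?D = "{..<r} \<times> (UNIV :: bool set)"
  let ?W = "{w. set w \<subseteq> ?D \<and> length w \<le> 3}"
  have sub: "tables r \<subseteq> {t. \<forall>l. (l \<in> ?D \<longrightarrow> t l \<in> ?W) \<and> (l \<notin> ?D \<longrightarrow> t l = [])}"
  proof
    fix t assume "t \<in> tables r"
    then obtain f g where t: "t = table r f" "fgiso {..<r} {..<r} f g" "\<forall>l. len (f l) \<le> 3"
      unfolding tables_def by blast
    show "t \<in> {t. \<forall>l. (l \<in> ?D \<longrightarrow> t l \<in> ?W) \<and> (l \<notin> ?D \<longrightarrow> t l = [])}"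
    proof (rule CollectI, intro allI conjI impI)
      fix l assume l: "l \<in> ?D"
      then have "f l \<in> gset {..<r}" using fgisoD(3)[OF t(2)] by auto
      then have "set (rep_fg (f l)) \<subseteq> ?D" unfolding gset_def by force
      moreover have "len (f l) \<le> 3" using t(3) by blast
      moreover have "t l = rep_fg (f l)" using l t(1) by (auto simp: table_def)
      ultimately show "t l \<in> ?W" by simp
    next
      fix l assume "l \<notin> ?D"
      then show "t l = []" using t(1) by (cases l) (auto simp: table_def)
    qed
  qed
  have "finite ?D" by simp
  then have "finite ?W" by (rule finite_lists_length_le)
  then have "finite {t. \<forall>l. (l \<in> ?D \<longrightarrow> t l \<in> ?W) \<and> (l \<notin> ?D \<longrightarrow> t l = [])}"
    using \<open>finite ?D\<close> by (intro finite_set_of_finite_funs)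
  with sub show ?thesis by (rule finite_subset)
qed

lemma fst_state_of [simp]: "fst (state_of r s) = {..<r}"
  by (simp add: state_of_def)

lemma goodD: "good r s \<Longrightarrow> i < length s \<Longrightarrow> j < length (s ! i) \<Longrightarrow> reduced (s ! i ! j)"
  "good r s \<Longrightarrow> i < length s \<Longrightarrow> j < length (s ! i) \<Longrightarrow> fst ` set (s ! i ! j) \<subseteq> {..<r}"
  unfolding good_def by (meson nth_mem)+

lemma goodI: "(\<And>i j. i < length s \<Longrightarrow> j < length (s ! i) \<Longrightarrow>
    reduced (s ! i ! j) \<and> fst ` set (s ! i ! j) \<subseteq> {..<r}) \<Longrightarrow> good r s"
  unfolding good_def by (metis in_set_conv_nth)

lemma valid_state_of: "good r s \<Longrightarrow> valid (state_of r s)"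
  by (rule validI) (use goodD in \<open>force simp: state_of_def\<close>)+

lemma snd_state_of: "snd (state_of r s) (i, j) = (if i < length s \<and> j < length (s ! i) then s ! i ! j else [])"
  by (simp add: state_of_def)

lemma state_of_inject:
  assumes "state_of r s = state_of r s'" "map length s = map length s'"
  shows "s = s'"
proof (rule nth_equalityI)
  show l: "length s = length s'" using assms(2) map_eq_imp_length_eq by blast
  fix i assume i: "i < length s"
  then have li: "length (s ! i) = length (s' ! i)" using assms(2) l by (metis nth_map)
  show "s ! i = s' ! i"
  proof (rule nth_equalityI[OF li])
    fix j assume "j < length (s ! i)"
    then show "s ! i ! j = s' ! i ! j" using snd_state_of[of r s i j] snd_state_of[of r s' i j] assms(1) i l li by simp
  qed
qed

lemma reduced_red [simp]: "reduced (red w)"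
  by (metis reduced_rep rep_gw_red)

lemma set_red: "fst ` set w \<subseteq> I \<Longrightarrow> fst ` set (red w) \<subseteq> I"
  using set_foldr_push[of w "[]"] by (auto simp: red_def)

lemma length_red: "length (red w) \<le> length w"
proof -
  have "length (push l w) \<le> Suc (length w)" for l w by (cases w) auto
  then show ?thesis unfolding red_def by (induction w) (auto intro: order_trans)
qed

lemma gw_table:
  assumes "fst ` set w \<subseteq> {..<r}" "symf f"
  shows "gw (concat (map (table r f) w)) = ext f (gw w)"
  using assms(1) by (induction w) (simp_all add: table_def ext_add assms(2))

lemma orb_trans:
  assumes "orb x y f z" "orb y x' f' z'"
  shows "orb x x' (\<lambda>l. ext f' (f l)) (\<lambda>i. ext f' (z i) + z' i)"
proof -
  obtain g g' where g: "fgiso (fst x) (fst y) f g" "fgiso (fst y) (fst x') f' g'"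
    using assms unfolding orb_def by blast
  have s: "symf f" "symf f'" using g fgisoD(1) by blast+
  have 1: "gw (snd y k) = - z (fst k) + ext f (gw (snd x k)) + z (fst k)" for k
    using assms(1) unfolding orb_def by blast
  have 2: "gw (snd x' k) = - z' (fst k) + ext f' (gw (snd y k)) + z' (fst k)" for k
    using assms(2) unfolding orb_def by blast
  have "gw (snd x' k) = - (ext f' (z (fst k)) + z' (fst k)) + ext (\<lambda>l. ext f' (f l)) (gw (snd x k)) +
      (ext f' (z (fst k)) + z' (fst k))" for k
    unfolding 2 1 ext_comp[OF s(2,1)] ext_add[OF s(2)] ext_uminus[OF s(2)]
    by (simp add: grp del: add_uminus_conv_diff)
  then show ?thesis using fgiso_comp[OF g] unfolding orb_def by blast
qed

section \<open>Soundness of the search moves\<close>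

lemma orb_move:
  assumes T: "set T = tables r" and s: "good r s" and m: "s' \<in> set (moves r T s)"
  shows "good r s' \<and> (\<exists>f z. orb (state_of r s) (state_of r s') f z \<and> (\<forall>i. z i \<in> gset {..<r}))"
proof -
  consider t where "t \<in> set T" "s' = subst t s" | l where "fst l < r" "s' \<in> set (conjs l s)"
    using m by (auto simp: moves_def set_letters)
  then show ?thesis
  proof cases
    case (1 t)
    then obtain f g where t: "t = table r f" "fgiso {..<r} {..<r} f g" using T unfolding tables_def by blast
    have nth: "s' ! i ! j = red (concat (map t (s ! i ! j)))" if "i < length s" "j < length (s ! i)" for i j
      using that 1 by (simp add: subst_def)
    have len: "length s' = length s" "i < length s \<Longrightarrow> length (s' ! i) = length (s ! i)" for i
      using 1 by (simp_all add: subst_def)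
    have sub: "fst ` set (concat (map t w)) \<subseteq> {..<r}" if "fst ` set w \<subseteq> {..<r}" for w
    proof -
      have *: "fst ` set (t l) \<subseteq> {..<r}" if "fst l < r" for l
        using fgisoD(3)[OF t(2), of l] that by (simp add: t(1) table_def gset_def)
      have "fst ` set (t l) \<subseteq> {..<r}" if "l \<in> set w" for l
      proof -
        have "fst l \<in> {..<r}" using \<open>fst ` set w \<subseteq> {..<r}\<close> that by blast
        then show ?thesis using * by simp
      qed
      then show ?thesis unfolding set_concat set_map image_UN image_image by (rule UN_least)
    qed
    have "good r s'"
      by (rule goodI) (simp add: len nth set_red[OF sub[OF goodD(2)[OF s]]])
    moreover have "gw (snd (state_of r s') k) = ext f (gw (snd (state_of r s) k))" for k
    proof (cases k)
      case (Pair i j)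
      show ?thesis
      proof (cases "i < length s \<and> j < length (s ! i)")
        case True
        then show ?thesis using gw_table[OF goodD(2)[OF s] fgisoD(1)[OF t(2)], of i j]
          by (simp add: Pair snd_state_of len nth t(1))
      next
        case False
        then show ?thesis by (auto simp: Pair snd_state_of len)
      qed
    qed
    then have "orb (state_of r s) (state_of r s') f (\<lambda>_. 0)" using t(2) by (auto simp: orb_def)
    ultimately show ?thesis using gset_simps(1) by blast
  next
    case (2 l)
    then obtain i0 where i0: "i0 < length s" "s' = s[i0 := conjb l (s ! i0)]" by (auto simp: set_conjs)
    have len: "length s' = length s" "i < length s \<Longrightarrow> length (s' ! i) = length (s ! i)" for i
      using i0 by (simp_all add: conjb_def nth_list_update)
    have nth: "s' ! i ! j = (if i = i0 then red (linv l # s ! i ! j @ [l]) else s ! i ! j)"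
      if "i < length s" "j < length (s ! i)" for i j
      using that i0 by (cases "i = i0") (simp_all add: conjb_def nth_list_update)
    have sub: "fst ` set (linv l # w @ [l]) \<subseteq> {..<r}" if "fst ` set w \<subseteq> {..<r}" for w
      using that 2 by auto
    have "good r s'"
    proof (rule goodI)
      fix i j assume "i < length s'" "j < length (s' ! i)"
      then have ij: "i < length s" "j < length (s ! i)" by (simp_all add: len)
      show "reduced (s' ! i ! j) \<and> fst ` set (s' ! i ! j) \<subseteq> {..<r}"
        unfolding nth[OF ij] using set_red[OF sub[OF goodD(2)[OF s ij]]] goodD[OF s ij] reduced_red
        by presburger
    qed
    let ?z = "\<lambda>i. if i = i0 then gl l else 0"
    have "gw (snd (state_of r s') k) = - ?z (fst k) + ext gl (gw (snd (state_of r s) k)) + ?z (fst k)" for k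
      by (cases k) (auto simp: snd_state_of len nth add.assoc)
    then have "orb (state_of r s) (state_of r s') gl ?z" using fgiso_id by (auto simp: orb_def)
    moreover have "?z i \<in> gset {..<r}" for i using 2 by simp
    ultimately show ?thesis using \<open>good r s'\<close> by blast
  qed
qed

lemma orb_moves:
  assumes T: "set T = tables r" and s: "good r s" and m: "(move_rel r T h)\<^sup>*\<^sup>* s s'"
  shows "good r s' \<and> (\<exists>f z. orb (state_of r s) (state_of r s') f z \<and> (\<forall>i. z i \<in> gset {..<r}))"
  using m
proof (induction rule: rtranclp_induct)
  case base
  have "orb (state_of r s) (state_of r s) gl (\<lambda>_. 0)" using fgiso_id by (auto simp: orb_def)
  then show ?case using s gset_simps(1) by blast
next
  case (step y y')
  then obtain f z where f: "orb (state_of r s) (state_of r y) f z" "\<And>i. z i \<in> gset {..<r}" by blast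
  obtain f' z' where f': "orb (state_of r y) (state_of r y') f' z'" "\<And>i. z' i \<in> gset {..<r}" "good r y'"
    using orb_move[OF T, of y y'] step by (auto simp: move_rel_def)
  obtain g where g: "fgiso {..<r} {..<r} f' g" using f' unfolding orb_def by auto
  have "ext f' (z i) + z' i \<in> gset {..<r}" for i using fgiso_ext(1)[OF g] f f' by blast
  then show ?case using orb_trans[OF f(1) f'(1)] f'(3) by blast
qed

section \<open>Completeness of the search moves within a length bound\<close>

lemma height_state_of:
  assumes "K = {(i, j). i < length s \<and> j < length (s ! i)}"
  shows "height K (state_of r s) = tsize s"
proof -
  have K: "K = Sigma {..<length s} (\<lambda>i. {..<length (s ! i)})" using assms by auto
  have "height K (state_of r s) = (\<Sum>i<length s. \<Sum>j<length (s ! i). length (s ! i ! j))"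
    unfolding height_def K by (subst sum.Sigma) (auto simp: snd_state_of intro!: sum.cong)
  also have "\<dots> = (\<Sum>i<length s. wsum (s ! i))"
    by (rule sum.cong) (simp_all add: wsum_def sum_list_sum_nth atLeast0LessThan)
  also have "\<dots> = tsize s" by (simp add: tsize_def sum_list_sum_nth atLeast0LessThan)
  finally show ?thesis .
qed

lemma sum_list_map_le: "(\<And>x. x \<in> set xs \<Longrightarrow> f x \<le> (g x :: nat)) \<Longrightarrow> sum_list (map f xs) \<le> sum_list (map g xs)"
  by (induction xs) (auto intro!: add_mono)

lemma length_concat_table:
  assumes "\<And>l. len (f l) \<le> 3" shows "length (concat (map (table r f) w)) \<le> 3 * length w"
proof (induction w)
  case (Cons l w)
  have "length (table r f l) \<le> 3" using assms by (simp add: table_def)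
  then show ?case using Cons by simp
qed simp

lemma tsize_subst:
  assumes "\<And>l. len (f l) \<le> 3" shows "tsize (subst (table r f) s) \<le> 3 * tsize s"
proof -
  have "wsum (map (\<lambda>w. red (concat (map (table r f) w))) b) \<le> 3 * wsum b" for b
  proof -
    have "length (red (concat (map (table r f) w))) \<le> 3 * length w" for w
      using length_red length_concat_table[OF assms] by (meson order_trans)
    then show ?thesis
      unfolding wsum_def map_map o_def sum_list_const_mult[symmetric] by (rule sum_list_map_le)
  qed
  then show ?thesis
    unfolding tsize_def subst_def map_map o_def sum_list_const_mult[symmetric] by (rule sum_list_map_le)
qed

lemma wsum_conjb: "wsum (conjb l b) \<le> wsum b + 2 * length b"
proof -
  have "length (red (linv l # w @ [l])) \<le> length w + 2" for w
    using length_red[of "linv l # w @ [l]"] by simp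
  then have "wsum (conjb l b) \<le> sum_list (map (\<lambda>w. length w + 2) b)"
    unfolding wsum_def conjb_def map_map o_def by (rule sum_list_map_le)
  also have "\<dots> = wsum b + 2 * length b" by (induction b) (simp_all add: wsum_def)
  finally show ?thesis .
qed

text \<open>A step is a substitution from the table followed by conjugations of single blocks.\<close>

lemma link_moves:
  assumes T: "set T = tables r" and s: "good r s"
    and link: "link {..<r} {(i, j). i < length s \<and> j < length (s ! i)} h (state_of r s) y"
    and H: "3 * h + 2 * num_words s \<le> H"
  shows "\<exists>s'. y = state_of r s' \<and> map length s' = map length s \<and> (move_rel r T H)\<^sup>*\<^sup>* s s'"
proof -
  have y: "fst y = {..<r}" "valid y" and hs: "tsize s \<le> h"
    using link unfolding link_def height_state_of[OF refl] by blast+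
  obtain f z where orb: "orb (state_of r s) y f z" and sm: "small {..<r} f z"
    using link unfolding link_def by blast
  obtain g where f: "fgiso {..<r} {..<r} f g" using orb y(1) unfolding orb_def fst_state_of by auto
  have f3: "len (f l) \<le> 3" for l using sm unfolding small_def by blast
  have "\<forall>i. \<exists>l. z i \<noteq> 0 \<longrightarrow> fst l < r \<and> z i = gl l" using sm unfolding small_def by auto
  then obtain L where L: "\<And>i. z i \<noteq> 0 \<Longrightarrow> fst (L i) < r \<and> z i = gl (L i)" by metis
  define t where "t = table r f"
  have t: "t \<in> set T" using T f f3 unfolding tables_def t_def by blast
  define s1 where "s1 = subst t s"
  have l1: "length s1 = length s" "map length s1 = map length s" by (simp_all add: s1_def subst_def)
  have z1: "tsize s1 \<le> 3 * h" using tsize_subst[of f r s] f3 hs by (simp add: s1_def t_def)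
  define c where "c i = (if z i = 0 then (\<lambda>b. b) else conjb (L i))" for i
  \<comment> \<open>The substitution first, then the conjugations of the blocks before
    \<open>k\<close>. Blocks with trivial conjugator are left alone, since the search offers
    conjugation by letters only.\<close>
  define S where "S k = map (\<lambda>i. if i < k then c i (s1 ! i) else s1 ! i) [0..<length s]" for k
  have S0: "S 0 = s1" using l1 using map_nth[of s1] by (simp add: S_def)
  have wc: "wsum (c i b) \<le> wsum b + 2 * length b" for i b using wsum_conjb by (simp add: c_def)
  \<comment> \<open>The substitution at most triples the total length, and conjugation by a letter
    adds at most 2 to each word of its block.\<close>
  have zS: "tsize (S k) \<le> H" for k
  proof -
    have "tsize (S k) \<le> sum_list (map (\<lambda>i. wsum (s1 ! i) + 2 * length (s1 ! i)) [0..<length s])"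
      unfolding tsize_def S_def map_map o_def by (rule sum_list_map_le) (simp add: wc)
    also have "\<dots> = sum_list (map (\<lambda>b. wsum b + 2 * length b) (map ((!) s1) [0..<length s1]))"
      unfolding map_map o_def l1 ..
    also have "\<dots> = tsize s1 + 2 * num_words s1"
      unfolding map_nth by (simp add: tsize_def num_words_def sum_list_addf sum_list_const_mult)
    also have "num_words s1 = num_words s" by (simp only: num_words_def l1)
    finally show ?thesis using z1 H by simp
  qed
  have "(move_rel r T H)\<^sup>*\<^sup>* s (S k)" if "k \<le> length s" for k
    using that
  proof (induction k)
    case 0
    have "s1 \<in> set (moves r T s)" using t by (auto simp: moves_def s1_def)
    then have "move_rel r T H s (S 0)" using zS[of 0] S0 by (simp add: move_rel_def)
    then show ?case by blast
  next
    case (Suc k)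
    have S_Suc: "S (Suc k) = (S k)[k := c k (S k ! k)]"
      using Suc.prems by (intro nth_equalityI) (auto simp: S_def nth_list_update)
    show ?case
    proof (cases "z k = 0")
      case True
      then have "S (Suc k) = S k" using S_Suc by (simp add: c_def)
      then show ?thesis using Suc by simp
    next
      case False
      have "S (Suc k) \<in> set (conjs (L k) (S k))"
      proof -
        have "k < length (S k)" using Suc.prems by (simp add: S_def)
        moreover have "S (Suc k) = (S k)[k := conjb (L k) (S k ! k)]" using S_Suc False by (simp add: c_def)
        ultimately show ?thesis unfolding set_conjs by blast
      qed
      then have "move_rel r T H (S k) (S (Suc k))"
        using L[OF False] zS[of "Suc k"] by (auto simp: move_rel_def moves_def set_letters)
      then show ?thesis using Suc by (metis Suc_leD rtranclp.rtrancl_into_rtrancl)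
    qed
  qed
  then have m: "(move_rel r T H)\<^sup>*\<^sup>* s (S (length s))" by simp
  let ?s = "S (length s)"
  have gs: "good r ?s" using orb_moves[OF T s m] by blast
  have lens: "length ?s = length s" "i < length s \<Longrightarrow> length (?s ! i) = length (s ! i)" for i
    by (simp_all add: S_def c_def conjb_def s1_def subst_def)
  have "map length ?s = map length s"
    by (rule nth_equalityI) (simp_all add: lens)
  moreover have "y = state_of r ?s"
  proof -
    have "gw (snd y k) = gw (snd (state_of r ?s) k)" for k
    proof (cases k)
      case (Pair i j)
      have e: "gw (snd y k) = - z i + ext f (gw (snd (state_of r s) k)) + z i"
        using orb unfolding orb_def Pair by (metis fst_conv)
      show ?thesis
      proof (cases "i < length s \<and> j < length (s ! i)")
        case True
        then have "gw (?s ! i ! j) = - z i + gw (red (concat (map t (s ! i ! j)))) + z i"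
          using L[of i] by (cases "z i = 0") (auto simp: S_def c_def conjb_def s1_def subst_def add.assoc)
        also have "gw (red (concat (map t (s ! i ! j)))) = ext f (gw (s ! i ! j))"
          using gw_table[OF goodD(2)[OF s] fgisoD(1)[OF f]] True by (simp add: t_def)
        finally show ?thesis unfolding e using True by (simp add: Pair snd_state_of lens)
      next
        case False
        then show ?thesis unfolding e by (auto simp: Pair snd_state_of lens)
      qed
    qed
    then have "snd y k = snd (state_of r ?s) k" for k
      using gw_inject validD(2)[OF y(2)] validD(2)[OF valid_state_of[OF gs]] by blast
    then show ?thesis using y(1) by (intro prod_eqI) (auto simp: fun_eq_iff)
  qed
  ultimately show ?thesis using m by blast
qed

lemma moves_complete:
  assumes T: "set T = tables r" and u: "good r u" and v: "good r v" and shape: "map length u = map length v"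
    and orb: "orb (state_of r u) (state_of r v) f z" "\<And>i. z i \<in> gset {..<r}"
    and H: "3 * (tsize u + tsize v) + 2 * num_words u \<le> H"
  shows "(move_rel r T H)\<^sup>*\<^sup>* u v"
proof -
  let ?K = "\<lambda>s. {(i, j). i < length s \<and> j < length (s ! i)}"
  have K: "?K s = ?K s'" if "map length s = map length s'" for s s' :: "word list list"
  proof -
    have "length s = length s'" using that map_eq_imp_length_eq by blast
    moreover from this have "length (s ! i) = length (s' ! i)" if "i < length s" for i
      using \<open>map length s = map length s'\<close> that by (metis nth_map)
    ultimately show ?thesis by auto
  qed
  let ?h = "tsize u + tsize v"
  \<comment> \<open>Blocks beyond the shape contain only empty words, so their conjugators may be
    made trivial; this gives the finite support that \<open>bounded_chain\<close> asks for.\<close>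
  let ?z = "\<lambda>i. if i < length u then z i else 0"
  have lv: "length u = length v" using shape map_eq_imp_length_eq by blast
  have orb': "orb (state_of r u) (state_of r v) f ?z"
    unfolding orb_def
  proof (intro conjI allI)
    show "\<exists>g. fgiso (fst (state_of r u)) (fst (state_of r v)) f g" using orb(1) unfolding orb_def by blast
    fix k
    have "gw (snd (state_of r v) k) = - z (fst k) + ext f (gw (snd (state_of r u) k)) + z (fst k)"
      using orb(1) unfolding orb_def by blast
    then show "gw (snd (state_of r v) k) = - ?z (fst k) + ext f (gw (snd (state_of r u) k)) + ?z (fst k)"
      using lv by (cases k) (simp add: snd_state_of)
  qed
  have "(link {..<r} (?K u) ?h)\<^sup>*\<^sup>* (state_of r u) (state_of r v)"
    by (rule bounded_chain[OF orb' valid_state_of[OF u] valid_state_of[OF v], where N = "{..<length u}"])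
       (use orb(2) height_state_of[OF refl, of u r] height_state_of[OF K[OF shape], of r] in auto)
  then have "\<exists>s'. state_of r v = state_of r s' \<and> map length s' = map length u \<and> (move_rel r T H)\<^sup>*\<^sup>* u s'"
  proof (induction rule: rtranclp_induct)
    case base
    then show ?case by blast
  next
    case (step x y)
    then obtain s where s: "x = state_of r s" "map length s = map length u" "(move_rel r T H)\<^sup>*\<^sup>* u s" by blast
    have "good r s" using orb_moves[OF T u s(3)] by blast
    moreover have "link {..<r} (?K s) ?h (state_of r s) y" using step.hyps(2) s K[OF s(2)] by simp
    moreover have "3 * ?h + 2 * num_words s \<le> H" using H s(2) by (simp add: num_words_def)
    ultimately obtain s' where "y = state_of r s'" "map length s' = map length s" "(move_rel r T H)\<^sup>*\<^sup>* s s'"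
      using link_moves[OF T] by blast
    then show ?case using s by (metis rtranclp_trans)
  qed
  then show ?thesis using state_of_inject shape by metis
qed

section \<open>Abstract free groups\<close>

lemma words_iff: "w \<in> words r \<longleftrightarrow> fst ` set w \<subseteq> {..<r}"
  by (auto simp: words_def)

locale free_basis = group F for F :: "('a, 'b) monoid_scheme" (structure) +
  fixes X :: "'a list"
  assumes basis: "free_group_basis F X"
begin

abbreviation I :: "nat set" where "I \<equiv> {..<length X}"

abbreviation lv :: "letter \<Rightarrow> 'a" where "lv \<equiv> letter_val F X"

abbreviation wv :: "word \<Rightarrow> 'a" where "wv \<equiv> word_val F X"

text \<open>Evaluation in \<open>F\<close>: an isomorphism on the subgroup of the letters in
  \<open>I\<close>, with inverse \<open>U\<close>.\<close>

definition V :: "fg \<Rightarrow> 'a" where "V g = wv (rep_fg g)"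

definition U :: "'a \<Rightarrow> fg" where "U = inv_into (gset I) V"

lemma X_closed: "i < length X \<Longrightarrow> X ! i \<in> carrier F"
  using basis nth_mem unfolding free_group_basis_def by blast

lemma lv_closed: "fst l < length X \<Longrightarrow> lv l \<in> carrier F"
  by (cases l) (simp add: letter_val_def X_closed)

lemma lv_linv: "fst l < length X \<Longrightarrow> lv (linv l) = inv (lv l)"
  by (cases l) (simp add: letter_val_def X_closed)

lemma wv_simps [simp]: "wv [] = \<one>" "wv (l # w) = lv l \<otimes> wv w"
  by (simp_all add: word_val_def)

lemma wv_closed: "fst ` set w \<subseteq> I \<Longrightarrow> wv w \<in> carrier F"
  by (induction w) (auto intro: lv_closed)

lemma wv_push:
  assumes "fst l < length X" "fst ` set w \<subseteq> I" shows "wv (push l w) = lv l \<otimes> wv w"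
proof (cases w)
  case (Cons m v)
  then have "lv l \<in> carrier F" "wv v \<in> carrier F" using assms lv_closed wv_closed by auto
  then show ?thesis using Cons lv_linv[OF assms(1)] by (simp add: m_assoc[symmetric])
qed simp

lemma wv_foldr_push:
  assumes "fst ` set v \<subseteq> I"
  shows "fst ` set u \<subseteq> I \<Longrightarrow> wv (foldr push u v) = wv u \<otimes> wv v"
proof (induction u)
  case Nil
  then show ?case using wv_closed[OF assms] by simp
next
  case (Cons l u)
  have "fst ` set (foldr push u v) \<subseteq> I"
    using image_mono[OF set_foldr_push[of u v], of fst] assms Cons.prems by (simp add: image_Un) blast
  then have "wv (foldr push (l # u) v) = lv l \<otimes> wv (foldr push u v)"
    using wv_push Cons.prems by simp
  then show ?case using Cons lv_closed wv_closed assms by (simp add: m_assoc)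
qed

lemma wv_red: "fst ` set w \<subseteq> I \<Longrightarrow> wv (red w) = wv w"
  using wv_foldr_push[of "[]" w] wv_closed[of w] by (simp add: red_def)

lemma V_gw: "fst ` set w \<subseteq> I \<Longrightarrow> V (gw w) = wv w"
  by (simp add: V_def rep_gw_red wv_red)

lemma V_bij: "bij_betw V (gset I) (carrier F)"
proof -
  have "bij_betw rep_fg (gset I) {w \<in> words (length X). reduced w}"
    by (rule bij_betwI[of _ _ _ abs_fg]) (auto simp: words_iff gset_def rep_fg_inverse)
  moreover have "bij_betw wv {w \<in> words (length X). reduced w} (carrier F)"
    using basis by (simp add: free_group_basis_def)
  ultimately have "bij_betw (wv \<circ> rep_fg) (gset I) (carrier F)" by (rule bij_betw_trans)
  moreover have "wv \<circ> rep_fg = V" by (simp add: V_def fun_eq_iff)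
  ultimately show ?thesis by simp
qed

lemma V_closed: "g \<in> gset I \<Longrightarrow> V g \<in> carrier F"
  using V_bij by (rule bij_betw_apply)

lemma U_closed: "a \<in> carrier F \<Longrightarrow> U a \<in> gset I"
  using bij_betw_inv_into[OF V_bij] unfolding U_def by (rule bij_betw_apply)

lemma V_U: "a \<in> carrier F \<Longrightarrow> V (U a) = a"
  unfolding U_def using V_bij by (simp add: bij_betw_inv_into_right)

lemma U_V: "g \<in> gset I \<Longrightarrow> U (V g) = g"
  unfolding U_def using V_bij by (simp add: bij_betw_inv_into_left)

lemma V_eq: "g \<in> gset I \<Longrightarrow> h \<in> gset I \<Longrightarrow> V g = V h \<longleftrightarrow> g = h"
  by (metis U_V)

lemma V_add: "g \<in> gset I \<Longrightarrow> h \<in> gset I \<Longrightarrow> V (g + h) = V g \<otimes> V h"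
  by (simp add: V_def rep_plus wv_foldr_push gset_def)

lemma V_gl: "fst l < length X \<Longrightarrow> V (gl l) = lv l"
  using lv_closed by (simp add: V_def)

lemma V_uminus: assumes "g \<in> gset I" shows "V (- g) = inv (V g)"
proof -
  have "V (- g) \<otimes> V g = \<one>"
    using V_add[of "- g" g] assms by (simp add: V_def)
  then show ?thesis using inv_equality V_closed assms by simp
qed

text \<open>Letters outside the basis are fixed, so that compatibility with inversion holds for all
  letters.\<close>

definition induced :: "('a \<Rightarrow> 'a) \<Rightarrow> letter \<Rightarrow> fg" where
  "induced \<phi> l = (if fst l < length X then U (\<phi> (lv l)) else gl l)"

lemma induced_props:
  assumes \<phi>: "\<phi> \<in> hom F F"
  shows "symf (induced \<phi>)" "fst l \<in> I \<Longrightarrow> induced \<phi> l \<in> gset I"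
    "g \<in> gset I \<Longrightarrow> ext (induced \<phi>) g = U (\<phi> (V g))"
proof -
  have c: "\<phi> a \<in> carrier F" if "a \<in> carrier F" for a using \<phi> that by (rule hom_in_carrier)
  have gs: "induced \<phi> l \<in> gset I" if "fst l \<in> I" for l
    using that c lv_closed by (simp add: induced_def U_closed)
  then show "fst l \<in> I \<Longrightarrow> induced \<phi> l \<in> gset I" .
  have Vi: "V (induced \<phi> l) = \<phi> (lv l)" if "fst l < length X" for l
    using that c lv_closed by (simp add: induced_def V_U)
  interpret group_hom F F \<phi> using \<phi> by unfold_locales
  show s: "symf (induced \<phi>)"
  proof (rule symfI)
    fix l
    show "induced \<phi> (linv l) = - induced \<phi> l"
    proof (cases "fst l < length X")
      case True
      then have "V (induced \<phi> (linv l)) = V (- induced \<phi> l)"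
        using Vi[of "linv l"] Vi[of l] gs[of l] V_uminus[of "induced \<phi> l"] lv_linv[of l] lv_closed[of l]
        by simp
      then show ?thesis using V_eq gs[of l] gs[of "linv l"] True by simp
    next
      case False
      then show ?thesis by (simp add: induced_def)
    qed
  qed
  have "V (ext (induced \<phi>) (gw w)) = \<phi> (wv w)" if "fst ` set w \<subseteq> I" for w
    using that
  proof (induction w)
    case Nil
    have "V 0 = \<one>" by (simp add: V_def)
    then show ?case by simp
  next
    case (Cons l w)
    then have l: "fst l \<in> I" "fst ` set w \<subseteq> I" by auto
    have "ext (induced \<phi>) (gw w) \<in> gset I"
      using ext_gset[OF gset_gw[OF l(2)]] gs by blast
    then have "V (ext (induced \<phi>) (gw (l # w))) = V (induced \<phi> l) \<otimes> V (ext (induced \<phi>) (gw w))"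
      using V_add gs[OF l(1)] by (simp add: ext_add s)
    then show ?case using Cons.IH[OF l(2)] Vi l lv_closed wv_closed[OF l(2)] by simp
  qed
  note w = this
  show "ext (induced \<phi>) g = U (\<phi> (V g))" if g: "g \<in> gset I" for g
  proof -
    have "V (ext (induced \<phi>) g) = \<phi> (V g)" using w[of "rep_fg g"] g by (simp add: gset_def V_def)
    moreover have "ext (induced \<phi>) g \<in> gset I" using ext_gset[OF g] gs by blast
    ultimately show ?thesis using U_V by metis
  qed
qed

lemma auto_fgiso:
  assumes "\<phi> \<in> auto F"
  shows "\<exists>g. fgiso I I (induced \<phi>) g"
proof -
  have \<phi>: "\<phi> \<in> hom F F" "bij_betw \<phi> (carrier F) (carrier F)"
    using assms by (auto simp: auto_def Bij_def)
  define \<psi> where "\<psi> = inv_into (carrier F) \<phi>"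
  have "\<phi> \<in> Group.iso F F" using \<phi> by (simp add: iso_def)
  then have "\<psi> \<in> Group.iso F F" unfolding \<psi>_def by (rule iso_set_sym)
  then have \<psi>: "\<psi> \<in> hom F F" by (simp add: iso_def)
  have inv: "\<psi> (\<phi> a) = a" "\<phi> (\<psi> a) = a" if "a \<in> carrier F" for a
    using \<phi>(2) that by (simp_all add: \<psi>_def bij_betw_inv_into_left bij_betw_inv_into_right)
  have c: "\<phi> a \<in> carrier F" "\<psi> a \<in> carrier F" if "a \<in> carrier F" for a
    using \<phi>(1) \<psi> that hom_in_carrier by metis+
  have "fgiso I I (induced \<phi>) (induced \<psi>)"
  proof (rule fgisoI)
    show "symf (induced \<phi>)" "symf (induced \<psi>)" using induced_props(1) \<phi>(1) \<psi> by blast+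
    show "induced \<phi> l \<in> gset I" "induced \<psi> l \<in> gset I" if "fst l \<in> I" for l
      using induced_props(2) \<phi>(1) \<psi> that by blast+
    show "ext (induced \<psi>) (induced \<phi> l) = gl l" if "fst l \<in> I" for l
      using induced_props(3)[OF \<psi> induced_props(2)[OF \<phi>(1) that]] that lv_closed c inv V_gl U_V[of "gl l"]
      by (simp add: induced_def V_U)
    show "ext (induced \<phi>) (induced \<psi> l) = gl l" if "fst l \<in> I" for l
      using induced_props(3)[OF \<phi>(1) induced_props(2)[OF \<psi> that]] that lv_closed c inv V_gl U_V[of "gl l"]
      by (simp add: induced_def V_U)
  qed
  then show ?thesis by blast
qed

lemma fgiso_auto:
  assumes "fgiso I I f g"
  defines "\<phi> \<equiv> restrict (\<lambda>a. V (ext f (U a))) (carrier F)"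
  shows "\<phi> \<in> auto F"
proof -
  have e: "ext f (U a) \<in> gset I" "ext g (ext f (U a)) = U a" if "a \<in> carrier F" for a
    using fgiso_ext[OF assms(1) U_closed[OF that]] by blast+
  have e': "ext g (U a) \<in> gset I" "ext f (ext g (U a)) = U a" if "a \<in> carrier F" for a
    using fgiso_ext[OF fgiso_sym[OF assms(1)] U_closed[OF that]] by blast+
  have U_mult: "U (a \<otimes> b) = U a + U b" if "a \<in> carrier F" "b \<in> carrier F" for a b
    using V_add[OF U_closed U_closed, OF that] that U_V[OF gset_add[OF U_closed U_closed, OF that]] by (simp add: V_U)
  have "\<phi> \<in> hom F F"
    unfolding hom_def using e V_closed V_add
    by (auto simp: \<phi>_def U_mult ext_add[OF fgisoD(1)[OF assms(1)]])
  moreover have "bij_betw \<phi> (carrier F) (carrier F)"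
    by (rule bij_betwI[of _ _ _ "\<lambda>a. V (ext g (U a))"])
       (use e e' V_closed in \<open>auto simp: \<phi>_def U_V V_U\<close>)
  ultimately show ?thesis by (simp add: auto_def Bij_def \<phi>_def)
qed

text \<open>The conjugators of the two sides are inverse to each other: one formulation conjugates
  \<open>v\<close> to reach the image of \<open>u\<close>, the other conjugates the image of
  \<open>u\<close> to reach \<open>v\<close>. Free reduction of the words changes no value.\<close>

theorem orbit_iff:
  assumes us: "us \<in> lists (lists (words (length X)))" and vs: "vs \<in> lists (lists (words (length X)))"
    and shape: "map length us = map length vs"
  shows "(\<exists>\<phi>\<in>auto F. \<exists>z. \<forall>i<length us. z i \<in> carrier F \<and>
      (\<forall>j<length (us ! i). \<phi> (wv (us ! i ! j)) = inv (z i) \<otimes> wv (vs ! i ! j) \<otimes> z i)) \<longleftrightarrow>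
    (\<exists>f z. orb (state_of (length X) (map (map red) us)) (state_of (length X) (map (map red) vs)) f z \<and> (\<forall>i. z i \<in> gset I))"
    (is "?L \<longleftrightarrow> ?R")
proof -
  let ?u = "map (map red) us" and ?v = "map (map red) vs"
  have len: "length us = length vs" "i < length us \<Longrightarrow> length (us ! i) = length (vs ! i)" for i
    using shape map_eq_imp_length_eq by (blast, metis nth_map map_eq_imp_length_eq)
  have ws: "fst ` set (us ! i ! j) \<subseteq> I" "fst ` set (vs ! i ! j) \<subseteq> I" if "i < length us" "j < length (us ! i)" for i j
  proof -
    have "i < length vs" "j < length (vs ! i)" using that len by simp_all
    then show "fst ` set (us ! i ! j) \<subseteq> I" "fst ` set (vs ! i ! j) \<subseteq> I"
      using that us vs unfolding in_lists_conv_set words_iff[symmetric] by (meson nth_mem)+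
  qed
  have fu: "gw (snd (state_of (length X) ?u) (i, j)) = (if i < length us \<and> j < length (us ! i) then gw (us ! i ! j) else 0)" for i j
    by (auto simp: snd_state_of)
  have fv: "gw (snd (state_of (length X) ?v) (i, j)) = (if i < length us \<and> j < length (us ! i) then gw (vs ! i ! j) else 0)" for i j
    using len by (auto simp: snd_state_of)
  have wg: "gw (us ! i ! j) \<in> gset I" "gw (vs ! i ! j) \<in> gset I" if "i < length us" "j < length (us ! i)" for i j
    using ws[OF that] gset_gw by blast+
  show ?thesis
  proof
    assume ?L
    then obtain \<phi> z where \<phi>: "\<phi> \<in> auto F" and z: "\<And>i. i < length us \<Longrightarrow> z i \<in> carrier F"
      and eq: "\<And>i j. i < length us \<Longrightarrow> j < length (us ! i) \<Longrightarrow>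
        \<phi> (wv (us ! i ! j)) = inv (z i) \<otimes> wv (vs ! i ! j) \<otimes> z i" by blast
    have h: "\<phi> \<in> hom F F" using \<phi> by (auto simp: auto_def)
    let ?f = "induced \<phi>"
    let ?z = "\<lambda>i. if i < length us then - U (z i) else 0"
    have "gw (snd (state_of (length X) ?v) k) = - ?z (fst k) + ext ?f (gw (snd (state_of (length X) ?u) k)) + ?z (fst k)" for k
    proof (cases k)
      case (Pair i j)
      show ?thesis
      proof (cases "i < length us \<and> j < length (us ! i)")
        case True
        then have ij: "i < length us" "j < length (us ! i)" by auto
        have c: "wv (vs ! i ! j) \<in> carrier F" "wv (us ! i ! j) \<in> carrier F" "z i \<in> carrier F"
          using ws[OF ij] z ij wv_closed by auto
        have e: "ext ?f (gw (us ! i ! j)) = U (\<phi> (wv (us ! i ! j)))"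
          using induced_props(3)[OF h wg(1)[OF ij]] V_gw[OF ws(1)[OF ij]] by simp
        have pc: "\<phi> (wv (us ! i ! j)) \<in> carrier F" using hom_in_carrier[OF h c(2)] .
        have "V (U (z i) + U (\<phi> (wv (us ! i ! j))) + - U (z i)) = z i \<otimes> \<phi> (wv (us ! i ! j)) \<otimes> inv (z i)"
          using V_add[OF gset_add[OF U_closed U_closed], of "z i" "\<phi> (wv (us ! i ! j))" "- U (z i)"]
            V_add[OF U_closed U_closed, of "z i" "\<phi> (wv (us ! i ! j))"] V_uminus[OF U_closed, of "z i"] U_closed c pc
          by (simp add: V_U del: add_uminus_conv_diff)
        also have "\<dots> = wv (vs ! i ! j)" using eq[OF ij] c by (simp add: m_assoc inv_solve_right)
          (simp add: m_assoc[symmetric])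
        also have "\<dots> = V (gw (vs ! i ! j))" using V_gw[OF ws(2)[OF ij]] by simp
        finally have V: "V (U (z i) + U (\<phi> (wv (us ! i ! j))) + - U (z i)) = V (gw (vs ! i ! j))" .
        have "U (z i) + U (\<phi> (wv (us ! i ! j))) + - U (z i) \<in> gset I"
          using U_closed[OF c(3)] U_closed[OF pc] by (intro gset_add) simp_all
        then have "U (z i) + U (\<phi> (wv (us ! i ! j))) + - U (z i) = gw (vs ! i ! j)"
          using V V_eq wg(2)[OF ij] by blast
        then show ?thesis using True by (simp add: Pair fu fv e)
      next
        case False
        then show ?thesis by (simp add: Pair fu fv)
      qed
    qed
    then have "orb (state_of (length X) ?u) (state_of (length X) ?v) ?f ?z"
      using auto_fgiso[OF \<phi>] unfolding orb_def by simp
    moreover have "?z i \<in> gset I" for i using U_closed z by simp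
    ultimately show ?R by blast
  next
    assume ?R
    then obtain f z where orb: "orb (state_of (length X) ?u) (state_of (length X) ?v) f z" and z: "\<And>i. z i \<in> gset I" by blast
    obtain g where f: "fgiso I I f g" using orb unfolding orb_def fst_state_of by blast
    let ?\<phi> = "restrict (\<lambda>a. V (ext f (U a))) (carrier F)"
    let ?z = "\<lambda>i. inv (V (z i))"
    have "?\<phi> (wv (us ! i ! j)) = inv (?z i) \<otimes> wv (vs ! i ! j) \<otimes> ?z i" if ij: "i < length us" "j < length (us ! i)" for i j
    proof -
      have "gw (snd (state_of (length X) ?v) (i, j)) = - z i + ext f (gw (snd (state_of (length X) ?u) (i, j))) + z i"
        using orb unfolding orb_def by (metis fst_conv)
      then have 1: "gw (vs ! i ! j) = - z i + ext f (gw (us ! i ! j)) + z i" using ij by (simp add: fu fv)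
      have x: "ext f (gw (us ! i ! j)) \<in> gset I" using fgiso_ext(1)[OF f wg(1)[OF ij]] .
      have "wv (vs ! i ! j) = inv (V (z i)) \<otimes> V (ext f (gw (us ! i ! j))) \<otimes> V (z i)"
        using V_gw[OF ws(2)[OF ij]] 1 z x gset_add by (simp add: V_add V_uminus)
      moreover have "?\<phi> (wv (us ! i ! j)) = V (ext f (gw (us ! i ! j)))"
        using wv_closed[OF ws(1)[OF ij]] V_gw[OF ws(1)[OF ij]] U_V[OF wg(1)[OF ij]] by simp
      moreover have "V (z i) \<in> carrier F" "V (ext f (gw (us ! i ! j))) \<in> carrier F"
        using V_closed z x by blast+
      ultimately show ?thesis by (simp add: m_assoc) (simp add: m_assoc[symmetric])
    qed
    moreover have "?z i \<in> carrier F" for i using V_closed z by simp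
    ultimately show ?L by (intro bexI[OF _ fgiso_auto[OF f]] exI[of _ ?z] allI impI conjI)
  qed
qed

end

section \<open>Decidability\<close>

definition grow :: "nat \<Rightarrow> (letter \<Rightarrow> word) list \<Rightarrow> nat \<Rightarrow> word list list list \<Rightarrow> word list list list" where
  "grow r T h L = L @ filter (\<lambda>s. tsize s \<le> h) (concat (map (\<lambda>s. moves r T s) L))"

definition stage :: "nat \<Rightarrow> (letter \<Rightarrow> word) list \<Rightarrow> nat \<Rightarrow> word list list \<Rightarrow> nat \<Rightarrow> word list list list" where
  "stage r T h u k = (grow r T h ^^ k) [u]"

definition stable :: "nat \<Rightarrow> (letter \<Rightarrow> word) list \<Rightarrow> nat \<Rightarrow> word list list \<Rightarrow> nat \<Rightarrow> bool" where
  "stable r T h u k \<longleftrightarrow> (\<forall>s\<in>set (stage r T h u (Suc k)). s \<in> set (stage r T h u k))"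

lemma set_stage_Suc: "set (stage r T h u (Suc k)) =
    set (stage r T h u k) \<union> {s'. \<exists>s\<in>set (stage r T h u k). move_rel r T h s s'}"
  by (auto simp: stage_def grow_def move_rel_def)

lemma stage_reach: "s \<in> set (stage r T h u k) \<Longrightarrow> (move_rel r T h)\<^sup>*\<^sup>* u s"
proof (induction k arbitrary: s)
  case 0
  then show ?case by (simp add: stage_def)
next
  case (Suc k)
  then show ?case unfolding set_stage_Suc by (auto intro: rtranclp.rtrancl_into_rtrancl)
qed

lemma stage_start: "u \<in> set (stage r T h u k)"
proof (induction k)
  case 0
  show ?case by (simp add: stage_def)
next
  case (Suc k)
  then show ?case unfolding set_stage_Suc by simp
qed

text \<open>A single round without a new family already means closure under the moves, so nothing
  can be found later.\<close>

lemma stable_complete: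
  assumes "stable r T h u k" shows "s \<in> set (stage r T h u k) \<longleftrightarrow> (move_rel r T h)\<^sup>*\<^sup>* u s"
proof
  assume "(move_rel r T h)\<^sup>*\<^sup>* u s"
  then show "s \<in> set (stage r T h u k)"
  proof (induction rule: rtranclp_induct)
    case base
    show ?case by (rule stage_start)
  next
    case (step y z)
    then have "z \<in> set (stage r T h u (Suc k))" unfolding set_stage_Suc by blast
    then show ?case using assms by (simp add: stable_def)
  qed
qed (rule stage_reach)

lemma moves_shape: "s' \<in> set (moves r T s) \<Longrightarrow> map length s' = map length s"
proof -
  have "map length (s[i := conjb l (s ! i)]) = map length s" if "i < length s" for i l
    using that list_update_id[of "map length s" i] by (simp add: map_update conjb_def)
  then show "s' \<in> set (moves r T s) \<Longrightarrow> map length s' = map length s"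
    by (auto simp: moves_def set_conjs subst_def)
qed

lemma finite_states: "finite {s. good r s \<and> map length s = ms \<and> tsize s \<le> m}"
proof -
  let ?D = "{..<r} \<times> (UNIV :: bool set)"
  let ?W = "{w. set w \<subseteq> ?D \<and> length w \<le> m}"
  let ?B = "{b. set b \<subseteq> ?W \<and> length b \<le> sum_list ms}"
  let ?S = "{s. set s \<subseteq> ?B \<and> length s \<le> length ms}"
  have "finite ?D" by simp
  then have "finite ?W" by (rule finite_lists_length_le)
  then have "finite ?B" by (rule finite_lists_length_le)
  then have "finite ?S" by (rule finite_lists_length_le)
  moreover have "{s. good r s \<and> map length s = ms \<and> tsize s \<le> m} \<subseteq> ?S"
  proof (rule subsetI, rule CollectI)
    fix s assume "s \<in> {s. good r s \<and> map length s = ms \<and> tsize s \<le> m}"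
    then have s: "good r s" "map length s = ms" "tsize s \<le> m" by auto
    have "b \<in> ?B" if b: "b \<in> set s" for b
    proof (rule CollectI, rule conjI)
      have "length b \<in> set ms" using b s(2) by auto
      then show "length b \<le> sum_list ms" by (rule member_le_sum_list) simp
      have "wsum b \<in> set (map wsum s)" using b by simp
      then have "wsum b \<le> tsize s" unfolding tsize_def by (rule member_le_sum_list) simp
      then have wb: "wsum b \<le> m" using s(3) by simp
      show "set b \<subseteq> ?W"
      proof (rule subsetI, rule CollectI, rule conjI)
        fix w assume w: "w \<in> set b"
        have "length w \<in> set (map length b)" using w by simp
        then have "length w \<le> wsum b" unfolding wsum_def by (rule member_le_sum_list) simp
        then show "length w \<le> m" using wb by simp
        have "fst ` set w \<subseteq> {..<r}" using s(1) b w unfolding good_def by blast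
        then show "set w \<subseteq> ?D" by force
      qed
    qed
    moreover have "length s = length ms" using s(2) by auto
    ultimately show "set s \<subseteq> ?B \<and> length s \<le> length ms" by (intro conjI subsetI) simp_all
  qed
  ultimately show ?thesis by (rule finite_subset[rotated])
qed

lemma increasing_stabilizes:
  fixes f :: "nat \<Rightarrow> 'a set"
  assumes "finite A" "\<And>n. f n \<subseteq> A" "\<And>n. f n \<subseteq> f (Suc n)"
  shows "\<exists>n. f (Suc n) \<subseteq> f n"
proof (rule ccontr)
  assume no: "\<nexists>n. f (Suc n) \<subseteq> f n"
  have "n \<le> card (f n)" for n
  proof (induction n)
    case (Suc n)
    have "f n \<subset> f (Suc n)" using no assms(3)[of n] by auto
    then have "card (f n) < card (f (Suc n))"
      using psubset_card_mono finite_subset[OF assms(2,1)] by blast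
    then show ?case using Suc by simp
  qed simp
  then have "Suc (card A) \<le> card (f (Suc (card A)))" by blast
  also have "\<dots> \<le> card A" using assms card_mono by blast
  finally show False by simp
qed

lemma stable_exists:
  assumes T: "set T = tables r" and u: "good r u"
  shows "\<exists>k. stable r T h u k"
proof -
  \<comment> \<open>The start \<open>u\<close> is never tested against \<open>h\<close>, hence the
    summand \<open>tsize u\<close>. The shape is invariant under moves, which bounds the number of
    words.\<close>
  let ?A = "{s. good r s \<and> map length s = map length u \<and> tsize s \<le> h + tsize u}"
  have "map length s = map length u \<and> tsize s \<le> h + tsize u" if "(move_rel r T h)\<^sup>*\<^sup>* u s" for s
    using that by (induction rule: rtranclp_induct) (auto simp: move_rel_def moves_shape)
  then have "set (stage r T h u k) \<subseteq> ?A" for k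
    using stage_reach orb_moves[OF T u] by blast
  moreover have "set (stage r T h u k) \<subseteq> set (stage r T h u (Suc k))" for k
    unfolding set_stage_Suc by blast
  ultimately obtain k where "set (stage r T h u (Suc k)) \<subseteq> set (stage r T h u k)"
    using increasing_stabilizes[OF finite_states[of r "map length u" "h + tsize u"], of "\<lambda>k. set (stage r T h u k)"] by auto
  then show ?thesis unfolding stable_def by blast
qed

subsection \<open>The search is recursive\<close>

definition encl :: "letter \<Rightarrow> nat" where
  "encl = (\<lambda>(i, b). 2 * i + of_bool b)"

abbreviation encW :: "word \<Rightarrow> nat" where "encW \<equiv> encL encl"
abbreviation encS :: "word list list \<Rightarrow> nat" where "encS \<equiv> encL (encL encW)"

lemma instance_code_enc: "instance_code = encP encS encS"
  by (simp add: instance_code_def blocks_code_def[abs_def] word_code_def[abs_def] encP_def[abs_def]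
      encL_def[abs_def] encl_def case_prod_unfold)

lemma inj_encl: "inj encl"
proof (rule injI)
  fix x y assume "encl x = encl y"
  then have "2 * fst x + of_bool (snd x) = 2 * fst y + (of_bool (snd y) :: nat)"
    by (simp add: encl_def case_prod_unfold)
  then show "x = y" by (cases x; cases y; cases "snd x"; cases "snd y"; simp; presburger)
qed

lemma surj_encl: "surj encl"
proof (rule surjI)
  show "encl (n div 2, odd n) = n" for n
    by (cases "even n") (simp_all add: encl_def)
qed

lemmas inj_encS = inj_encL[OF inj_encL[OF inj_encL[OF inj_encl]]]
lemmas surj_encS = surj_encL[OF surj_encL[OF surj_encL[OF surj_encl]]]

lemmas cmp_map' = cmp_map[unfolded case_prod_unfold]
lemmas cmp_foldr' = cmp_foldr[unfolded case_prod_unfold]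
lemmas cmp_filter' = cmp_filter[unfolded case_prod_unfold]
lemmas cmp_Ball' = cmp_Ball[unfolded case_prod_unfold]
lemmas cmp_sum_list' = cmp_sum_list[unfolded case_prod_unfold]
lemmas cmp_funpow' = cmp_funpow[unfolded case_prod_unfold]
lemmas cmp_minimise' = cmp_minimise[unfolded case_prod_unfold]

text \<open>The two letters of index \<open>i\<close> have the codes \<open>2 * i\<close> and
  \<open>2 * i + 1\<close>, so inversion flips the last bit.\<close>

lemma cmp_linv: assumes "cmp ea encl f" shows "cmp ea encl (\<lambda>a. linv (f a))"
proof -
  have par: "rec_nat 0 (\<lambda>y r. 1 - r) c = c mod 2" for c :: nat
    by (induction c) (auto simp: mod_Suc)
  have "rec1 (\<lambda>c. rec_nat 0 (\<lambda>y r. 1 - r) c)"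
    by (rule rec1_rec_nat, rule rec3_comp(2)[OF rec2_sub _ rec3_proj(2)])
       (rule rec3_comp(1)[OF rec1_const rec3_proj(1)])
  then have p: "rec1 (\<lambda>c. c mod 2)" by (simp only: par)
  have "cmp encl encl linv"
  proof (rule cmpI)
    show "rec1 (\<lambda>c. if c mod 2 = 0 then Suc c else c - 1)" by (rule rec1_if[OF p rec1_Suc rec1_pred])
    show "(if encl x mod 2 = 0 then Suc (encl x) else encl x - 1) = encl (linv x)" for x
      by (cases x; cases "snd x") (simp_all add: encl_def)
  qed
  then show ?thesis using assms by (rule cmp_comp)
qed

text \<open>A total head function: the default is the letter with code 0, the value that decoding
  the empty list happens to return.\<close>

definition hd0 :: "word \<Rightarrow> letter" where
  "hd0 w = (if w = [] then (0, False) else hd w)"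

lemma prod_decode_0: "prod_decode 0 = (0, 0)"
  using prod_encode_inverse[of "(0, 0)"] by (simp add: prod_encode_def)

lemma cmp_hd0: assumes "cmp ea encW f" shows "cmp ea encl (\<lambda>a. hd0 (f a))"
proof -
  have "cmp encW encl hd0"
  proof (rule cmpI)
    show "rec1 (\<lambda>c. p1 (c - 1))" by (rule rec1_comp[OF rec1_p1 rec1_pred])
    show "p1 (encW x - 1) = encl (hd0 x)" for x
      by (cases x) (simp_all add: hd0_def encL_def encl_def prod_decode_0)
  qed
  then show ?thesis using assms by (rule cmp_comp)
qed

lemma cmp_tl: assumes "cmp ea (encL ex) f" shows "cmp ea (encL ex) (\<lambda>a. tl (f a))"
proof -
  have "cmp (encL ex) (encL ex) tl"
  proof (rule cmpI)
    show "rec1 (\<lambda>c. p2 (c - 1))" by (rule rec1_comp[OF rec1_p2 rec1_pred])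
    show "p2 (encL ex x - 1) = encL ex (tl x)" for x
      by (cases x) (simp_all add: encL_def prod_decode_0)
  qed
  then show ?thesis using assms by (rule cmp_comp)
qed

lemma cmp_push: assumes "cmp ea encl f" "cmp ea encW g" shows "cmp ea encW (\<lambda>a. push (f a) (g a))"
proof -
  have "cmp ea encW (\<lambda>a. if g a \<noteq> [] \<and> hd0 (g a) = linv (f a) then tl (g a) else f a # g a)"
    by (rule cmp_if cmp_and cmp_not cmp_eq[OF inj_encL[OF inj_encl]] cmp_eq[OF inj_encl] cmp_const cmp_hd0
        cmp_linv cmp_tl cmp_Cons assms)+
  moreover have "(if w \<noteq> [] \<and> hd0 w = linv l then tl w else l # w) = push l w" for l w
    by (cases w) (auto simp: hd0_def)
  ultimately show ?thesis by simp
qed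

lemma cmp_red: assumes "cmp ea encW f" shows "cmp ea encW (\<lambda>a. red (f a))"
  unfolding red_def
  by (rule cmp_foldr'[OF cmp_const assms]) (rule cmp_id cmp_push cmp_fst cmp_snd)+

lemma cmp_subst:
  assumes t: "cmp encl encW t" and s: "cmp ea encS s" shows "cmp ea encS (\<lambda>a. subst t (s a))"
  unfolding subst_def
  by (rule cmp_map'[OF s]) (rule cmp_id cmp_map' cmp_red cmp_concat cmp_comp[OF t] cmp_snd)+

lemma cmp_conjb: assumes s: "cmp ea (encL encW) s" shows "cmp ea (encL encW) (\<lambda>a. conjb l (s a))"
  unfolding conjb_def
  by (rule cmp_map'[OF s]) (rule cmp_id cmp_const cmp_red cmp_Cons cmp_append cmp_snd)+

lemma cmp_conjs:
  assumes s: "cmp ea encS s" shows "cmp ea (encL encS) (\<lambda>a. conjs l (s a))"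
proof -
  have "cmp ea (encP encS (encL encS))
     (\<lambda>a. foldr (\<lambda>b q. (b # fst q, (conjb l b # fst q) # map (\<lambda>x. b # x) (snd q))) (s a) ([], []))"
    by (rule cmp_foldr'[OF cmp_const s])
       (rule cmp_id cmp_pair cmp_map' cmp_Cons cmp_conjb cmp_fst cmp_snd)+
  then have "cmp ea (encL encS)
     (\<lambda>a. snd (foldr (\<lambda>b q. (b # fst q, (conjb l b # fst q) # map (\<lambda>x. b # x) (snd q))) (s a) ([], [])))"
    by (rule cmp_snd)
  then show ?thesis by (simp add: conjs_def case_prod_unfold)
qed

lemma cmp_moves:
  assumes T: "\<And>t. t \<in> set T \<Longrightarrow> cmp encl encW t" and s: "cmp ea encS s"
  shows "cmp ea (encL encS) (\<lambda>a. moves r T (s a))"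
  unfolding moves_def
  by (rule cmp_append cmp_concat cmp_map_fixed cmp_subst[OF T s] cmp_conjs[OF s] | assumption)+

lemma cmp_tsize: assumes "cmp ea encS s" shows "cmp ea encN (\<lambda>a. tsize (s a))"
  unfolding tsize_def wsum_def
  by (rule cmp_sum_list'[OF assms]) (rule cmp_id cmp_sum_list' cmp_length cmp_snd)+

lemma cmp_num_words: assumes "cmp ea encS s" shows "cmp ea encN (\<lambda>a. num_words (s a))"
  unfolding num_words_def
  by (rule cmp_sum_list'[OF assms]) (rule cmp_id cmp_length cmp_snd)+

lemma cmp_grow:
  assumes T: "\<And>t. t \<in> set T \<Longrightarrow> cmp encl encW t" and h: "cmp ea encN h" and L: "cmp ea (encL encS) L"
  shows "cmp ea (encL encS) (\<lambda>a. grow r T (h a) (L a))"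
  unfolding grow_def
  by (rule cmp_id L cmp_append cmp_filter' cmp_concat cmp_map' cmp_moves[OF T] cmp_le cmp_tsize
      cmp_comp[OF h] cmp_fst cmp_snd | assumption)+

lemma cmp_stage:
  assumes T: "\<And>t. t \<in> set T \<Longrightarrow> cmp encl encW t" and h: "cmp ea encN h" and u: "cmp ea encS u" and k: "cmp ea encN k"
  shows "cmp ea (encL encS) (\<lambda>a. stage r T (h a) (u a) (k a))"
  unfolding stage_def
proof (rule cmp_funpow'[OF k])
  show "cmp ea (encL encS) (\<lambda>a. [u a])" by (rule cmp_Cons[OF u cmp_const])
  show "cmp (encP ea (encL encS)) (encL encS) (\<lambda>p. grow r T (h (fst p)) (snd p))"
    by (rule cmp_grow[OF T]) (assumption | rule cmp_id cmp_comp[OF h] cmp_fst cmp_snd)+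
qed

text \<open>Membership in \<open>instances\<close>, spelled out with quantifiers over lists so that
  \<open>cmp_Ball\<close> and \<open>cmp_member\<close> apply.\<close>

definition wf_instance :: "nat \<Rightarrow> word list list \<times> word list list \<Rightarrow> bool" where
  "wf_instance r p \<longleftrightarrow> map length (fst p) = map length (snd p) \<and>
     (\<forall>b\<in>set (fst p). \<forall>w\<in>set b. \<forall>l\<in>set w. l \<in> set (letters r)) \<and>
     (\<forall>b\<in>set (snd p). \<forall>w\<in>set b. \<forall>l\<in>set w. l \<in> set (letters r))"

lemma wf_instance_iff: "wf_instance r p \<longleftrightarrow> p \<in> instances r"
  by (cases p) (auto simp: wf_instance_def instances_def set_letters words_iff image_subset_iff in_lists_conv_set)

text \<open>Malformed inputs are replaced by the empty instance, so that the search always terminates.\<close>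

definition left :: "nat \<Rightarrow> word list list \<times> word list list \<Rightarrow> word list list" where
  "left r p = (if wf_instance r p then map (map (\<lambda>w. red w)) (fst p) else [])"

definition right :: "nat \<Rightarrow> word list list \<times> word list list \<Rightarrow> word list list" where
  "right r p = (if wf_instance r p then map (map (\<lambda>w. red w)) (snd p) else [])"

text \<open>The bound \<open>3 * n + 2 * m\<close> of \<open>moves_complete\<close>, written with
  additions only to match \<open>cmp_add\<close>.\<close>

definition bound :: "nat \<Rightarrow> word list list \<times> word list list \<Rightarrow> nat" where
  "bound r p = (let n = tsize (left r p) + tsize (right r p); m = num_words (left r p) in n + n + n + (m + m))"

lemma cmp_wf_instance: "cmp instance_code encB (wf_instance r)"
proof -
  have eq: "inj (encL encN)" by (rule inj_encL) (simp add: encN_def inj_def)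
  show ?thesis
    unfolding wf_instance_def[abs_def] instance_code_enc
    by (rule cmp_id cmp_const cmp_and cmp_eq[OF eq] cmp_member[OF inj_encl] cmp_Ball' cmp_map' cmp_length cmp_fst cmp_snd)+
qed

lemma cmp_left: "cmp instance_code encS (left r)"
  unfolding left_def[abs_def]
  by (rule cmp_if[OF cmp_wf_instance _ cmp_const], unfold instance_code_enc)
     (rule cmp_id cmp_map' cmp_red cmp_fst cmp_snd)+

lemma cmp_right: "cmp instance_code encS (right r)"
  unfolding right_def[abs_def]
  by (rule cmp_if[OF cmp_wf_instance _ cmp_const], unfold instance_code_enc)
     (rule cmp_id cmp_map' cmp_red cmp_fst cmp_snd)+

lemma cmp_bound: "cmp instance_code encN (bound r)"
  unfolding bound_def[abs_def] Let_def
  by (rule cmp_add cmp_tsize cmp_num_words cmp_left cmp_right)+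

lemma cmp_table: "cmp encl encW (table r f)"
proof (rule cmpI)
  let ?g = "\<lambda>n. encW (table r f (inv_into UNIV encl n))"
  have inv: "encl (inv_into UNIV encl n) = n" for n using surj_encl by (rule surj_f_inv_f)
  \<comment> \<open>The empty word has code 0, so only codes of letters with index below
    \<open>r\<close> lie in the support.\<close>
  have "{n. ?g n \<noteq> 0} \<subseteq> {..< 2 * r}"
  proof
    fix n assume "n \<in> {n. ?g n \<noteq> 0}"
    then have "fst (inv_into UNIV encl n) < r" by (auto simp: table_def encL_def split: if_splits)
    moreover have "n \<le> 2 * fst (inv_into UNIV encl n) + 1"
      using inv[of n] by (cases "inv_into UNIV encl n"; cases "snd (inv_into UNIV encl n)") (auto simp: encl_def)
    ultimately show "n \<in> {..< 2 * r}" by simp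
  qed
  then show "rec1 ?g" by (intro rec1_finite_support finite_subset[OF _ finite_lessThan])
  show "?g (encl l) = encW (table r f l)" for l using inj_encl by simp
qed

text \<open>Every number is the code of an input, so a function that is correct on codes computes
  the characteristic function everywhere.\<close>

lemma decidableI:
  assumes "inj code" "surj code" "cmp code encB (\<lambda>x. x \<in> A)"
  shows "decidable code A"
  using assms(3)
proof (rule cmpE)
  fix g assume g: "rec1 g" "\<And>x. g (code x) = encB (x \<in> A)"
  have "g n = of_bool (n \<in> code ` A)" for n
  proof -
    obtain x where "n = code x" using assms(2) by (auto simp: surj_def)
    then show ?thesis using g(2) by (simp add: encB_def inj_image_mem_iff[OF assms(1)])
  qed
  then show ?thesis using g(1) by (simp add: decidable_def rec1_def)
qed

lemma good_left: "good r (left r p)" and good_right: "good r (right r p)"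
proof -
  have *: "good r (map (map red) s)" if "\<forall>b\<in>set s. \<forall>w\<in>set b. \<forall>l\<in>set w. l \<in> set (letters r)" for s
    unfolding good_def
  proof (intro ballI conjI)
    fix b w assume "b \<in> set (map (map red) s)" "w \<in> set b"
    then obtain b' w' where w: "b' \<in> set s" "w' \<in> set b'" "w = red w'" by auto
    then have "fst ` set w' \<subseteq> {..<r}" using that by (auto simp: set_letters)
    then show "reduced w" "fst ` set w \<subseteq> {..<r}" using w(3) set_red by simp_all
  qed
  show "good r (left r p)" "good r (right r p)"
  proof -
    have "good r []" by (simp add: good_def)
    then show "good r (left r p)" "good r (right r p)"
      using * by (simp_all add: left_def right_def wf_instance_def)
  qed
qed

theorem theorem6p1:
  fixes F :: "('a, 'b) monoid_scheme" and X :: "'a list"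
  assumes "free_group_basis F X"
  shows "decidable instance_code
    {(us, vs) \<in> instances (length X).
       \<exists>\<phi> \<in> auto F. \<exists>z. \<forall>i < length us. z i \<in> carrier F \<and>
         (\<forall>j < length (us ! i).
            \<phi> (word_val F X (us ! i ! j)) =
              inv\<^bsub>F\<^esub> (z i) \<otimes>\<^bsub>F\<^esub> word_val F X (vs ! i ! j) \<otimes>\<^bsub>F\<^esub> z i)}"
    (is "decidable _ ?A")
proof (rule decidableI)
  let ?r = "length X"
  interpret group F using assms by (simp add: free_group_basis_def)
  interpret free_basis F X using assms by unfold_locales
  show "inj instance_code" "surj instance_code"
    unfolding instance_code_enc by (intro inj_encP surj_encP inj_encS surj_encS)+
  \<comment> \<open>The group is fixed before the algorithm, so a list of its finitely many tables
    may simply be chosen.\<close>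
  obtain T where T: "set T = tables ?r" using finite_list[OF finite_tables] by blast
  have cT: "cmp encl encW t" if "t \<in> set T" for t
    using that T cmp_table unfolding tables_def by auto
  let ?stable = "\<lambda>k p. stable ?r T (bound ?r p) (left ?r p) k"
  let ?k = "\<lambda>p. LEAST k. ?stable k p"
  have ex: "\<exists>k. ?stable k p" for p using stable_exists[OF T good_left] .
  have stable: "cmp (encP encN instance_code) encB (\<lambda>q. ?stable (fst q) (snd q))"
    unfolding stable_def
    by (rule cmp_id cmp_Ball' cmp_member[OF inj_encS] cmp_stage[OF cT] cmp_comp[OF cmp_bound]
       cmp_comp[OF cmp_left] cmp_Suc cmp_fst cmp_snd | assumption)+
  \<comment> \<open>Regularity of this minimisation is termination of the search; the number of
    rounds needs no explicit bound.\<close>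
  have "cmp instance_code encN ?k"
    by (rule cmp_minimise'[OF \<open>surj instance_code\<close> stable ex])
  then have "cmp instance_code encB (\<lambda>p. wf_instance ?r p \<and>
      right ?r p \<in> set (stage ?r T (bound ?r p) (left ?r p) (?k p)))"
    by (intro cmp_and cmp_wf_instance cmp_member[OF inj_encS cmp_stage[OF cT cmp_bound cmp_left] cmp_right])
  moreover have "wf_instance ?r p \<and> right ?r p \<in> set (stage ?r T (bound ?r p) (left ?r p) (?k p)) \<longleftrightarrow> p \<in> ?A" for p
  proof (cases "wf_instance ?r p")
    case True
    obtain us vs where p: "p = (us, vs)" by (cases p)
    have inst: "us \<in> lists (lists (words ?r))" "vs \<in> lists (lists (words ?r))" "map length us = map length vs"
      using True by (auto simp: wf_instance_iff instances_def p)
    have u: "left ?r p = map (map red) us" and v: "right ?r p = map (map red) vs"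
      using True by (simp_all add: left_def right_def p)
    let ?u = "left ?r p" and ?v = "right ?r p"
    have shape: "map length ?u = map length ?v" using inst(3) by (simp add: u v o_def)
    have "?v \<in> set (stage ?r T (bound ?r p) ?u (?k p)) \<longleftrightarrow> (move_rel ?r T (bound ?r p))\<^sup>*\<^sup>* ?u ?v"
      by (rule stable_complete) (rule LeastI_ex[OF ex])
    also have "\<dots> \<longleftrightarrow> (\<exists>f z. orb (state_of ?r ?u) (state_of ?r ?v) f z \<and> (\<forall>i. z i \<in> gset I))"
    proof
      assume "(move_rel ?r T (bound ?r p))\<^sup>*\<^sup>* ?u ?v"
      then show "\<exists>f z. orb (state_of ?r ?u) (state_of ?r ?v) f z \<and> (\<forall>i. z i \<in> gset I)"
        using orb_moves[OF T good_left] by blast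
    next
      assume "\<exists>f z. orb (state_of ?r ?u) (state_of ?r ?v) f z \<and> (\<forall>i. z i \<in> gset I)"
      then show "(move_rel ?r T (bound ?r p))\<^sup>*\<^sup>* ?u ?v"
        using moves_complete[OF T good_left good_right shape] by (auto simp: bound_def Let_def)
    qed
    also have "\<dots> \<longleftrightarrow> p \<in> ?A"
      using orbit_iff[OF inst] True by (simp add: u v) (simp add: p wf_instance_iff)
    finally show ?thesis using True by simp
  next
    case False
    then show ?thesis by (cases p) (simp add: wf_instance_iff)
  qed
  ultimately show "cmp instance_code encB (\<lambda>p. p \<in> ?A)" by simp
qed

end
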